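(* Let $\Gamma$ be a finite subgroup of $\mathbf{SL}_4(\mathbb{C})$ and let $\gamma_0,\dots,\gamma_l$ be its irreducible finite-dimensional complex representations up to equivalence, with $\gamma_0$ trivial. For $(p,q,r)\in\mathbb{N}^3$ let $m_i(p,q,r)$ be the multiplicity of $\gamma_i$ in $\pi_{p,q,r}|_\Gamma$, and for $i\in\{0,\dots,l\}$ set $$P_\Gamma(t,u,w)_i=\sum_{p=0}^\infty\sum_{q=0}^\infty\sum_{r=0}^\infty m_i(p,q,r)\,t^pu^qw^r\in\mathbb{C}[[t,u,w]].$$ Then the formal power series $P_\Gamma(t,u,w)_i$ are rational functions: there exist polynomials $N_\Gamma(t,u,w)_0,\dots,N_\Gamma(t,u,w)_l$ and a nonzero polynomial $D_\Gamma(t,u,w)$ in $\mathbb{Q}[t,u,w]$ such that $$P_\Gamma(t,u,w)_i=\frac{N_\Gamma(t,u,w)_i}{D_\Gamma(t,u,w)}\qquad\text{for all } i\in\{0,\dots,l\}.$$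
   Context: $\mathbb{N}=\{0,1,2,\dots\}$. Let $\mathfrak{h}$ be a Cartan subalgebra of $\mathfrak{sl}_4\mathbb{C}$ with corresponding fundamental weights $\varpi_1,\varpi_2,\varpi_3$ (in the standard ordering, so that $\varpi_1$ is the highest weight of the natural representation $\mathbb{C}^4$, $\varpi_2$ that of $\mathbb{C}^4\wedge\mathbb{C}^4$ and $\varpi_3$ that of $(\mathbb{C}^4)^*$). For $(p,q,r)\in\mathbb{N}^3$, $\pi_{p,q,r}$ is the irreducible representation of $\mathbf{SL}_4(\mathbb{C})$ of highest weight $p\varpi_1+q\varpi_2+r\varpi_3$. Its restriction to $\Gamma$ decomposes as $\pi_{p,q,r}|_\Gamma=\bigoplus_{i=0}^l m_i(p,q,r)\gamma_i$. *)

theory Defs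
  imports
    "Jordan_Normal_Form.VS_Connect"
    "Jordan_Normal_Form.Determinant"
    "HOL-Computational_Algebra.Computational_Algebra"
begin

definition GL :: "nat \<Rightarrow> complex mat monoid" where
  "GL n = units_of (ring_mat TYPE(complex) n ())"

definition SL :: "nat \<Rightarrow> complex mat monoid" where
  "SL n = GL n\<lparr>carrier := {A \<in> carrier_mat n n. det A = 1}\<rparr>"

(* Finite-dimensional complex representations are matrix representations, acting on
   column vectors; the degree is read off from the image of the identity.  A representation
   of G is also one of each subgroup H, taken as the group G\<lparr>carrier := H\<rparr>. *)

definition rep_dim :: "('a, 'b) monoid_scheme \<Rightarrow> ('a \<Rightarrow> complex mat) \<Rightarrow> nat" where
  "rep_dim G \<rho> = dim_row (\<rho> \<one>\<^bsub>G\<^esub>)"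

definition representation :: "('a, 'b) monoid_scheme \<Rightarrow> ('a \<Rightarrow> complex mat) \<Rightarrow> bool" where
  "representation G \<rho> \<longleftrightarrow> \<rho> \<in> hom G (GL (rep_dim G \<rho>))"

definition irreducible_rep :: "('a, 'b) monoid_scheme \<Rightarrow> ('a \<Rightarrow> complex mat) \<Rightarrow> bool" where
  "irreducible_rep G \<rho> \<longleftrightarrow>
     representation G \<rho> \<and> rep_dim G \<rho> > 0 \<and>
     (\<forall>W. VectorSpace.subspace class_ring W (module_vec TYPE(complex) (rep_dim G \<rho>)) \<longrightarrow>
          (\<forall>g\<in>carrier G. \<forall>w\<in>W. \<rho> g *\<^sub>v w \<in> W) \<longrightarrow>
          W = {0\<^sub>v (rep_dim G \<rho>)} \<or> W = carrier_vec (rep_dim G \<rho>))"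

definition equivalent_rep ::
    "('a, 'b) monoid_scheme \<Rightarrow> ('a \<Rightarrow> complex mat) \<Rightarrow> ('a \<Rightarrow> complex mat) \<Rightarrow> bool" where
  "equivalent_rep G \<rho> \<sigma> \<longleftrightarrow>
     rep_dim G \<rho> = rep_dim G \<sigma> \<and>
     (\<exists>T\<in>carrier (GL (rep_dim G \<rho>)). \<forall>g\<in>carrier G. T * \<rho> g = \<sigma> g * T)"

definition trivial_rep :: "'a \<Rightarrow> complex mat" where
  "trivial_rep g = 1\<^sub>m 1"

definition direct_sum_rep :: "('a \<Rightarrow> complex mat) list \<Rightarrow> 'a \<Rightarrow> complex mat" where
  "direct_sum_rep \<rho>s g = diag_block_mat (map (\<lambda>\<rho>. \<rho> g) \<rho>s)"

(* The number of summands equivalent to \<sigma> in a decomposition of \<rho> into irreducibles.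
   Such a decomposition exists and this number does not depend on it when G is finite. *)
definition multiplicity_rep ::
    "('a, 'b) monoid_scheme \<Rightarrow> ('a \<Rightarrow> complex mat) \<Rightarrow> ('a \<Rightarrow> complex mat) \<Rightarrow> nat" where
  "multiplicity_rep G \<sigma> \<rho> =
     (THE m. \<exists>\<tau>s. (\<forall>\<tau>\<in>set \<tau>s. irreducible_rep G \<tau>) \<and>
                   equivalent_rep G \<rho> (direct_sum_rep \<tau>s) \<and>
                   m = length (filter (equivalent_rep G \<sigma>) \<tau>s))"

(* Polynomial functions of the matrix entries.  As SL n is Zariski closed in the n x n matrices,
   their restrictions to SL n are exactly its regular functions. *)
inductive polynomial_fun :: "nat \<Rightarrow> (complex mat \<Rightarrow> complex) \<Rightarrow> bool" for n :: nat where
  const: "polynomial_fun n (\<lambda>A. c)"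
| entry: "i < n \<Longrightarrow> j < n \<Longrightarrow> polynomial_fun n (\<lambda>A. A $$ (i, j))"
| add: "polynomial_fun n f \<Longrightarrow> polynomial_fun n g \<Longrightarrow> polynomial_fun n (\<lambda>A. f A + g A)"
| mult: "polynomial_fun n f \<Longrightarrow> polynomial_fun n g \<Longrightarrow> polynomial_fun n (\<lambda>A. f A * g A)"

(* Without regularity, "representation of SL n" would include twists by wild automorphisms
   of the complex numbers. *)
definition rational_rep_SL :: "nat \<Rightarrow> (complex mat \<Rightarrow> complex mat) \<Rightarrow> bool" where
  "rational_rep_SL n \<rho> \<longleftrightarrow>
     representation (SL n) \<rho> \<and>
     (\<forall>i<rep_dim (SL n) \<rho>. \<forall>j<rep_dim (SL n) \<rho>.
        \<exists>f. polynomial_fun n f \<and> (\<forall>A\<in>carrier (SL n). \<rho> A $$ (i, j) = f A))"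

(* Weights are written as characters of the diagonal torus.  The k-th exterior power of the
   natural representation has highest weight vector e_1 \<and> ... \<and> e_k, on which the
   diagonal matrix with entries x_1, ..., x_n acts by x_1 ... x_k. *)
definition fundamental_weight :: "nat \<Rightarrow> complex mat \<Rightarrow> complex" where
  "fundamental_weight k A = (\<Prod>j<k. A $$ (j, j))"

definition has_highest_weight_SL ::
    "nat \<Rightarrow> (complex mat \<Rightarrow> complex mat) \<Rightarrow> (complex mat \<Rightarrow> complex) \<Rightarrow> bool" where
  "has_highest_weight_SL n \<rho> \<chi> \<longleftrightarrow>
     (\<exists>v\<in>carrier_vec (rep_dim (SL n) \<rho>). v \<noteq> 0\<^sub>v (rep_dim (SL n) \<rho>) \<and>
        (\<forall>A\<in>carrier (SL n). upper_triangular A \<and> (\<forall>i<n. A $$ (i, i) = 1) \<longrightarrow> \<rho> A *\<^sub>v v = v) \<and>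
        (\<forall>A\<in>carrier (SL n). diagonal_mat A \<longrightarrow> \<rho> A *\<^sub>v v = \<chi> A \<cdot>\<^sub>v v))"

definition irreducible_rep_SL4 ::
    "nat \<Rightarrow> nat \<Rightarrow> nat \<Rightarrow> (complex mat \<Rightarrow> complex mat) \<Rightarrow> bool" where
  "irreducible_rep_SL4 p q r \<rho> \<longleftrightarrow>
     rational_rep_SL 4 \<rho> \<and> irreducible_rep (SL 4) \<rho> \<and>
     has_highest_weight_SL 4 \<rho>
       (\<lambda>A. fundamental_weight 1 A ^ p * fundamental_weight 2 A ^ q * fundamental_weight 3 A ^ r)"

(* R[[t,u,w]] is encoded as R[[w]][[u]][[t]]: the coefficient of t^p u^q w^r is a p q r.
   Likewise R[t,u,w] is encoded as R[w][u][t]. *)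
definition fps3 :: "(nat \<Rightarrow> nat \<Rightarrow> nat \<Rightarrow> 'a) \<Rightarrow> 'a fps fps fps" where
  "fps3 a = Abs_fps (\<lambda>p. Abs_fps (\<lambda>q. Abs_fps (\<lambda>r. a p q r)))"

definition fps3_of_poly :: "rat poly poly poly \<Rightarrow> complex fps fps fps" where
  "fps3_of_poly f = fps3 (\<lambda>p q r. of_rat (coeff (coeff (coeff f p) q) r))"

definition multiplicity_series ::
    "complex mat set \<Rightarrow> (nat \<Rightarrow> nat \<Rightarrow> nat \<Rightarrow> complex mat \<Rightarrow> complex mat) \<Rightarrow>
     (complex mat \<Rightarrow> complex mat) \<Rightarrow> complex fps fps fps" where
  "multiplicity_series \<Gamma> \<pi> \<sigma> =
     fps3 (\<lambda>p q r. of_nat (multiplicity_rep (SL 4\<lparr>carrier := \<Gamma>\<rparr>) \<sigma> (\<pi> p q r)))"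

end

theory Submission
  imports
    Defs
    "Jordan_Normal_Form.Spectral_Radius"
    "HOL-Library.Function_Algebras"
begin

unbundle no fps_syntax

text \<open>
  By character theory the multiplicity of a fixed irreducible representation of \<open>\<Gamma>\<close> is a linear
  combination of the traces of the elements of \<open>\<Gamma>\<close>, so it suffices that the generating function of the
  characters of \<open>\<pi>\<^sub>p\<^sub>q\<^sub>r\<close> at a fixed \<open>g\<close> is rational, where \<open>g\<close> may be replaced by a diagonal matrix.

  The matrix coefficients \<open>A \<mapsto> \<zeta> \<bullet> \<pi>\<^sub>p\<^sub>q\<^sub>r(A) v\<close> of the highest weight vector \<open>v\<close> form the span of the monomials
  of multidegree \<open>(p,q,r)\<close> in the 14 flag minors of \<open>A\<close> (the minors of its first one, two or three columns).
  Call an exponent vector standard if its monomial is not a combination of lexicographically smaller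
  monomials of the same multidegree.  The standard monomials of multidegree \<open>(p,q,r)\<close> are a basis on which
  the diagonal torus acts diagonally, and the standard exponents are closed downwards.  For a down-closed set of
  exponents rationality follows from Dickson's lemma, so no straightening law and no character
  formula is needed.

  The multiplicities are integers, so a rational-linear functional on the complex numbers finally moves
  the coefficients of the numerators and of the denominator into the rational numbers.
\<close>

subsection \<open>Linear algebra of column vectors\<close>



text \<open>The traces to be summed belong to a different representation for each (p,q,r), and \<pi>
  is known only through irreducibility and highest weights. The standard exponents remove this
  obstacle: they are defined from the flag minors as functions on \<open>SL 4\<close> alone, so one
  set serves all (p,q,r) and all elements of \<Gamma>, and only the weights attached to the 14
  coordinates depend on the element. Irreducibility identifies rows of length \<open>d\<close> with
  coefficient functions, so the representations need not be constructed.

  The critical point is that every monomial in the minors is a coefficient function, not only the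
  extremal one. The extremal coefficient is a product of powers of leading principal minors; by
  Cauchy-Binet its value at \<open>transpose_mat B * A\<close> is a positive combination of
  monomials in \<open>A\<close> times the same monomials in \<open>B\<close>, and positivity puts
  each monomial into the span of the sections of this kernel.\<close>

definition inj_mat :: "complex mat \<Rightarrow> bool" where
  "inj_mat A \<longleftrightarrow> (\<forall>v\<in>carrier_vec (dim_col A). A *\<^sub>v v = 0\<^sub>v (dim_row A) \<longrightarrow> v = 0\<^sub>v (dim_col A))"

lemma inj_matI:
  assumes "A \<in> carrier_mat m n" "\<And>v. v \<in> carrier_vec n \<Longrightarrow> A *\<^sub>v v = 0\<^sub>v m \<Longrightarrow> v = 0\<^sub>v n"
  shows "inj_mat A"
  using assms unfolding inj_mat_def by auto

lemma inj_matD: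
  assumes "inj_mat A" "A \<in> carrier_mat m n" "v \<in> carrier_vec n" "A *\<^sub>v v = 0\<^sub>v m"
  shows "v = 0\<^sub>v n"
  using assms unfolding inj_mat_def by auto

lemma eq_mat_on_vecI:
  fixes A B :: "complex mat"
  assumes A: "A \<in> carrier_mat m n" and B: "B \<in> carrier_mat m n"
    and eq: "\<And>v. v \<in> carrier_vec n \<Longrightarrow> A *\<^sub>v v = B *\<^sub>v v"
  shows "A = B"
proof (rule eq_matI)
  fix i j assume "i < dim_row B" "j < dim_col B"
  then have i: "i < m" and j: "j < n" using B by auto
  have "(A *\<^sub>v unit_vec n j) $ i = (B *\<^sub>v unit_vec n j) $ i"
    using eq by simp
  then show "A $$ (i,j) = B $$ (i,j)"
    using A B i j by (simp add: scalar_prod_right_unit)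
qed (use A B in auto)

lemma mult_mat_zero_vec [simp]: "(A :: complex mat) \<in> carrier_mat m n \<Longrightarrow> A *\<^sub>v 0\<^sub>v n = 0\<^sub>v m"
  by (intro eq_vecI) auto

lemma zero_mult_mat_vec [simp]: "v \<in> carrier_vec n \<Longrightarrow> 0\<^sub>m m n *\<^sub>v v = (0\<^sub>v m :: complex vec)"
  by (intro eq_vecI) auto

lemma square_inverse_exists:
  assumes A: "A \<in> carrier_mat n n" and inj: "inj_mat A"
  shows "\<exists>B\<in>carrier_mat n n. A * B = 1\<^sub>m n \<and> B * A = 1\<^sub>m n"
proof -
  have "det A \<noteq> 0"
    using det_0_iff_vec_prod_zero_field[OF A] inj_matD[OF inj A] by auto
  from det_non_zero_imp_unit[OF A this, of "()"]
  show ?thesis unfolding Units_def ring_mat_simps by auto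
qed

text \<open>If there were more columns than rows, padding with zero rows would give a singular
  square matrix, whose kernel vectors are also killed by \<open>A\<close>.\<close>

lemma inj_mat_dim_le:
  assumes A: "A \<in> carrier_mat m n" and inj: "inj_mat A"
  shows "n \<le> m"
proof (rule ccontr)
  assume "\<not> n \<le> m"
  define B where "B = mat n n (\<lambda>(i,j). if i < m then A $$ (i,j) else 0)"
  have B: "B \<in> carrier_mat n n" unfolding B_def by simp
  have "row B m = 0\<^sub>v n" using \<open>\<not> n \<le> m\<close> unfolding B_def by (intro eq_vecI) auto
  have nz: "\<exists>v. v \<in> carrier_vec n \<and> v \<noteq> 0\<^sub>v n \<and> B *\<^sub>v v = 0\<^sub>v n"
  proof (rule ccontr)
    assume "\<not> ?thesis"
    then have "inj_mat B" using B by (intro inj_matI[OF B]) blast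
    then obtain C where C: "C \<in> carrier_mat n n" "B * C = 1\<^sub>m n"
      using square_inverse_exists[OF B] by blast
    have "(B * C) $$ (m,m) = row B m \<bullet> col C m"
      using B C(1) \<open>\<not> n \<le> m\<close> by auto
    also have "\<dots> = 0" unfolding \<open>row B m = 0\<^sub>v n\<close> using C(1) by auto
    finally show False using C(2) \<open>\<not> n \<le> m\<close> by simp
  qed
  then obtain v where v: "v \<in> carrier_vec n" "v \<noteq> 0\<^sub>v n" "B *\<^sub>v v = 0\<^sub>v n" by blast
  have "A *\<^sub>v v = 0\<^sub>v m"
  proof (rule eq_vecI)
    fix i assume "i < dim_vec (0\<^sub>v m :: complex vec)"
    then have i: "i < m" by simp
    have "row A i = row B i" using i A \<open>\<not> n \<le> m\<close> unfolding B_def by (intro eq_vecI) auto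
    moreover have "(B *\<^sub>v v) $ i = 0" using v(3) i \<open>\<not> n \<le> m\<close> by simp
    ultimately show "(A *\<^sub>v v) $ i = 0\<^sub>v m $ i" using i A B \<open>\<not> n \<le> m\<close> by simp
  qed (use A in auto)
  then show False using inj_matD[OF inj A] v by blast
qed

text \<open>The Gram matrix \<open>H * C\<close>, with \<open>H\<close> the conjugate transpose, is
  injective because a kernel vector x satisfies |C x|^2 = 0. Its inverse times \<open>H\<close> is
  the left inverse.\<close>

lemma left_inverse_exists:
  assumes C: "C \<in> carrier_mat n k" and inj: "inj_mat C"
  shows "\<exists>L\<in>carrier_mat k n. L * C = 1\<^sub>m k"
proof -
  define H where "H = transpose_mat (map_mat cnj C)"
  have H: "H \<in> carrier_mat k n" unfolding H_def using C by simp
  have "inj_mat (H * C)"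
  proof (rule inj_matI)
    show "H * C \<in> carrier_mat k k" using H C by simp
    fix x :: "complex vec" assume x: "x \<in> carrier_vec k" and 0: "(H * C) *\<^sub>v x = 0\<^sub>v k"
    define y where "y = C *\<^sub>v x"
    have y: "y \<in> carrier_vec n" unfolding y_def using C x by simp
    have Hy: "H *\<^sub>v y = 0\<^sub>v k" unfolding y_def using 0 H C x by simp
    have "conjugate y = transpose_mat H *\<^sub>v conjugate x"
      unfolding y_def H_def using C x
      by (intro eq_vecI) (auto simp: scalar_prod_def conjugate_vec_def)
    then have "y \<bullet> conjugate y = y \<bullet> (transpose_mat H *\<^sub>v conjugate x)" by simp
    also have "\<dots> = conjugate x \<bullet> (H *\<^sub>v y)"
      using H y x transpose_vec_mult_scalar[OF H y, of "conjugate x"]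
      by (simp add: comm_scalar_prod[of "H *\<^sub>v y" k] comm_scalar_prod[of y n])
    also have "\<dots> = 0" unfolding Hy using x by simp
    finally have "y = 0\<^sub>v n" using y by simp
    then show "x = 0\<^sub>v k" using inj_matD[OF inj C x] unfolding y_def by simp
  qed
  then obtain B where B: "B \<in> carrier_mat k k" "B * (H * C) = 1\<^sub>m k"
    using square_inverse_exists[of "H * C" k] H C by auto
  show ?thesis
    by (rule bexI[of _ "B * H"]) (use B H C in auto)
qed

definition subspace_vec :: "nat \<Rightarrow> complex vec set \<Rightarrow> bool" where
  "subspace_vec n W \<longleftrightarrow> W \<subseteq> carrier_vec n \<and> 0\<^sub>v n \<in> W \<and>
     (\<forall>v\<in>W. \<forall>w\<in>W. v + w \<in> W) \<and> (\<forall>c. \<forall>v\<in>W. c \<cdot>\<^sub>v v \<in> W)"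

lemma subspace_vec_iff:
  "VectorSpace.subspace class_ring W (module_vec TYPE(complex) n) \<longleftrightarrow> subspace_vec n W"
  unfolding subspace_vec_def VectorSpace.subspace_def submodule_def
  using vec_vs[of n, where 'a = complex] vec_module[of n, where 'a = complex]
  by (auto simp: module_vec_simps class_ring_simps)

lemma irreducible_rep_iff:
  "irreducible_rep G \<rho> \<longleftrightarrow> representation G \<rho> \<and> rep_dim G \<rho> > 0 \<and>
     (\<forall>W. subspace_vec (rep_dim G \<rho>) W \<longrightarrow> (\<forall>g\<in>carrier G. \<forall>w\<in>W. \<rho> g *\<^sub>v w \<in> W) \<longrightarrow>
          W = {0\<^sub>v (rep_dim G \<rho>)} \<or> W = carrier_vec (rep_dim G \<rho>))"
  unfolding irreducible_rep_def subspace_vec_iff ..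

lemma subspace_vec_kernel:
  assumes "A \<in> carrier_mat m n"
  shows "subspace_vec n {v \<in> carrier_vec n. A *\<^sub>v v = 0\<^sub>v m}"
  using assms unfolding subspace_vec_def by (auto simp: mult_add_distrib_mat_vec[of _ m n] mult_mat_vec[of _ m n])

lemma subspace_vec_range:
  assumes A: "A \<in> carrier_mat m n"
  shows "subspace_vec m ((*\<^sub>v) A ` carrier_vec n)"
  unfolding subspace_vec_def
proof (intro conjI ballI allI)
  show "0\<^sub>v m \<in> (*\<^sub>v) A ` carrier_vec n"
    using A by (intro image_eqI[of _ _ "0\<^sub>v n"]) auto
next
  fix v w assume "v \<in> (*\<^sub>v) A ` carrier_vec n" "w \<in> (*\<^sub>v) A ` carrier_vec n"
  then obtain x y where "x \<in> carrier_vec n" "v = A *\<^sub>v x" "y \<in> carrier_vec n" "w = A *\<^sub>v y" by auto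
  then show "v + w \<in> (*\<^sub>v) A ` carrier_vec n"
    using A by (intro image_eqI[of _ _ "x + y"]) (auto simp: mult_add_distrib_mat_vec[of _ m n])
next
  fix c v assume "v \<in> (*\<^sub>v) A ` carrier_vec n"
  then obtain x where "x \<in> carrier_vec n" "v = A *\<^sub>v x" by auto
  then show "c \<cdot>\<^sub>v v \<in> (*\<^sub>v) A ` carrier_vec n"
    using A by (intro image_eqI[of _ _ "c \<cdot>\<^sub>v x"]) (auto simp: mult_mat_vec[of _ m n])
qed (use A in auto)

text \<open>Among injective matrices with range inside \<open>W\<close> take one with the most
  columns; a vector of \<open>W\<close> outside its range could be appended as a further column.
  Describing subspaces as ranges keeps subrepresentations and complements within matrix
  algebra.\<close>

lemma subspace_vec_basis:
  assumes W: "subspace_vec n W"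
  shows "\<exists>k. \<exists>C\<in>carrier_mat n k. inj_mat C \<and> W = (*\<^sub>v) C ` carrier_vec k"
proof -
  define P where "P = (\<lambda>k. \<exists>C\<in>carrier_mat n k. inj_mat C \<and> (*\<^sub>v) C ` carrier_vec k \<subseteq> W)"
  have Wsub: "W \<subseteq> carrier_vec n" and W0: "0\<^sub>v n \<in> W"
    and Wadd: "\<And>v w. v \<in> W \<Longrightarrow> w \<in> W \<Longrightarrow> v + w \<in> W" and Wsm: "\<And>c v. v \<in> W \<Longrightarrow> c \<cdot>\<^sub>v v \<in> W"
    using W unfolding subspace_vec_def by blast+
  have "P 0" unfolding P_def
  proof (rule bexI[of _ "0\<^sub>m n 0"], rule conjI)
    show "inj_mat (0\<^sub>m n 0)" by (rule inj_matI[of _ n 0]) auto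
    show "(*\<^sub>v) (0\<^sub>m n 0) ` carrier_vec 0 \<subseteq> W" using W0 by force
  qed simp
  moreover have bound: "\<forall>k. P k \<longrightarrow> k \<le> n" unfolding P_def using inj_mat_dim_le by blast
  ultimately obtain k where k: "P k" and max: "\<And>k'. P k' \<Longrightarrow> k' \<le> k"
    using GreatestI_nat[of P 0 n] Greatest_le_nat[of P _ n] by metis
  then obtain C where C: "C \<in> carrier_mat n k" "inj_mat C" "(*\<^sub>v) C ` carrier_vec k \<subseteq> W"
    unfolding P_def by blast
  have "W \<subseteq> (*\<^sub>v) C ` carrier_vec k"
  proof
    fix w assume w: "w \<in> W"
    have wc: "w \<in> carrier_vec n" using w Wsub by auto
    show "w \<in> (*\<^sub>v) C ` carrier_vec k"
    proof (rule ccontr)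
      assume nin: "w \<notin> (*\<^sub>v) C ` carrier_vec k"
      define D where "D = mat n (Suc k) (\<lambda>(i,j). if j < k then C $$ (i,j) else w $ i)"
      have D: "D \<in> carrier_mat n (Suc k)" unfolding D_def by simp
      have Dv: "D *\<^sub>v v = C *\<^sub>v vec k (\<lambda>i. v $ i) + (v $ k) \<cdot>\<^sub>v w" if "v \<in> carrier_vec (Suc k)" for v
        using that C(1) wc unfolding D_def by (intro eq_vecI) (auto simp: scalar_prod_def)
      have "inj_mat D"
      proof (rule inj_matI[OF D])
        fix v :: "complex vec" assume v: "v \<in> carrier_vec (Suc k)" and 0: "D *\<^sub>v v = 0\<^sub>v n"
        define u where "u = vec k (\<lambda>i. v $ i)"
        have u: "u \<in> carrier_vec k" unfolding u_def by simp
        have eq: "(C *\<^sub>v u) $ i + v $ k * w $ i = 0" if "i < n" for i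
        proof -
          have "(C *\<^sub>v u + (v $ k) \<cdot>\<^sub>v w) $ i = 0" using 0 Dv[OF v] that unfolding u_def by simp
          then show ?thesis using that wc by auto
        qed
        have vk: "v $ k = 0"
        proof (rule ccontr)
          assume nz: "v $ k \<noteq> 0"
          have "w = C *\<^sub>v ((- 1 / v $ k) \<cdot>\<^sub>v u)"
          proof (rule eq_vecI)
            fix i assume "i < dim_vec (C *\<^sub>v ((- 1 / v $ k) \<cdot>\<^sub>v u))"
            then have i: "i < n" using C(1) by simp
            have "(C *\<^sub>v ((- 1 / v $ k) \<cdot>\<^sub>v u)) $ i = (- 1 / v $ k) * (C *\<^sub>v u) $ i"
              using mult_mat_vec[OF C(1) u] C(1) i by simp
            moreover have "v $ k * w $ i = - (C *\<^sub>v u) $ i"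
              using eq[OF i] by (simp add: eq_neg_iff_add_eq_0 add.commute)
            then have "w $ i = - (C *\<^sub>v u) $ i / v $ k"
              using nz by (metis nonzero_mult_div_cancel_left)
            ultimately show "w $ i = (C *\<^sub>v ((- 1 / v $ k) \<cdot>\<^sub>v u)) $ i" by simp
          qed (use wc C(1) in auto)
          then show False using nin u by auto
        qed
        have "C *\<^sub>v u = 0\<^sub>v n" using eq vk C(1) by (intro eq_vecI) auto
        then have "u = 0\<^sub>v k" using inj_matD[OF C(2,1) u] by blast
        then have "v $ i = 0" if "i < k" for i using that unfolding u_def by (metis index_vec index_zero_vec(1))
        then show "v = 0\<^sub>v (Suc k)" using vk v by (intro eq_vecI) (auto simp: less_Suc_eq)
      qed
      moreover have "(*\<^sub>v) D ` carrier_vec (Suc k) \<subseteq> W"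
      proof (rule image_subsetI)
        fix x :: "complex vec" assume x: "x \<in> carrier_vec (Suc k)"
        have "C *\<^sub>v vec k (($) x) \<in> W" using C(3) by auto
        then show "D *\<^sub>v x \<in> W" unfolding Dv[OF x] by (intro Wadd Wsm w)
      qed
      ultimately have "P (Suc k)" unfolding P_def using D by blast
      then show False using max by fastforce
    qed
  qed
  then show ?thesis using C by blast
qed

lemma inj_mat_of_left_inverse:
  assumes L: "L \<in> carrier_mat k n" and C: "C \<in> carrier_mat n k" and LC: "L * C = 1\<^sub>m k"
  shows "inj_mat C"
proof (rule inj_matI[OF C])
  fix v assume v: "v \<in> carrier_vec k" and "C *\<^sub>v v = 0\<^sub>v n"
  then have "(L * C) *\<^sub>v v = 0\<^sub>v k" using L C by simp
  then show "v = 0\<^sub>v k" using LC v by simp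
qed

lemma bij_mat_inverse:
  assumes P: "P \<in> carrier_mat n k" and inj: "inj_mat P"
    and surj: "\<And>w. w \<in> carrier_vec n \<Longrightarrow> \<exists>x\<in>carrier_vec k. w = P *\<^sub>v x"
  shows "k = n \<and> (\<exists>Q\<in>carrier_mat n n. P * Q = 1\<^sub>m n \<and> Q * P = 1\<^sub>m n)"
proof -
  obtain Q where Q: "Q \<in> carrier_mat k n" "Q * P = 1\<^sub>m k" using left_inverse_exists[OF P inj] by blast
  have "P * Q = 1\<^sub>m n"
  proof (rule eq_mat_on_vecI)
    fix w :: "complex vec" assume w: "w \<in> carrier_vec n"
    then obtain x where x: "x \<in> carrier_vec k" "w = P *\<^sub>v x" using surj by blast
    have "Q *\<^sub>v w = (Q * P) *\<^sub>v x" unfolding x(2) using x(1) P Q(1) by simp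
    then have "Q *\<^sub>v w = x" using Q x by simp
    then show "(P * Q) *\<^sub>v w = 1\<^sub>m n *\<^sub>v w" using x P Q w by (simp add: assoc_mult_mat_vec[of _ n k])
  qed (use P Q in auto)
  then have "inj_mat Q" by (rule inj_mat_of_left_inverse[OF P Q(1)])
  then have "n \<le> k" using inj_mat_dim_le[OF Q(1)] by simp
  moreover have "k \<le> n" using inj_mat_dim_le[OF P inj] .
  ultimately have "k = n" by simp
  then show ?thesis using Q \<open>P * Q = 1\<^sub>m n\<close> by auto
qed

subsection \<open>Characters of finite groups\<close>

definition mat_trace :: "complex mat \<Rightarrow> complex" where
  "mat_trace A = (\<Sum>i<dim_row A. A $$ (i,i))"

lemma mat_trace_comm:
  assumes A: "A \<in> carrier_mat m n" and B: "B \<in> carrier_mat n m"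
  shows "mat_trace (A * B) = mat_trace (B * A)"
proof -
  have "mat_trace (A * B) = (\<Sum>i<m. \<Sum>j<n. A $$ (i,j) * B $$ (j,i))"
    using A B unfolding mat_trace_def by (auto simp: scalar_prod_def atLeast0LessThan intro!: sum.cong)
  also have "\<dots> = (\<Sum>j<n. \<Sum>i<m. B $$ (j,i) * A $$ (i,j))"
    by (subst sum.swap) (simp add: mult.commute)
  also have "\<dots> = mat_trace (B * A)"
    using A B unfolding mat_trace_def by (auto simp: scalar_prod_def atLeast0LessThan intro!: sum.cong)
  finally show ?thesis .
qed

lemma mat_trace_conj:
  assumes P: "P \<in> carrier_mat n n" and Q: "Q \<in> carrier_mat n n" and A: "A \<in> carrier_mat n n"
    and QP: "Q * P = 1\<^sub>m n"
  shows "mat_trace (P * A * Q) = mat_trace A"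
proof -
  have "mat_trace (P * A * Q) = mat_trace (Q * (P * A))"
    using P Q A by (intro mat_trace_comm[of _ n n]) auto
  also have "Q * (P * A) = (Q * P) * A" using P Q A by simp
  finally show ?thesis using QP A by simp
qed

lemma mat_trace_four_block:
  assumes "A \<in> carrier_mat n n" "D \<in> carrier_mat m m"
  shows "mat_trace (four_block_mat A B C D) = mat_trace A + mat_trace D"
proof -
  have "mat_trace (four_block_mat A B C D) =
      (\<Sum>i<n + m. if i < n then A $$ (i,i) else D $$ (i - n, i - n))"
    using assms unfolding mat_trace_def by (auto intro!: sum.cong)
  also have "\<dots> = (\<Sum>i<n. A $$ (i,i)) + (\<Sum>i<m. D $$ (i,i))"
    by (induction m) simp_all
  finally show ?thesis using assms unfolding mat_trace_def by simp
qed

lemma mat_trace_diag_block: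
  assumes "\<And>A. A \<in> set As \<Longrightarrow> dim_col A = dim_row A"
  shows "mat_trace (diag_block_mat As) = (\<Sum>A\<leftarrow>As. mat_trace A)"
  using assms
proof (induction As)
  case Nil
  then show ?case by (simp add: mat_trace_def)
next
  case (Cons A As)
  have "square_mat (diag_block_mat As)" using Cons.prems by (intro diag_block_mat_square) auto
  moreover have "dim_col A = dim_row A" using Cons.prems by simp
  ultimately have c: "A \<in> carrier_mat (dim_row A) (dim_row A)"
    "diag_block_mat As \<in> carrier_mat (dim_row (diag_block_mat As)) (dim_row (diag_block_mat As))"
    by auto
  have "mat_trace (diag_block_mat As) = (\<Sum>A\<leftarrow>As. mat_trace A)"
    using Cons by simp
  then show ?case
    by (simp add: Let_def mat_trace_four_block[OF c])
qed

text \<open>The dimensions are parameters because the empty sum must be a zero matrix of known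
  size.\<close>

definition sum_mat :: "nat \<Rightarrow> nat \<Rightarrow> ('a \<Rightarrow> complex mat) \<Rightarrow> 'a set \<Rightarrow> complex mat" where
  "sum_mat m n f S = mat m n (\<lambda>(i,j). \<Sum>g\<in>S. f g $$ (i,j))"

lemma sum_mat_carrier [simp]: "sum_mat m n f S \<in> carrier_mat m n"
  unfolding sum_mat_def by simp

lemma sum_mat_cong: "(\<And>g. g \<in> S \<Longrightarrow> f g = h g) \<Longrightarrow> sum_mat m n f S = sum_mat m n h S"
  unfolding sum_mat_def by simp

lemma sum_mat_reindex: "bij_betw t S S \<Longrightarrow> sum_mat m n (\<lambda>g. f (t g)) S = sum_mat m n f S"
  unfolding sum_mat_def by (simp add: sum.reindex_bij_betw[of t S S "\<lambda>g. f g $$ _"])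

lemma mult_sum_mat:
  assumes A: "A \<in> carrier_mat k m" and f: "\<And>g. g \<in> S \<Longrightarrow> f g \<in> carrier_mat m n"
  shows "A * sum_mat m n f S = sum_mat k n (\<lambda>g. A * f g) S"
proof (rule eq_matI)
  fix i j assume "i < dim_row (sum_mat k n (\<lambda>g. A * f g) S)" "j < dim_col (sum_mat k n (\<lambda>g. A * f g) S)"
  then have i: "i < k" and j: "j < n" by (auto simp: sum_mat_def)
  have "(A * sum_mat m n f S) $$ (i,j) = (\<Sum>l<m. A $$ (i,l) * (\<Sum>g\<in>S. f g $$ (l,j)))"
    using A i j by (simp add: sum_mat_def scalar_prod_def atLeast0LessThan)
  also have "\<dots> = (\<Sum>g\<in>S. \<Sum>l<m. A $$ (i,l) * f g $$ (l,j))"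
    unfolding sum_distrib_left by (rule sum.swap)
  also have "\<dots> = (\<Sum>g\<in>S. (A * f g) $$ (i,j))"
    using f A i j by (intro sum.cong) (auto simp: scalar_prod_def atLeast0LessThan dest!: f)
  finally show "(A * sum_mat m n f S) $$ (i,j) = sum_mat k n (\<lambda>g. A * f g) S $$ (i,j)"
    using i j by (simp add: sum_mat_def)
qed (use A in \<open>auto simp: sum_mat_def\<close>)

lemma sum_mat_mult:
  assumes A: "A \<in> carrier_mat n k" and f: "\<And>g. g \<in> S \<Longrightarrow> f g \<in> carrier_mat m n"
  shows "sum_mat m n f S * A = sum_mat m k (\<lambda>g. f g * A) S"
proof (rule eq_matI)
  fix i j assume "i < dim_row (sum_mat m k (\<lambda>g. f g * A) S)" "j < dim_col (sum_mat m k (\<lambda>g. f g * A) S)"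
  then have i: "i < m" and j: "j < k" by (auto simp: sum_mat_def)
  have "(sum_mat m n f S * A) $$ (i,j) = (\<Sum>l<n. (\<Sum>g\<in>S. f g $$ (i,l)) * A $$ (l,j))"
    using A i j by (simp add: sum_mat_def scalar_prod_def atLeast0LessThan)
  also have "\<dots> = (\<Sum>g\<in>S. \<Sum>l<n. f g $$ (i,l) * A $$ (l,j))"
    unfolding sum_distrib_right by (rule sum.swap)
  also have "\<dots> = (\<Sum>g\<in>S. (f g * A) $$ (i,j))"
    using f A i j by (intro sum.cong) (auto simp: scalar_prod_def atLeast0LessThan dest!: f)
  finally show "(sum_mat m n f S * A) $$ (i,j) = sum_mat m k (\<lambda>g. f g * A) S $$ (i,j)"
    using i j by (simp add: sum_mat_def)
qed (use A in \<open>auto simp: sum_mat_def\<close>)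

lemma smult_mat_mult_vec:
  assumes "(A :: complex mat) \<in> carrier_mat m n" "v \<in> carrier_vec n"
  shows "(c \<cdot>\<^sub>m A) *\<^sub>v v = c \<cdot>\<^sub>v (A *\<^sub>v v)"
  using assms by (intro eq_vecI) (auto simp: scalar_prod_def sum_distrib_left mult.assoc)

lemma representationD:
  assumes "group G" "representation G \<rho>"
  shows "\<And>g. g \<in> carrier G \<Longrightarrow> \<rho> g \<in> carrier_mat (rep_dim G \<rho>) (rep_dim G \<rho>)"
    and "\<And>g h. g \<in> carrier G \<Longrightarrow> h \<in> carrier G \<Longrightarrow> \<rho> (g \<otimes>\<^bsub>G\<^esub> h) = \<rho> g * \<rho> h"
    and "\<rho> \<one>\<^bsub>G\<^esub> = 1\<^sub>m (rep_dim G \<rho>)"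
proof -
  let ?n = "rep_dim G \<rho>"
  interpret group G by fact
  have hom: "\<rho> \<in> hom G (GL ?n)" using assms(2) unfolding representation_def .
  show car: "\<rho> g \<in> carrier_mat ?n ?n" if "g \<in> carrier G" for g
    using hom that unfolding hom_def GL_def units_of_def Units_def by (auto simp: ring_mat_simps)
  show mult: "\<rho> (g \<otimes>\<^bsub>G\<^esub> h) = \<rho> g * \<rho> h" if "g \<in> carrier G" "h \<in> carrier G" for g h
    using hom that unfolding hom_def GL_def units_of_def by (auto simp: ring_mat_simps)
  have "\<rho> \<one>\<^bsub>G\<^esub> \<in> Units (ring_mat TYPE(complex) ?n ())"
    using hom unfolding hom_def GL_def units_of_def by auto
  then obtain B where B: "B \<in> carrier_mat ?n ?n" "B * \<rho> \<one>\<^bsub>G\<^esub> = 1\<^sub>m ?n"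
    unfolding Units_def by (auto simp: ring_mat_simps)
  have "\<rho> \<one>\<^bsub>G\<^esub> = (B * \<rho> \<one>\<^bsub>G\<^esub>) * \<rho> \<one>\<^bsub>G\<^esub>" using B(2) car[of "\<one>\<^bsub>G\<^esub>"] by simp
  also have "\<dots> = B * \<rho> (\<one>\<^bsub>G\<^esub> \<otimes>\<^bsub>G\<^esub> \<one>\<^bsub>G\<^esub>)" unfolding mult[OF one_closed one_closed]
    using B(1) car[OF one_closed] by (simp only: assoc_mult_mat[of _ ?n ?n _ ?n _ ?n])
  finally show "\<rho> \<one>\<^bsub>G\<^esub> = 1\<^sub>m ?n" using B(2) by simp
qed

lemma representationI:
  assumes "group G" and car: "\<And>g. g \<in> carrier G \<Longrightarrow> \<rho> g \<in> carrier_mat n n"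
    and mult: "\<And>g h. g \<in> carrier G \<Longrightarrow> h \<in> carrier G \<Longrightarrow> \<rho> (g \<otimes>\<^bsub>G\<^esub> h) = \<rho> g * \<rho> h"
    and one: "\<rho> \<one>\<^bsub>G\<^esub> = 1\<^sub>m n"
  shows "representation G \<rho>" "rep_dim G \<rho> = n"
proof -
  interpret group G by fact
  show n: "rep_dim G \<rho> = n" unfolding rep_dim_def one by simp
  have "\<rho> g \<in> Units (ring_mat TYPE(complex) n ())" if g: "g \<in> carrier G" for g
  proof -
    have "\<rho> (inv\<^bsub>G\<^esub> g) * \<rho> g = 1\<^sub>m n" "\<rho> g * \<rho> (inv\<^bsub>G\<^esub> g) = 1\<^sub>m n"
      using g one by (simp_all flip: mult)
    then show ?thesis using car g unfolding Units_def by (auto simp: ring_mat_simps)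
  qed
  then show "representation G \<rho>"
    unfolding representation_def n hom_def GL_def units_of_def using mult by (auto simp: ring_mat_simps)
qed

lemma GL_iff:
  "T \<in> carrier (GL n) \<longleftrightarrow> T \<in> carrier_mat n n \<and> (\<exists>S\<in>carrier_mat n n. S * T = 1\<^sub>m n \<and> T * S = 1\<^sub>m n)"
  unfolding GL_def units_of_def Units_def by (auto simp: ring_mat_simps)

lemma equivalent_rep_trans:
  assumes "equivalent_rep G \<rho> \<sigma>" "equivalent_rep G \<sigma> \<tau>" "group G"
    "representation G \<rho>" "representation G \<sigma>" "representation G \<tau>"
  shows "equivalent_rep G \<rho> \<tau>"
proof -
  let ?n = "rep_dim G \<rho>"
  have n: "rep_dim G \<sigma> = ?n" "rep_dim G \<tau> = ?n" using assms unfolding equivalent_rep_def by auto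
  obtain S T where S: "S \<in> carrier (GL ?n)" "\<And>g. g \<in> carrier G \<Longrightarrow> S * \<rho> g = \<sigma> g * S"
    and T: "T \<in> carrier (GL ?n)" "\<And>g. g \<in> carrier G \<Longrightarrow> T * \<sigma> g = \<tau> g * T"
    using assms unfolding equivalent_rep_def by auto
  obtain S' T' where S': "S' \<in> carrier_mat ?n ?n" "S' * S = 1\<^sub>m ?n" "S * S' = 1\<^sub>m ?n"
    and T': "T' \<in> carrier_mat ?n ?n" "T' * T = 1\<^sub>m ?n" "T * T' = 1\<^sub>m ?n"
    using S(1) T(1) unfolding GL_iff by auto
  have Sc: "S \<in> carrier_mat ?n ?n" and Tc: "T \<in> carrier_mat ?n ?n" using S T unfolding GL_iff by auto
  have "(S' * T') * (T * S) = S' * (T' * T) * S"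
    using Sc Tc S'(1) T'(1) by (simp add: assoc_mult_mat[of _ ?n ?n _ ?n _ ?n])
  then have e1: "(S' * T') * (T * S) = 1\<^sub>m ?n" using S' T' by simp
  have "(T * S) * (S' * T') = T * (S * S') * T'"
    using Sc Tc S'(1) T'(1) by (simp add: assoc_mult_mat[of _ ?n ?n _ ?n _ ?n])
  then have e2: "(T * S) * (S' * T') = 1\<^sub>m ?n" using S' T' Tc by simp
  have "T * S \<in> carrier (GL ?n)"
    unfolding GL_iff
    by (intro conjI bexI[of _ "S' * T'"], use Sc Tc S'(1) T'(1) in simp, fact, fact, use S'(1) T'(1) in simp)
  moreover have "(T * S) * \<rho> g = \<tau> g * (T * S)" if g: "g \<in> carrier G" for g
  proof -
    have c: "\<rho> g \<in> carrier_mat ?n ?n" "\<sigma> g \<in> carrier_mat ?n ?n" "\<tau> g \<in> carrier_mat ?n ?n"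
      using representationD(1)[OF assms(3)] assms(4-6) g n by metis+
    have "(T * S) * \<rho> g = T * (S * \<rho> g)" using c Sc Tc by simp
    also have "\<dots> = (T * \<sigma> g) * S" unfolding S(2)[OF g] using c Sc Tc by simp
    also have "\<dots> = \<tau> g * (T * S)" unfolding T(2)[OF g] using c Sc Tc by simp
    finally show ?thesis .
  qed
  ultimately show ?thesis unfolding equivalent_rep_def n by auto
qed

lemma equivalent_rep_trace:
  assumes "equivalent_rep G \<rho> \<sigma>" "group G" "representation G \<rho>" "representation G \<sigma>" "g \<in> carrier G"
  shows "mat_trace (\<rho> g) = mat_trace (\<sigma> g)"
proof -
  let ?n = "rep_dim G \<rho>"
  have n: "rep_dim G \<sigma> = ?n" using assms unfolding equivalent_rep_def by auto
  obtain S where "S \<in> carrier (GL ?n)" and S: "S * \<rho> g = \<sigma> g * S"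
    using assms unfolding equivalent_rep_def by auto
  then obtain S' where S': "S' \<in> carrier_mat ?n ?n" "S' * S = 1\<^sub>m ?n" "S * S' = 1\<^sub>m ?n"
    and Sc: "S \<in> carrier_mat ?n ?n" unfolding GL_iff by auto
  have c: "\<rho> g \<in> carrier_mat ?n ?n" "\<sigma> g \<in> carrier_mat ?n ?n"
    using representationD(1)[OF assms(2)] assms(3-5) n by metis+
  have "mat_trace (\<rho> g) = mat_trace (S * \<rho> g * S')"
    using mat_trace_conj[OF Sc S'(1) c(1) S'(2)] by simp
  also have "S * \<rho> g * S' = \<sigma> g * (S * S')" unfolding S using c Sc S'(1) by simp
  finally show ?thesis using S'(3) c by simp
qed

section \<open>Schur's lemma\<close>

lemma schur_lemma:
  assumes G: "group G" and \<sigma>: "irreducible_rep G \<sigma>" and \<tau>: "irreducible_rep G \<tau>"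
    and T: "T \<in> carrier_mat (rep_dim G \<sigma>) (rep_dim G \<tau>)"
    and comm: "\<And>g. g \<in> carrier G \<Longrightarrow> \<sigma> g * T = T * \<tau> g"
    and nz: "T \<noteq> 0\<^sub>m (rep_dim G \<sigma>) (rep_dim G \<tau>)"
  shows "rep_dim G \<sigma> = rep_dim G \<tau>" "T \<in> carrier (GL (rep_dim G \<tau>))" "inj_mat T"
proof -
  let ?m = "rep_dim G \<sigma>" and ?n = "rep_dim G \<tau>"
  have r: "representation G \<sigma>" "representation G \<tau>" using \<sigma> \<tau> unfolding irreducible_rep_iff by auto
  note D = representationD(1)[OF G r(1)] representationD(1)[OF G r(2)]
  have cv: "\<sigma> g *\<^sub>v (T *\<^sub>v v) = T *\<^sub>v (\<tau> g *\<^sub>v v)" if "g \<in> carrier G" "v \<in> carrier_vec ?n" for g v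
  proof -
    have "\<sigma> g *\<^sub>v (T *\<^sub>v v) = (\<sigma> g * T) *\<^sub>v v" using D(1)[OF that(1)] that(2) T by (rule_tac assoc_mult_mat_vec[symmetric]) auto
    also have "\<dots> = T *\<^sub>v (\<tau> g *\<^sub>v v)" unfolding comm[OF that(1)] using D(2)[OF that(1)] that(2) T by (rule_tac assoc_mult_mat_vec) auto
    finally show ?thesis .
  qed
  define K where "K = {v \<in> carrier_vec ?n. T *\<^sub>v v = 0\<^sub>v ?m}"
  have "\<tau> g *\<^sub>v w \<in> K" if "g \<in> carrier G" "w \<in> K" for g w
  proof -
    have "T *\<^sub>v (\<tau> g *\<^sub>v w) = \<sigma> g *\<^sub>v 0\<^sub>v ?m" using that cv[of g w] unfolding K_def by auto
    then show ?thesis using D(1)[OF that(1)] D(2)[OF that(1)] that(2) unfolding K_def by auto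
  qed
  then have "K = {0\<^sub>v ?n} \<or> K = carrier_vec ?n"
    using \<tau> subspace_vec_kernel[OF T] unfolding irreducible_rep_iff K_def by blast
  moreover have "K \<noteq> carrier_vec ?n"
  proof
    assume "K = carrier_vec ?n"
    then have "T *\<^sub>v v = 0\<^sub>m ?m ?n *\<^sub>v v" if "v \<in> carrier_vec ?n" for v
      using that unfolding K_def by auto
    then show False using nz eq_mat_on_vecI[OF T, of "0\<^sub>m ?m ?n"] by auto
  qed
  ultimately have K: "K = {0\<^sub>v ?n}" by blast
  show inj: "inj_mat T" by (rule inj_matI[OF T]) (use K in \<open>auto simp: K_def\<close>)
  define R where "R = (*\<^sub>v) T ` carrier_vec ?n"
  have "\<sigma> g *\<^sub>v w \<in> R" if "g \<in> carrier G" "w \<in> R" for g w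
    using that(2) cv[OF that(1)] D(2)[OF that(1)] unfolding R_def by (auto intro!: image_eqI)
  then have "R = {0\<^sub>v ?m} \<or> R = carrier_vec ?m"
    using \<sigma> subspace_vec_range[OF T] unfolding irreducible_rep_iff R_def by blast
  moreover have "R \<noteq> {0\<^sub>v ?m}"
  proof
    assume "R = {0\<^sub>v ?m}"
    then have "T *\<^sub>v v = 0\<^sub>m ?m ?n *\<^sub>v v" if "v \<in> carrier_vec ?n" for v
      using that unfolding R_def by auto
    then show False using nz eq_mat_on_vecI[OF T, of "0\<^sub>m ?m ?n"] by auto
  qed
  ultimately have R: "R = carrier_vec ?m" by blast
  have "?n = ?m \<and> (\<exists>Q\<in>carrier_mat ?m ?m. T * Q = 1\<^sub>m ?m \<and> Q * T = 1\<^sub>m ?m)"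
  proof (rule bij_mat_inverse[OF T inj])
    fix w :: "complex vec" assume "w \<in> carrier_vec ?m"
    then show "\<exists>x\<in>carrier_vec ?n. w = T *\<^sub>v x" using R unfolding R_def by (metis imageE)
  qed
  then show "?m = ?n" "T \<in> carrier (GL ?n)" using T unfolding GL_iff by auto
qed

text \<open>Over the complex numbers \<open>T\<close> has an eigenvalue c; then T - c still commutes
  with the action but is not injective, so Schur's lemma makes it zero.\<close>

lemma schur_lemma_scalar:
  assumes G: "group G" and \<sigma>: "irreducible_rep G \<sigma>"
    and T: "T \<in> carrier_mat (rep_dim G \<sigma>) (rep_dim G \<sigma>)"
    and comm: "\<And>g. g \<in> carrier G \<Longrightarrow> \<sigma> g * T = T * \<sigma> g"
  shows "\<exists>c. T = c \<cdot>\<^sub>m 1\<^sub>m (rep_dim G \<sigma>)"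
proof -
  let ?n = "rep_dim G \<sigma>"
  have r: "representation G \<sigma>" and n0: "?n > 0" using \<sigma> unfolding irreducible_rep_iff by auto
  note D = representationD(1)[OF G r]
  obtain c where "eigenvalue T c"
    using spectrum_non_empty[OF T n0] unfolding spectrum_def by auto
  then obtain v where v: "v \<in> carrier_vec ?n" "v \<noteq> 0\<^sub>v ?n" "T *\<^sub>v v = c \<cdot>\<^sub>v v"
    using T unfolding eigenvalue_def eigenvector_def by auto
  define S where "S = T - c \<cdot>\<^sub>m 1\<^sub>m ?n"
  have S: "S \<in> carrier_mat ?n ?n" unfolding S_def by (intro minus_carrier_mat) auto
  have "S *\<^sub>v v = T *\<^sub>v v - (c \<cdot>\<^sub>m 1\<^sub>m ?n) *\<^sub>v v"
    unfolding S_def using T v(1) by (intro minus_mult_distrib_mat_vec) auto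
  also have "(c \<cdot>\<^sub>m 1\<^sub>m ?n) *\<^sub>v v = c \<cdot>\<^sub>v v"
    using v(1) by (simp add: smult_mat_mult_vec[of _ ?n ?n])
  finally have "S *\<^sub>v v = 0\<^sub>v ?n" using v by auto
  then have "\<not> inj_mat S" using inj_matD[OF _ S v(1)] v(2) by blast
  moreover have "\<sigma> g * S = S * \<sigma> g" if g: "g \<in> carrier G" for g
  proof -
    have "\<sigma> g * S = \<sigma> g * T - \<sigma> g * (c \<cdot>\<^sub>m 1\<^sub>m ?n)"
      unfolding S_def using D[OF g] T by (intro mult_minus_distrib_mat) auto
    also have "\<sigma> g * (c \<cdot>\<^sub>m 1\<^sub>m ?n) = (c \<cdot>\<^sub>m 1\<^sub>m ?n) * \<sigma> g"
      unfolding mult_smult_distrib[OF D[OF g] one_carrier_mat] mult_smult_assoc_mat[OF one_carrier_mat D[OF g]]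
      using D[OF g] by simp
    also have "\<sigma> g * T - (c \<cdot>\<^sub>m 1\<^sub>m ?n) * \<sigma> g = S * \<sigma> g"
      unfolding S_def comm[OF g] using D[OF g] T by (intro minus_mult_distrib_mat[symmetric]) auto
    finally show ?thesis .
  qed
  ultimately have S0: "S = 0\<^sub>m ?n ?n"
    using schur_lemma(3)[OF G \<sigma> \<sigma> S] by blast
  have "T = c \<cdot>\<^sub>m 1\<^sub>m ?n"
  proof (rule eq_matI)
    fix i j assume ij: "i < dim_row (c \<cdot>\<^sub>m 1\<^sub>m ?n)" "j < dim_col (c \<cdot>\<^sub>m 1\<^sub>m ?n)"
    then have "S $$ (i,j) = 0" using S0 by simp
    then show "T $$ (i,j) = (c \<cdot>\<^sub>m 1\<^sub>m ?n) $$ (i,j)" using ij T unfolding S_def by simp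
  qed (use T in auto)
  then show ?thesis by blast
qed

section \<open>Averaging over the group and orthogonality of characters\<close>

definition matrix_unit :: "nat \<Rightarrow> nat \<Rightarrow> nat \<Rightarrow> nat \<Rightarrow> complex mat" where
  "matrix_unit m n i j = mat m n (\<lambda>(a,b). if a = i \<and> b = j then 1 else 0)"

lemma mult_matrix_unit_mult:
  assumes "A \<in> carrier_mat k m" "B \<in> carrier_mat n l" "a < k" "b < l" "i < m" "j < n"
  shows "(A * matrix_unit m n i j * B) $$ (a,b) = A $$ (a,i) * B $$ (j,b)"
proof -
  have 1: "(A * matrix_unit m n i j) $$ (a,c) = (if c = j then A $$ (a,i) else 0)" if "c < n" for c
    using assms that by (auto simp: matrix_unit_def scalar_prod_def if_distrib cong: if_cong)
  have "(A * matrix_unit m n i j * B) $$ (a,b) =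
      (\<Sum>c<n. (A * matrix_unit m n i j) $$ (a,c) * B $$ (c,b))"
    using assms by (simp add: scalar_prod_def atLeast0LessThan matrix_unit_def)
  also have "\<dots> = (\<Sum>c<n. if c = j then A $$ (a,i) * B $$ (c,b) else 0)"
    by (intro sum.cong refl) (use 1 in auto)
  finally show ?thesis using assms by simp
qed

text \<open>Averaging turns an arbitrary matrix into an intertwiner from \<tau> to \<sigma>. Applied
  to matrix units it yields exactly the sums of products of matrix entries that occur in the
  orthogonality relations.\<close>

definition averaged_mat ::
    "('a, 'b) monoid_scheme \<Rightarrow> ('a \<Rightarrow> complex mat) \<Rightarrow> ('a \<Rightarrow> complex mat) \<Rightarrow> complex mat \<Rightarrow> complex mat" where
  "averaged_mat G \<sigma> \<tau> X =
     sum_mat (rep_dim G \<sigma>) (rep_dim G \<tau>) (\<lambda>g. \<sigma> (inv\<^bsub>G\<^esub> g) * X * \<tau> g) (carrier G)"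

lemma averaged_mat_carrier [simp]: "averaged_mat G \<sigma> \<tau> X \<in> carrier_mat (rep_dim G \<sigma>) (rep_dim G \<tau>)"
  unfolding averaged_mat_def by simp

lemma averaged_mat_comm:
  assumes G: "group G" and r: "representation G \<sigma>" "representation G \<tau>"
    and X: "X \<in> carrier_mat (rep_dim G \<sigma>) (rep_dim G \<tau>)" and h: "h \<in> carrier G"
  shows "\<sigma> h * averaged_mat G \<sigma> \<tau> X = averaged_mat G \<sigma> \<tau> X * \<tau> h"
proof -
  interpret group G by fact
  let ?m = "rep_dim G \<sigma>" and ?n = "rep_dim G \<tau>"
  note D\<sigma> = representationD[OF G r(1)] and D\<tau> = representationD[OF G r(2)]
  have c: "\<sigma> (inv\<^bsub>G\<^esub> g) * X * \<tau> g \<in> carrier_mat ?m ?n" if "g \<in> carrier G" for g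
    using that D\<sigma>(1)[of "inv\<^bsub>G\<^esub> g"] D\<tau>(1)[of g] X by auto
  have bij: "bij_betw (\<lambda>g. g \<otimes>\<^bsub>G\<^esub> h) (carrier G) (carrier G)"
    by (rule bij_betwI[of _ _ _ "\<lambda>g. g \<otimes>\<^bsub>G\<^esub> inv\<^bsub>G\<^esub> h"]) (use h in \<open>auto simp: m_assoc\<close>)
  have "\<sigma> h * averaged_mat G \<sigma> \<tau> X =
      sum_mat ?m ?n (\<lambda>g. \<sigma> h * (\<sigma> (inv\<^bsub>G\<^esub> g) * X * \<tau> g)) (carrier G)"
    unfolding averaged_mat_def by (rule mult_sum_mat[OF D\<sigma>(1)[OF h] c])
  also have "\<dots> = sum_mat ?m ?n
      (\<lambda>g. \<sigma> h * (\<sigma> (inv\<^bsub>G\<^esub> (g \<otimes>\<^bsub>G\<^esub> h)) * X * \<tau> (g \<otimes>\<^bsub>G\<^esub> h))) (carrier G)"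
    by (rule sum_mat_reindex[OF bij, symmetric])
  also have "\<dots> = sum_mat ?m ?n (\<lambda>g. \<sigma> (inv\<^bsub>G\<^esub> g) * X * \<tau> g * \<tau> h) (carrier G)"
  proof (rule sum_mat_cong)
    fix g assume g: "g \<in> carrier G"
    have "h \<otimes>\<^bsub>G\<^esub> inv\<^bsub>G\<^esub> (g \<otimes>\<^bsub>G\<^esub> h) = inv\<^bsub>G\<^esub> g"
      using g h by (simp add: inv_mult_group flip: m_assoc)
    then have "\<sigma> h * \<sigma> (inv\<^bsub>G\<^esub> (g \<otimes>\<^bsub>G\<^esub> h)) = \<sigma> (inv\<^bsub>G\<^esub> g)"
      using g h by (simp flip: D\<sigma>(2))
    moreover have "\<sigma> h * (\<sigma> (inv\<^bsub>G\<^esub> (g \<otimes>\<^bsub>G\<^esub> h)) * X * \<tau> (g \<otimes>\<^bsub>G\<^esub> h)) =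
        (\<sigma> h * \<sigma> (inv\<^bsub>G\<^esub> (g \<otimes>\<^bsub>G\<^esub> h))) * X * \<tau> (g \<otimes>\<^bsub>G\<^esub> h)"
      using g h D\<sigma>(1)[of h] D\<sigma>(1)[of "inv\<^bsub>G\<^esub> (g \<otimes>\<^bsub>G\<^esub> h)"] D\<tau>(1)[of "g \<otimes>\<^bsub>G\<^esub> h"] X
      by (simp add: assoc_mult_mat[of _ ?m ?m _ ?m _ ?n] assoc_mult_mat[of _ ?m ?m _ ?n _ ?n])
    ultimately have "\<sigma> h * (\<sigma> (inv\<^bsub>G\<^esub> (g \<otimes>\<^bsub>G\<^esub> h)) * X * \<tau> (g \<otimes>\<^bsub>G\<^esub> h)) =
        \<sigma> (inv\<^bsub>G\<^esub> g) * X * (\<tau> g * \<tau> h)" using D\<tau>(2)[OF g h] by simp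
    also have "\<dots> = \<sigma> (inv\<^bsub>G\<^esub> g) * X * \<tau> g * \<tau> h"
      using D\<sigma>(1)[of "inv\<^bsub>G\<^esub> g"] D\<tau>(1)[OF g] D\<tau>(1)[OF h] X g
      by (intro assoc_mult_mat[symmetric]) auto
    finally show "\<sigma> h * (\<sigma> (inv\<^bsub>G\<^esub> (g \<otimes>\<^bsub>G\<^esub> h)) * X * \<tau> (g \<otimes>\<^bsub>G\<^esub> h)) =
        \<sigma> (inv\<^bsub>G\<^esub> g) * X * \<tau> g * \<tau> h" .
  qed
  also have "\<dots> = averaged_mat G \<sigma> \<tau> X * \<tau> h"
    unfolding averaged_mat_def by (rule sum_mat_mult[OF D\<tau>(1)[OF h] c, symmetric])
  finally show ?thesis .
qed

lemma averaged_matrix_unit: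
  assumes G: "group G" and r: "representation G \<sigma>" "representation G \<tau>"
    and "a < rep_dim G \<sigma>" "i < rep_dim G \<sigma>" "j < rep_dim G \<tau>" "b < rep_dim G \<tau>"
  shows "averaged_mat G \<sigma> \<tau> (matrix_unit (rep_dim G \<sigma>) (rep_dim G \<tau>) i j) $$ (a,b) =
    (\<Sum>g\<in>carrier G. \<sigma> (inv\<^bsub>G\<^esub> g) $$ (a,i) * \<tau> g $$ (j,b))"
proof -
  interpret group G by fact
  note D\<sigma> = representationD[OF G r(1)] and D\<tau> = representationD[OF G r(2)]
  have "(\<sigma> (inv\<^bsub>G\<^esub> g) * matrix_unit (rep_dim G \<sigma>) (rep_dim G \<tau>) i j * \<tau> g) $$ (a,b) =
      \<sigma> (inv\<^bsub>G\<^esub> g) $$ (a,i) * \<tau> g $$ (j,b)" if "g \<in> carrier G" for g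
    by (rule mult_matrix_unit_mult[OF D\<sigma>(1) D\<tau>(1)]) (use that assms in auto)
  then show ?thesis unfolding averaged_mat_def sum_mat_def using assms by auto
qed

text \<open>A product of traces is the double sum of products of diagonal entries (a,a) and (b,b),
  and summing one such product over the group gives the (a,b) entry of the averaged matrix unit at
  (a,b).\<close>

lemma character_product_sum:
  assumes G: "group G" and r: "representation G \<sigma>" "representation G \<tau>"
  shows "(\<Sum>g\<in>carrier G. mat_trace (\<tau> g) * mat_trace (\<sigma> (inv\<^bsub>G\<^esub> g))) =
    (\<Sum>a<rep_dim G \<sigma>. \<Sum>b<rep_dim G \<tau>.
       averaged_mat G \<sigma> \<tau> (matrix_unit (rep_dim G \<sigma>) (rep_dim G \<tau>) a b) $$ (a,b))"
proof -
  interpret group G by fact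
  let ?m = "rep_dim G \<sigma>" and ?n = "rep_dim G \<tau>"
  note D\<sigma> = representationD[OF G r(1)] and D\<tau> = representationD[OF G r(2)]
  have "(\<Sum>g\<in>carrier G. mat_trace (\<tau> g) * mat_trace (\<sigma> (inv\<^bsub>G\<^esub> g))) =
      (\<Sum>g\<in>carrier G. \<Sum>a<?m. \<Sum>b<?n. \<sigma> (inv\<^bsub>G\<^esub> g) $$ (a,a) * \<tau> g $$ (b,b))"
  proof (rule sum.cong[OF refl])
    fix g assume g: "g \<in> carrier G"
    have "dim_row (\<sigma> (inv\<^bsub>G\<^esub> g)) = ?m" "dim_row (\<tau> g) = ?n"
      using D\<sigma>(1)[of "inv\<^bsub>G\<^esub> g"] D\<tau>(1)[OF g] g by auto
    then show "mat_trace (\<tau> g) * mat_trace (\<sigma> (inv\<^bsub>G\<^esub> g)) =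
        (\<Sum>a<?m. \<Sum>b<?n. \<sigma> (inv\<^bsub>G\<^esub> g) $$ (a,a) * \<tau> g $$ (b,b))"
      unfolding mat_trace_def by (subst mult.commute) (simp add: sum_product)
  qed
  also have "\<dots> = (\<Sum>a<?m. \<Sum>b<?n. \<Sum>g\<in>carrier G. \<sigma> (inv\<^bsub>G\<^esub> g) $$ (a,a) * \<tau> g $$ (b,b))"
    by (subst sum.swap, intro sum.cong refl, rule sum.swap)
  also have "\<dots> = (\<Sum>a<?m. \<Sum>b<?n. averaged_mat G \<sigma> \<tau> (matrix_unit ?m ?n a b) $$ (a,b))"
    by (intro sum.cong refl) (simp add: averaged_matrix_unit[OF assms])
  finally show ?thesis .
qed

lemma character_orthogonal:
  assumes G: "group G" and \<sigma>: "irreducible_rep G \<sigma>" and \<tau>: "irreducible_rep G \<tau>"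
    and ne: "\<not> equivalent_rep G \<sigma> \<tau>"
  shows "(\<Sum>g\<in>carrier G. mat_trace (\<tau> g) * mat_trace (\<sigma> (inv\<^bsub>G\<^esub> g))) = 0"
proof -
  let ?m = "rep_dim G \<sigma>" and ?n = "rep_dim G \<tau>"
  have r: "representation G \<sigma>" "representation G \<tau>" using \<sigma> \<tau> unfolding irreducible_rep_iff by auto
  have z: "averaged_mat G \<sigma> \<tau> X = 0\<^sub>m ?m ?n" if X: "X \<in> carrier_mat ?m ?n" for X
  proof (rule ccontr)
    let ?T = "averaged_mat G \<sigma> \<tau> X"
    assume nz: "?T \<noteq> 0\<^sub>m ?m ?n"
    note S = schur_lemma[OF G \<sigma> \<tau> averaged_mat_carrier averaged_mat_comm[OF G r X] nz]
    then have Tc: "?T \<in> carrier_mat ?n ?n" using averaged_mat_carrier[of G \<sigma> \<tau> X] by simp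
    obtain S where S': "S \<in> carrier_mat ?n ?n" "S * ?T = 1\<^sub>m ?n" "?T * S = 1\<^sub>m ?n"
      using S(2) unfolding GL_iff by auto
    \<comment> \<open>The inverse is what is wanted: the averaged matrix maps \<tau> to \<sigma>,
      while \<open>equivalent_rep G \<sigma> \<tau>\<close> asks for a map from \<sigma> to
      \<tau>.\<close>
    have "S * \<sigma> g = \<tau> g * S" if g: "g \<in> carrier G" for g
    proof -
      have c: "\<sigma> g \<in> carrier_mat ?n ?n" "\<tau> g \<in> carrier_mat ?n ?n"
        using representationD(1)[OF G r(1) g] representationD(1)[OF G r(2) g] S(1) by auto
      have "S * \<sigma> g = S * \<sigma> g * (?T * S)" using c S' by simp
      also have "\<dots> = S * (\<sigma> g * ?T) * S" using c S'(1) Tc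
        by (simp add: assoc_mult_mat[of _ ?n ?n _ ?n _ ?n])
      also have "\<dots> = (S * ?T) * \<tau> g * S" unfolding averaged_mat_comm[OF G r X g] using c S'(1) Tc
        by (simp add: assoc_mult_mat[of _ ?n ?n _ ?n _ ?n])
      finally show ?thesis using S' c by simp
    qed
    moreover have "S \<in> carrier (GL ?n)" unfolding GL_iff using S' Tc by auto
    ultimately have "equivalent_rep G \<sigma> \<tau>" unfolding equivalent_rep_def using S(1) by auto
    then show False using ne by blast
  qed
  show ?thesis unfolding character_product_sum[OF G r]
    by (intro sum.neutral ballI) (simp add: z matrix_unit_def)
qed

text \<open>By Schur's lemma each averaged matrix unit is a scalar c. Its trace is n * c on the one
  hand; on the other hand it collapses through \<sigma>(g) \<sigma>(inverse of g) = 1 to the group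
  order when a = b and to 0 otherwise.\<close>

lemma character_norm:
  assumes G: "group G" and fin: "finite (carrier G)" and \<sigma>: "irreducible_rep G \<sigma>"
  shows "(\<Sum>g\<in>carrier G. mat_trace (\<sigma> g) * mat_trace (\<sigma> (inv\<^bsub>G\<^esub> g))) = of_nat (card (carrier G))"
proof -
  interpret group G by fact
  let ?n = "rep_dim G \<sigma>"
  have r: "representation G \<sigma>" and n0: "?n > 0" using \<sigma> unfolding irreducible_rep_iff by auto
  note D = representationD[OF G r]
  let ?T = "\<lambda>a b. averaged_mat G \<sigma> \<sigma> (matrix_unit ?n ?n a b)"
  have "?T a b $$ (a,b) = (if a = b then of_nat (card (carrier G)) / of_nat ?n else 0)"
    if ab: "a < ?n" "b < ?n" for a b
  proof -
    have mu: "matrix_unit ?n ?n a b \<in> carrier_mat ?n ?n" unfolding matrix_unit_def by simp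
    obtain c where c: "?T a b = c \<cdot>\<^sub>m 1\<^sub>m ?n"
      using schur_lemma_scalar[OF G \<sigma> averaged_mat_carrier averaged_mat_comm[OF G r r mu]] by blast
    have "of_nat ?n * c = (\<Sum>i<?n. ?T a b $$ (i,i))" unfolding c by simp
    also have "\<dots> = (\<Sum>i<?n. \<Sum>g\<in>carrier G. \<sigma> g $$ (b,i) * \<sigma> (inv\<^bsub>G\<^esub> g) $$ (i,a))"
      using ab by (intro sum.cong refl) (simp add: averaged_matrix_unit[OF G r r] mult.commute)
    also have "\<dots> = (\<Sum>g\<in>carrier G. \<Sum>i<?n. \<sigma> g $$ (b,i) * \<sigma> (inv\<^bsub>G\<^esub> g) $$ (i,a))"
      by (rule sum.swap)
    also have "\<dots> = (\<Sum>g\<in>carrier G. (1\<^sub>m ?n :: complex mat) $$ (b,a))"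
    proof (rule sum.cong[OF refl])
      fix g assume g: "g \<in> carrier G"
      have "\<sigma> g * \<sigma> (inv\<^bsub>G\<^esub> g) = 1\<^sub>m ?n" using g D(3) by (simp flip: D(2))
      moreover have "(\<sigma> g * \<sigma> (inv\<^bsub>G\<^esub> g)) $$ (b,a) = (\<Sum>i<?n. \<sigma> g $$ (b,i) * \<sigma> (inv\<^bsub>G\<^esub> g) $$ (i,a))"
        using D(1)[OF g] D(1)[of "inv\<^bsub>G\<^esub> g"] g ab by (simp add: scalar_prod_def atLeast0LessThan)
      ultimately show "(\<Sum>i<?n. \<sigma> g $$ (b,i) * \<sigma> (inv\<^bsub>G\<^esub> g) $$ (i,a)) = (1\<^sub>m ?n :: complex mat) $$ (b,a)"
        by simp
    qed
    finally have "of_nat ?n * c = (if a = b then of_nat (card (carrier G)) else 0)"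
      using ab by auto
    then have "c = (if a = b then of_nat (card (carrier G)) / of_nat ?n else 0)"
      using n0 by (auto simp: field_simps)
    then show ?thesis unfolding c using ab by auto
  qed
  then have "(\<Sum>a<?n. \<Sum>b<?n. ?T a b $$ (a,b)) =
      (\<Sum>a<?n. \<Sum>b<?n. if a = b then of_nat (card (carrier G)) / of_nat ?n else 0)"
    by (intro sum.cong refl) simp
  also have "\<dots> = of_nat (card (carrier G))" using n0 by simp
  finally show ?thesis unfolding character_product_sum[OF G r r] .
qed

lemma block_diag_carrier:
  assumes "\<And>\<tau>. \<tau> \<in> set \<tau>s \<Longrightarrow> \<tau> g \<in> carrier_mat (d \<tau>) (d \<tau>)"
  shows "direct_sum_rep \<tau>s g \<in> carrier_mat (\<Sum>\<tau>\<leftarrow>\<tau>s. d \<tau>) (\<Sum>\<tau>\<leftarrow>\<tau>s. d \<tau>)"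
proof -
  have "map dim_row (map (\<lambda>\<tau>. \<tau> g) \<tau>s) = map d \<tau>s" "map dim_col (map (\<lambda>\<tau>. \<tau> g) \<tau>s) = map d \<tau>s"
    using assms by auto
  then show ?thesis unfolding direct_sum_rep_def
    by (intro carrier_matI) (simp_all only: dim_diag_block_mat)
qed

lemma direct_sum_rep_Cons:
  "direct_sum_rep (\<tau> # \<tau>s) g = four_block_mat (\<tau> g)
     (0\<^sub>m (dim_row (\<tau> g)) (dim_col (direct_sum_rep \<tau>s g)))
     (0\<^sub>m (dim_row (direct_sum_rep \<tau>s g)) (dim_col (\<tau> g))) (direct_sum_rep \<tau>s g)"
  unfolding direct_sum_rep_def by (simp add: Let_def)

lemma direct_sum_rep_single [simp]: "direct_sum_rep [\<tau>] = \<tau>"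
  unfolding direct_sum_rep_def list.map diag_block_mat_singleton ..

lemma mult_block_diag:
  fixes A1 :: "complex mat"
  assumes "A1 \<in> carrier_mat n n" "B1 \<in> carrier_mat n n" "A2 \<in> carrier_mat m m" "B2 \<in> carrier_mat m m"
  shows "four_block_mat A1 (0\<^sub>m n m) (0\<^sub>m m n) A2 * four_block_mat B1 (0\<^sub>m n m) (0\<^sub>m m n) B2 =
    four_block_mat (A1 * B1) (0\<^sub>m n m) (0\<^sub>m m n) (A2 * B2)"
  using assms by (subst mult_four_block_mat[of _ n n _ m _ m _ _ n _ m]) auto

lemma direct_sum_representation:
  assumes G: "group G" and r: "\<And>\<tau>. \<tau> \<in> set \<tau>s \<Longrightarrow> representation G \<tau>"
  shows "representation G (direct_sum_rep \<tau>s)"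
    and "rep_dim G (direct_sum_rep \<tau>s) = (\<Sum>\<tau>\<leftarrow>\<tau>s. rep_dim G \<tau>)"
proof -
  let ?d = "\<lambda>\<tau>s. \<Sum>\<tau>\<leftarrow>\<tau>s. rep_dim G \<tau>"
  interpret group G by fact
  have car: "direct_sum_rep ts g \<in> carrier_mat (?d ts) (?d ts)"
    if "g \<in> carrier G" "set ts \<subseteq> set \<tau>s" for g ts
    using that r representationD(1)[OF G] by (intro block_diag_carrier) auto
  have mult: "direct_sum_rep \<tau>s (g \<otimes>\<^bsub>G\<^esub> h) = direct_sum_rep \<tau>s g * direct_sum_rep \<tau>s h"
    if gh: "g \<in> carrier G" "h \<in> carrier G" for g h
    using r car
  proof (induction \<tau>s)
    case Nil
    show ?case by (simp add: direct_sum_rep_def)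
  next
    case (Cons \<tau> ts)
    have c1: "\<tau> x \<in> carrier_mat (rep_dim G \<tau>) (rep_dim G \<tau>)" if "x \<in> carrier G" for x
      using Cons.prems(1) representationD(1)[OF G _ that] by simp
    have c2: "direct_sum_rep ts x \<in> carrier_mat (?d ts) (?d ts)" if "x \<in> carrier G" for x
      using Cons.prems(2)[OF that, of ts] by auto
    have eq: "direct_sum_rep (\<tau> # ts) x = four_block_mat (\<tau> x) (0\<^sub>m (rep_dim G \<tau>) (?d ts))
        (0\<^sub>m (?d ts) (rep_dim G \<tau>)) (direct_sum_rep ts x)" if "x \<in> carrier G" for x
      using c1[OF that] c2[OF that] unfolding direct_sum_rep_Cons by auto
    have "\<tau> (g \<otimes>\<^bsub>G\<^esub> h) = \<tau> g * \<tau> h" using representationD(2)[OF G] Cons.prems(1) gh by simp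
    moreover have "direct_sum_rep ts (g \<otimes>\<^bsub>G\<^esub> h) = direct_sum_rep ts g * direct_sum_rep ts h"
      using Cons.prems by (intro Cons.IH) auto
    ultimately show ?case using gh
      by (simp add: eq mult_block_diag[OF c1 c1 c2 c2])
  qed
  have one: "direct_sum_rep \<tau>s \<one>\<^bsub>G\<^esub> = 1\<^sub>m (?d \<tau>s)"
  proof -
    have "map (\<lambda>\<tau>. \<tau> \<one>\<^bsub>G\<^esub>) \<tau>s = map (\<lambda>A. 1\<^sub>m (dim_row A)) (map (\<lambda>\<tau>. \<tau> \<one>\<^bsub>G\<^esub>) \<tau>s)"
      unfolding map_map o_def
      by (rule map_cong[OF refl]) (rule representationD(3)[OF G r, unfolded rep_dim_def])
    then have "direct_sum_rep \<tau>s \<one>\<^bsub>G\<^esub> = 1\<^sub>m (sum_list (map dim_row (map (\<lambda>\<tau>. \<tau> \<one>\<^bsub>G\<^esub>) \<tau>s)))"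
      unfolding direct_sum_rep_def by (metis diag_block_one_mat)
    also have "map dim_row (map (\<lambda>\<tau>. \<tau> \<one>\<^bsub>G\<^esub>) \<tau>s) = map (rep_dim G) \<tau>s"
      by (simp add: rep_dim_def)
    finally show ?thesis .
  qed
  show "representation G (direct_sum_rep \<tau>s)" "rep_dim G (direct_sum_rep \<tau>s) = ?d \<tau>s"
    using representationI[OF G car mult one] by auto
qed

lemma direct_sum_trace:
  assumes G: "group G" and r: "\<And>\<tau>. \<tau> \<in> set \<tau>s \<Longrightarrow> representation G \<tau>" and g: "g \<in> carrier G"
  shows "mat_trace (direct_sum_rep \<tau>s g) = (\<Sum>\<tau>\<leftarrow>\<tau>s. mat_trace (\<tau> g))"
proof -
  have "mat_trace (direct_sum_rep \<tau>s g) = (\<Sum>A\<leftarrow>map (\<lambda>\<tau>. \<tau> g) \<tau>s. mat_trace A)"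
    unfolding direct_sum_rep_def
    by (rule mat_trace_diag_block) (use r representationD(1)[OF G _ g] in fastforce)
  then show ?thesis by (simp add: o_def)
qed

lemma equivalent_rep_refl:
  assumes "group G" "representation G \<rho>"
  shows "equivalent_rep G \<rho> \<rho>"
  unfolding equivalent_rep_def
proof (intro conjI refl bexI[of _ "1\<^sub>m (rep_dim G \<rho>)"] ballI)
  fix g assume "g \<in> carrier G"
  then show "1\<^sub>m (rep_dim G \<rho>) * \<rho> g = \<rho> g * 1\<^sub>m (rep_dim G \<rho>)"
    using representationD(1)[OF assms] left_mult_one_mat right_mult_one_mat by metis
qed (auto simp: GL_iff)

lemma sum_list_indicator:
  assumes "\<And>\<tau>. \<tau> \<in> set \<tau>s \<Longrightarrow> f \<tau> = (if P \<tau> then c else (0 :: complex))"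
  shows "(\<Sum>\<tau>\<leftarrow>\<tau>s. f \<tau>) = c * of_nat (length (filter P \<tau>s))"
  using assms by (induction \<tau>s) (auto simp: algebra_simps)

text \<open>The left side does not mention \<open>\<tau>s\<close>, so every decomposition has the
  same number of summands equivalent to \<sigma>. This is what gives the definite description in
  \<open>multiplicity_rep\<close> a value.\<close>

lemma decomposition_count:
  assumes G: "group G" and fin: "finite (carrier G)" and \<sigma>: "irreducible_rep G \<sigma>"
    and \<rho>: "representation G \<rho>" and irr: "\<And>\<tau>. \<tau> \<in> set \<tau>s \<Longrightarrow> irreducible_rep G \<tau>"
    and eq: "equivalent_rep G \<rho> (direct_sum_rep \<tau>s)"
  shows "(\<Sum>g\<in>carrier G. mat_trace (\<rho> g) * mat_trace (\<sigma> (inv\<^bsub>G\<^esub> g))) =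
    of_nat (card (carrier G)) * of_nat (length (filter (equivalent_rep G \<sigma>) \<tau>s))"
proof -
  have r: "\<And>\<tau>. \<tau> \<in> set \<tau>s \<Longrightarrow> representation G \<tau>" and r\<sigma>: "representation G \<sigma>"
    using irr \<sigma> unfolding irreducible_rep_iff by auto
  have orth: "(\<Sum>g\<in>carrier G. mat_trace (\<tau> g) * mat_trace (\<sigma> (inv\<^bsub>G\<^esub> g))) =
      (if equivalent_rep G \<sigma> \<tau> then of_nat (card (carrier G)) else 0)" if \<tau>: "\<tau> \<in> set \<tau>s" for \<tau>
  proof (cases "equivalent_rep G \<sigma> \<tau>")
    case True
    then have "mat_trace (\<tau> g) = mat_trace (\<sigma> g)" if "g \<in> carrier G" for g
      using equivalent_rep_trace[OF True G r\<sigma> r[OF \<tau>] that] by simp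
    then show ?thesis using character_norm[OF G fin \<sigma>] True by simp
  next
    case False
    then show ?thesis using character_orthogonal[OF G \<sigma> irr[OF \<tau>]] by simp
  qed
  have "(\<Sum>g\<in>carrier G. mat_trace (\<rho> g) * mat_trace (\<sigma> (inv\<^bsub>G\<^esub> g))) =
      (\<Sum>g\<in>carrier G. \<Sum>\<tau>\<leftarrow>\<tau>s. mat_trace (\<tau> g) * mat_trace (\<sigma> (inv\<^bsub>G\<^esub> g)))"
    using equivalent_rep_trace[OF eq G \<rho> direct_sum_representation(1)[OF G r]] direct_sum_trace[OF G r]
    by (intro sum.cong refl) (simp add: sum_list_mult_const)
  also have "\<dots> = (\<Sum>\<tau>\<leftarrow>\<tau>s. \<Sum>g\<in>carrier G. mat_trace (\<tau> g) * mat_trace (\<sigma> (inv\<^bsub>G\<^esub> g)))"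
    by (induction \<tau>s) (simp_all add: sum.distrib)
  also have "\<dots> = of_nat (card (carrier G)) * of_nat (length (filter (equivalent_rep G \<sigma>) \<tau>s))"
    by (rule sum_list_indicator[OF orth])
  finally show ?thesis .
qed

section \<open>Maschke's theorem and complete reducibility\<close>

lemma subrep:
  assumes G: "group G" and \<rho>: "representation G \<rho>"
    and C: "C \<in> carrier_mat (rep_dim G \<rho>) k" and inj: "inj_mat C"
    and inv: "\<And>g v. g \<in> carrier G \<Longrightarrow> v \<in> carrier_vec k \<Longrightarrow>
      \<exists>u\<in>carrier_vec k. \<rho> g *\<^sub>v (C *\<^sub>v v) = C *\<^sub>v u"
  shows "\<exists>\<tau>. representation G \<tau> \<and> rep_dim G \<tau> = k \<and> (\<forall>g\<in>carrier G. \<rho> g * C = C * \<tau> g)"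
proof -
  interpret group G by fact
  let ?n = "rep_dim G \<rho>"
  note D = representationD[OF G \<rho>]
  obtain L where L: "L \<in> carrier_mat k ?n" "L * C = 1\<^sub>m k" using left_inverse_exists[OF C inj] by blast
  \<comment> \<open>This is the matrix of \<rho>(g) restricted to the range of \<open>C\<close>, in
    the basis formed by the columns of \<open>C\<close>.\<close>
  define \<tau> where "\<tau> = (\<lambda>g. L * \<rho> g * C)"
  have car: "\<tau> g \<in> carrier_mat k k" if "g \<in> carrier G" for g
    unfolding \<tau>_def using D(1)[OF that] L C by simp
  have key: "\<rho> g * C = C * \<tau> g" if g: "g \<in> carrier G" for g
  proof (rule eq_mat_on_vecI)
    show "\<rho> g * C \<in> carrier_mat ?n k" "C * \<tau> g \<in> carrier_mat ?n k" using D(1)[OF g] C car[OF g] by auto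
    fix v :: "complex vec" assume v: "v \<in> carrier_vec k"
    obtain u where u: "u \<in> carrier_vec k" "\<rho> g *\<^sub>v (C *\<^sub>v v) = C *\<^sub>v u" using inv[OF g v] by blast
    have "\<tau> g *\<^sub>v v = L *\<^sub>v (\<rho> g *\<^sub>v (C *\<^sub>v v))"
      unfolding \<tau>_def using D(1)[OF g] C L(1) v
      by (simp add: assoc_mult_mat_vec[of _ k ?n _ k] assoc_mult_mat_vec[of _ ?n ?n _ k] assoc_mult_mat[of _ k ?n _ ?n _ k])
    also have "\<dots> = (L * C) *\<^sub>v u" unfolding u(2) using L(1) C u(1) by simp
    also have "\<dots> = u" using L(2) u(1) by simp
    finally have "\<tau> g *\<^sub>v v = u" .
    then show "(\<rho> g * C) *\<^sub>v v = (C * \<tau> g) *\<^sub>v v"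
      using u D(1)[OF g] C v car[OF g]
      by (simp add: assoc_mult_mat_vec[of _ ?n ?n _ k] assoc_mult_mat_vec[of _ ?n k _ k])
  qed
  have mult: "\<tau> (g \<otimes>\<^bsub>G\<^esub> h) = \<tau> g * \<tau> h" if gh: "g \<in> carrier G" "h \<in> carrier G" for g h
  proof -
    have "\<tau> (g \<otimes>\<^bsub>G\<^esub> h) = L * (\<rho> g * (\<rho> h * C))"
      unfolding \<tau>_def D(2)[OF gh] using D(1)[OF gh(1)] D(1)[OF gh(2)] L(1) C
      by (simp add: assoc_mult_mat[of _ k ?n _ ?n _ k] assoc_mult_mat[of _ ?n ?n _ ?n _ k])
    also have "\<dots> = L * (\<rho> g * C * \<tau> h)"
      unfolding key[OF gh(2)] using D(1)[OF gh(1)] C car[OF gh(2)] by simp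
    also have "\<dots> = \<tau> g * \<tau> h"
      unfolding \<tau>_def[of ] using D(1)[OF gh(1)] D(1)[OF gh(2)] L(1) C
      by (simp add: assoc_mult_mat[of _ k ?n _ ?n _ k] assoc_mult_mat[of _ ?n ?n _ ?n _ k]
          assoc_mult_mat[of _ k ?n _ k _ k] assoc_mult_mat[of _ ?n ?n _ k _ k] assoc_mult_mat[of _ k ?n _ ?n _ ?n])
    finally show ?thesis .
  qed
  have "\<tau> \<one>\<^bsub>G\<^esub> = 1\<^sub>m k" unfolding \<tau>_def D(3) using L C by simp
  from representationI[OF G car mult this] key show ?thesis by blast
qed

lemma block_diag_mult_vec:
  assumes "A \<in> carrier_mat n n" "D \<in> carrier_mat m m" "(x :: complex vec) \<in> carrier_vec n" "y \<in> carrier_vec m"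
  shows "four_block_mat A (0\<^sub>m n m) (0\<^sub>m m n) D *\<^sub>v (x @\<^sub>v y) = (A *\<^sub>v x) @\<^sub>v (D *\<^sub>v y)"
  using assms by (subst four_block_mat_mult_vec[of _ n n _ m _ m]) auto

lemma hcat_mult_vec:
  assumes "A \<in> carrier_mat n k" "B \<in> carrier_mat n l" "(x :: complex vec) \<in> carrier_vec k" "y \<in> carrier_vec l"
  shows "four_block_mat A B (0\<^sub>m 0 k) (0\<^sub>m 0 l) *\<^sub>v (x @\<^sub>v y) = A *\<^sub>v x + B *\<^sub>v y"
  using assms by (subst four_block_mat_mult_vec[of _ n k _ l _ 0]) (auto intro!: eq_vecI)

lemma carrier_vec_appendE:
  assumes "(v :: complex vec) \<in> carrier_vec (n + m)"
  obtains x y where "x \<in> carrier_vec n" "y \<in> carrier_vec m" "v = x @\<^sub>v y"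
  using vec_first_last_append[OF assms] by (metis vec_first_carrier vec_last_carrier)

text \<open>\<open>E\<close> is the group average of the projection \<open>C * L\<close>, not
  divided by the group order, hence the factor in \<open>E * C\<close>. The factorisation through
  \<open>F\<close> records that its range lies in that of \<open>C\<close>; its kernel is the
  invariant complement.\<close>

lemma invariant_complement:
  assumes G: "group G" and fin: "finite (carrier G)" and \<rho>: "representation G \<rho>"
    and C: "C \<in> carrier_mat (rep_dim G \<rho>) k" and inj: "inj_mat C"
    and \<tau>: "representation G \<tau>" "rep_dim G \<tau> = k" "\<And>g. g \<in> carrier G \<Longrightarrow> \<rho> g * C = C * \<tau> g"
  shows "\<exists>E\<in>carrier_mat (rep_dim G \<rho>) (rep_dim G \<rho>). \<exists>F\<in>carrier_mat k (rep_dim G \<rho>).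
    E = C * F \<and> E * C = of_nat (card (carrier G)) \<cdot>\<^sub>m C \<and> (\<forall>g\<in>carrier G. \<rho> g * E = E * \<rho> g)"
proof -
  interpret group G by fact
  let ?n = "rep_dim G \<rho>"
  note D = representationD[OF G \<rho>] and D\<tau> = representationD[OF G \<tau>(1), unfolded \<tau>(2)]
  obtain L where L: "L \<in> carrier_mat k ?n" "L * C = 1\<^sub>m k" using left_inverse_exists[OF C inj] by blast
  define E where "E = averaged_mat G \<rho> \<rho> (C * L)"
  define F where "F = sum_mat k ?n (\<lambda>g. \<tau> (inv\<^bsub>G\<^esub> g) * (L * \<rho> g)) (carrier G)"
  have CL: "C * L \<in> carrier_mat ?n ?n" using C L by simp
  have t: "\<rho> (inv\<^bsub>G\<^esub> g) * (C * L) * \<rho> g = C * (\<tau> (inv\<^bsub>G\<^esub> g) * (L * \<rho> g))" if g: "g \<in> carrier G" for g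
  proof -
    have "\<rho> (inv\<^bsub>G\<^esub> g) * (C * L) * \<rho> g = (\<rho> (inv\<^bsub>G\<^esub> g) * C) * (L * \<rho> g)"
      using D(1)[of "inv\<^bsub>G\<^esub> g"] D(1)[of g] C L(1) g
      by (simp add: assoc_mult_mat[of _ ?n ?n _ ?n _ ?n] assoc_mult_mat[of _ ?n ?n _ k _ ?n] assoc_mult_mat[of _ ?n k _ ?n _ ?n])
    also have "\<dots> = C * (\<tau> (inv\<^bsub>G\<^esub> g) * (L * \<rho> g))"
      unfolding \<tau>(3)[OF inv_closed[OF g]]
      using D\<tau>(1)[of "inv\<^bsub>G\<^esub> g"] D(1)[of g] C L(1) g by (intro assoc_mult_mat) auto
    finally show ?thesis .
  qed
  have "E = sum_mat ?n ?n (\<lambda>g. C * (\<tau> (inv\<^bsub>G\<^esub> g) * (L * \<rho> g))) (carrier G)"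
    unfolding E_def averaged_mat_def by (rule sum_mat_cong) (rule t)
  also have "\<dots> = C * F"
    unfolding F_def by (rule mult_sum_mat[OF C, symmetric]) (use D(1) D\<tau>(1) L in \<open>auto intro!: mult_carrier_mat\<close>)
  finally have EF: "E = C * F" .
  have "E * C = sum_mat ?n k (\<lambda>g. \<rho> (inv\<^bsub>G\<^esub> g) * (C * L) * \<rho> g * C) (carrier G)"
    unfolding E_def averaged_mat_def
    by (rule sum_mat_mult[OF C]) (use D(1) CL in \<open>auto intro!: mult_carrier_mat[of _ ?n ?n]\<close>)
  also have "\<dots> = sum_mat ?n k (\<lambda>g. C) (carrier G)"
  proof (rule sum_mat_cong)
    fix g assume g: "g \<in> carrier G"
    have c: "\<rho> g \<in> carrier_mat ?n ?n" "\<rho> (inv\<^bsub>G\<^esub> g) \<in> carrier_mat ?n ?n" "\<tau> g \<in> carrier_mat k k"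
      using D(1) D\<tau>(1) g by auto
    have "\<rho> (inv\<^bsub>G\<^esub> g) * (C * L) * \<rho> g * C = \<rho> (inv\<^bsub>G\<^esub> g) * (C * L) * (\<rho> g * C)"
      using c C L(1) by (intro assoc_mult_mat) auto
    also have "\<dots> = \<rho> (inv\<^bsub>G\<^esub> g) * (C * L * (C * \<tau> g))"
      unfolding \<tau>(3)[OF g] using c C L(1) by (intro assoc_mult_mat) auto
    also have "C * L * (C * \<tau> g) = C * (L * C) * \<tau> g"
    proof -
      have "C * L * (C * \<tau> g) = C * (L * (C * \<tau> g))"
        using c C L(1) by (intro assoc_mult_mat) auto
      also have "L * (C * \<tau> g) = (L * C) * \<tau> g"
        using c C L(1) by (intro assoc_mult_mat[symmetric]) auto
      also have "C * ((L * C) * \<tau> g) = C * (L * C) * \<tau> g"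
        using c C L(1) by (intro assoc_mult_mat[symmetric]) auto
      finally show ?thesis .
    qed
    also have "C * (L * C) * \<tau> g = \<rho> g * C" unfolding L(2) \<tau>(3)[OF g] using C c by simp
    also have "\<rho> (inv\<^bsub>G\<^esub> g) * (\<rho> g * C) = (\<rho> (inv\<^bsub>G\<^esub> g) * \<rho> g) * C"
      using c C by (intro assoc_mult_mat[symmetric]) auto
    also have "\<rho> (inv\<^bsub>G\<^esub> g) * \<rho> g = 1\<^sub>m ?n" using g D(3) by (simp flip: D(2))
    finally show "\<rho> (inv\<^bsub>G\<^esub> g) * (C * L) * \<rho> g * C = C" using C by simp
  qed
  also have "\<dots> = of_nat (card (carrier G)) \<cdot>\<^sub>m C"
    by (intro eq_matI) (use C in \<open>auto simp: sum_mat_def\<close>)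
  finally have EC: "E * C = of_nat (card (carrier G)) \<cdot>\<^sub>m C" .
  have "\<forall>g\<in>carrier G. \<rho> g * E = E * \<rho> g"
    unfolding E_def using averaged_mat_comm[OF G \<rho> \<rho> CL] by blast
  moreover have "E \<in> carrier_mat ?n ?n" "F \<in> carrier_mat k ?n" unfolding E_def F_def by auto
  ultimately show ?thesis using EF EC by blast
qed

text \<open>An invariant subspace (the range of \<open>C\<close>) and the kernel of the averaged
  projection \<open>E\<close> (the range of \<open>B\<close>) are complementary. Their bases side by
  side form an invertible matrix \<open>P\<close> that conjugates \<rho> into block diagonal
  form.\<close>

lemma reducible_split:
  assumes G: "group G" and fin: "finite (carrier G)" and \<rho>: "representation G \<rho>"
    and n0: "rep_dim G \<rho> > 0" and red: "\<not> irreducible_rep G \<rho>"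
  shows "\<exists>\<tau>1 \<tau>2. representation G \<tau>1 \<and> representation G \<tau>2 \<and>
    rep_dim G \<tau>1 < rep_dim G \<rho> \<and> rep_dim G \<tau>2 < rep_dim G \<rho> \<and>
    equivalent_rep G \<rho> (direct_sum_rep [\<tau>1, \<tau>2])"
proof -
  interpret group G by fact
  let ?n = "rep_dim G \<rho>" and ?N = "of_nat (card (carrier G)) :: complex"
  note D = representationD[OF G \<rho>]
  have N0: "?N \<noteq> 0" using fin one_closed by auto
  obtain W where W: "subspace_vec ?n W" "\<forall>g\<in>carrier G. \<forall>w\<in>W. \<rho> g *\<^sub>v w \<in> W"
    and Wne: "W \<noteq> {0\<^sub>v ?n}" "W \<noteq> carrier_vec ?n"
    using red \<rho> n0 unfolding irreducible_rep_iff by auto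
  obtain k C where C: "C \<in> carrier_mat ?n k" "inj_mat C" "W = (*\<^sub>v) C ` carrier_vec k"
    using subspace_vec_basis[OF W(1)] by blast
  obtain \<tau> where \<tau>: "representation G \<tau>" "rep_dim G \<tau> = k" "\<And>g. g \<in> carrier G \<Longrightarrow> \<rho> g * C = C * \<tau> g"
    using subrep[OF G \<rho> C(1,2)] W(2) unfolding C(3) by blast
  obtain E F where E: "E \<in> carrier_mat ?n ?n" "F \<in> carrier_mat k ?n" "E = C * F" "E * C = ?N \<cdot>\<^sub>m C"
    and comm: "\<And>g. g \<in> carrier G \<Longrightarrow> \<rho> g * E = E * \<rho> g"
    using invariant_complement[OF G fin \<rho> C(1,2) \<tau>] by blast
  define K where "K = {v \<in> carrier_vec ?n. E *\<^sub>v v = 0\<^sub>v ?n}"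
  have "subspace_vec ?n K" unfolding K_def by (rule subspace_vec_kernel[OF E(1)])
  then obtain l B where B: "B \<in> carrier_mat ?n l" "inj_mat B" "K = (*\<^sub>v) B ` carrier_vec l"
    using subspace_vec_basis by blast
  have Kinv: "\<rho> g *\<^sub>v w \<in> K" if "g \<in> carrier G" "w \<in> K" for g w
  proof -
    have w: "w \<in> carrier_vec ?n" "E *\<^sub>v w = 0\<^sub>v ?n" using that(2) unfolding K_def by auto
    have "E *\<^sub>v (\<rho> g *\<^sub>v w) = (\<rho> g * E) *\<^sub>v w"
      unfolding comm[OF that(1)] using E(1) D(1)[OF that(1)] w(1) by (intro assoc_mult_mat_vec[symmetric]) auto
    also have "\<dots> = \<rho> g *\<^sub>v (E *\<^sub>v w)"
      using E(1) D(1)[OF that(1)] w(1) by (intro assoc_mult_mat_vec) auto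
    finally show ?thesis using D(1)[OF that(1)] w unfolding K_def by auto
  qed
  have "\<exists>\<tau>'. representation G \<tau>' \<and> rep_dim G \<tau>' = l \<and> (\<forall>g\<in>carrier G. \<rho> g * B = B * \<tau>' g)"
    by (rule subrep[OF G \<rho> B(1,2)]) (use Kinv in \<open>auto simp: B(3)\<close>)
  then obtain \<tau>' where \<tau>': "representation G \<tau>'" "rep_dim G \<tau>' = l" "\<And>g. g \<in> carrier G \<Longrightarrow> \<rho> g * B = B * \<tau>' g"
    by blast
  \<comment> \<open>Horizontal concatenation of \<open>C\<close> and \<open>B\<close>, written as a
    four-block matrix whose lower blocks have no rows.\<close>
  define P where "P = four_block_mat C B (0\<^sub>m 0 k) (0\<^sub>m 0 l)"
  have P: "P \<in> carrier_mat ?n (k + l)" unfolding P_def using C(1) B(1) by (metis add_0_right four_block_carrier_mat zero_carrier_mat)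
  have Pv: "P *\<^sub>v (x @\<^sub>v y) = C *\<^sub>v x + B *\<^sub>v y" if "x \<in> carrier_vec k" "y \<in> carrier_vec l" for x y
    unfolding P_def by (rule hcat_mult_vec[OF C(1) B(1) that])
  have EC: "E *\<^sub>v (C *\<^sub>v x) = ?N \<cdot>\<^sub>v (C *\<^sub>v x)" if x: "x \<in> carrier_vec k" for x
  proof -
    have "E *\<^sub>v (C *\<^sub>v x) = (E * C) *\<^sub>v x" using E(1) C(1) x by simp
    also have "\<dots> = ?N \<cdot>\<^sub>v (C *\<^sub>v x)" unfolding E(4) using C(1) x by (simp add: smult_mat_mult_vec[of _ ?n k])
    finally show ?thesis .
  qed
  have EB: "E *\<^sub>v (B *\<^sub>v y) = 0\<^sub>v ?n" if "y \<in> carrier_vec l" for y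
    using that B(3) unfolding K_def by blast
  have injP: "inj_mat P"
  proof (rule inj_matI[OF P])
    fix v :: "complex vec" assume v: "v \<in> carrier_vec (k + l)" and 0: "P *\<^sub>v v = 0\<^sub>v ?n"
    obtain x y where xy: "x \<in> carrier_vec k" "y \<in> carrier_vec l" "v = x @\<^sub>v y" using carrier_vec_appendE[OF v] .
    have s: "C *\<^sub>v x + B *\<^sub>v y = 0\<^sub>v ?n" using 0 Pv xy by simp
    have "E *\<^sub>v (C *\<^sub>v x + B *\<^sub>v y) = ?N \<cdot>\<^sub>v (C *\<^sub>v x) + 0\<^sub>v ?n"
      unfolding EC[OF xy(1), symmetric] EB[OF xy(2), symmetric] using E(1) C(1) B(1) xy
      by (intro mult_add_distrib_mat_vec) auto
    then have z: "?N \<cdot>\<^sub>v (C *\<^sub>v x) = 0\<^sub>v ?n" unfolding s using E(1) C(1) xy(1) by simp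
    have Cx: "C *\<^sub>v x = 0\<^sub>v ?n"
    proof (rule eq_vecI)
      fix i assume i: "i < dim_vec (0\<^sub>v ?n :: complex vec)"
      then have "(?N \<cdot>\<^sub>v (C *\<^sub>v x)) $ i = 0" unfolding z by simp
      then have "?N * (C *\<^sub>v x) $ i = 0" using i C(1) by (auto simp del: index_mult_mat_vec)
      then show "(C *\<^sub>v x) $ i = 0\<^sub>v ?n $ i" using i N0 by auto
    qed (use C(1) in auto)
    then have x: "x = 0\<^sub>v k" using inj_matD[OF C(2,1) xy(1)] by blast
    have "B *\<^sub>v y = 0\<^sub>v ?n" using s B(1) xy(2) unfolding Cx by simp
    then have y: "y = 0\<^sub>v l" using inj_matD[OF B(2,1) xy(2)] by blast
    show "v = 0\<^sub>v (k + l)" unfolding xy(3) x y by (intro eq_vecI) auto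
  qed
  have surjP: "\<exists>v\<in>carrier_vec (k + l). w = P *\<^sub>v v" if w: "w \<in> carrier_vec ?n" for w
  proof -
    \<comment> \<open>With this choice \<open>C *\<^sub>v x\<close> is the projection of
      \<open>w\<close> to the range of \<open>C\<close>, so the remainder lies in the kernel of
      \<open>E\<close>.\<close>
    define x where "x = (1 / ?N) \<cdot>\<^sub>v (F *\<^sub>v w)"
    have x: "x \<in> carrier_vec k" unfolding x_def using E(2) w by simp
    have Fw: "F *\<^sub>v w \<in> carrier_vec k" using E(2) w by simp
    have "C *\<^sub>v x = (1 / ?N) \<cdot>\<^sub>v (C *\<^sub>v (F *\<^sub>v w))" unfolding x_def using mult_mat_vec[OF C(1) Fw] .
    also have "C *\<^sub>v (F *\<^sub>v w) = E *\<^sub>v w" unfolding E(3) using C(1) E(2) w by simp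
    finally have Cx: "C *\<^sub>v x = (1 / ?N) \<cdot>\<^sub>v (E *\<^sub>v w)" .
    then have "?N \<cdot>\<^sub>v (C *\<^sub>v x) = E *\<^sub>v w" using N0 by (simp add: smult_smult_assoc)
    then have ECx: "E *\<^sub>v (C *\<^sub>v x) = E *\<^sub>v w" using EC[OF x] by simp
    have Cxc: "C *\<^sub>v x \<in> carrier_vec ?n" using C(1) x by simp
    have "E *\<^sub>v (w - C *\<^sub>v x) = E *\<^sub>v w - E *\<^sub>v (C *\<^sub>v x)"
      using E(1) w Cxc by (rule mult_minus_distrib_mat_vec)
    then have "w - C *\<^sub>v x \<in> K" unfolding K_def ECx using w Cxc E(1) by auto
    then obtain y where y: "y \<in> carrier_vec l" "w - C *\<^sub>v x = B *\<^sub>v y" unfolding B(3) by auto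
    have "w = C *\<^sub>v x + B *\<^sub>v y" unfolding y(2)[symmetric] using w Cxc C(1) by (intro eq_vecI) auto
    then show ?thesis using Pv[OF x y(1)] x y(1) by (intro bexI[of _ "x @\<^sub>v y"]) auto
  qed
  from bij_mat_inverse[OF P injP surjP] obtain Q where kl: "k + l = ?n"
    and Q: "Q \<in> carrier_mat ?n ?n" "P * Q = 1\<^sub>m ?n" "Q * P = 1\<^sub>m ?n" by auto
  have P: "P \<in> carrier_mat ?n ?n" using P kl by simp
  define \<beta> where "\<beta> = direct_sum_rep [\<tau>, \<tau>']"
  have r: "\<And>t. t \<in> set [\<tau>, \<tau>'] \<Longrightarrow> representation G t" using \<tau> \<tau>' by auto
  have \<beta>: "representation G \<beta>" "rep_dim G \<beta> = ?n"
    using direct_sum_representation[OF G, of "[\<tau>, \<tau>']"] \<tau>(1,2) \<tau>'(1,2) kl unfolding \<beta>_def by auto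
  have \<beta>g: "\<beta> g = four_block_mat (\<tau> g) (0\<^sub>m k l) (0\<^sub>m l k) (\<tau>' g)" if g: "g \<in> carrier G" for g
    using representationD(1)[OF G \<tau>(1) g] representationD(1)[OF G \<tau>'(1) g] \<tau>(2) \<tau>'(2)
    unfolding \<beta>_def by (auto simp: direct_sum_rep_Cons[of \<tau>])
  have PB: "\<rho> g * P = P * \<beta> g" if g: "g \<in> carrier G" for g
  proof (rule eq_mat_on_vecI)
    note c = D(1)[OF g] representationD(1)[OF G \<beta>(1) g, unfolded \<beta>(2)]
      representationD(1)[OF G \<tau>(1) g, unfolded \<tau>(2)] representationD(1)[OF G \<tau>'(1) g, unfolded \<tau>'(2)]
    show "\<rho> g * P \<in> carrier_mat ?n ?n" "P * \<beta> g \<in> carrier_mat ?n ?n" using c P by auto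
    fix v :: "complex vec" assume "v \<in> carrier_vec ?n"
    then have v: "v \<in> carrier_vec (k + l)" unfolding kl .
    obtain x y where xy: "x \<in> carrier_vec k" "y \<in> carrier_vec l" "v = x @\<^sub>v y" using carrier_vec_appendE[OF v] .
    have v': "v \<in> carrier_vec ?n" using v kl by simp
    have "(\<rho> g * P) *\<^sub>v v = \<rho> g *\<^sub>v (P *\<^sub>v v)" using c P v' by (intro assoc_mult_mat_vec) auto
    also have "\<dots> = \<rho> g *\<^sub>v (C *\<^sub>v x + B *\<^sub>v y)" using Pv xy by simp
    also have "\<dots> = \<rho> g *\<^sub>v (C *\<^sub>v x) + \<rho> g *\<^sub>v (B *\<^sub>v y)"
      using c C(1) B(1) xy by (intro mult_add_distrib_mat_vec) auto
    also have "\<rho> g *\<^sub>v (C *\<^sub>v x) = (\<rho> g * C) *\<^sub>v x"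
      using c C(1) xy(1) by (intro assoc_mult_mat_vec[symmetric]) auto
    also have "\<dots> = C *\<^sub>v (\<tau> g *\<^sub>v x)"
      unfolding \<tau>(3)[OF g] using c C(1) xy(1) by (intro assoc_mult_mat_vec) auto
    also have "\<rho> g *\<^sub>v (B *\<^sub>v y) = (\<rho> g * B) *\<^sub>v y"
      using c B(1) xy(2) by (intro assoc_mult_mat_vec[symmetric]) auto
    also have "\<dots> = B *\<^sub>v (\<tau>' g *\<^sub>v y)"
      unfolding \<tau>'(3)[OF g] using c B(1) xy(2) by (intro assoc_mult_mat_vec) auto
    also have "C *\<^sub>v (\<tau> g *\<^sub>v x) + B *\<^sub>v (\<tau>' g *\<^sub>v y) = P *\<^sub>v ((\<tau> g *\<^sub>v x) @\<^sub>v (\<tau>' g *\<^sub>v y))"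
      using c xy by (intro Pv[symmetric]) auto
    also have "(\<tau> g *\<^sub>v x) @\<^sub>v (\<tau>' g *\<^sub>v y) = \<beta> g *\<^sub>v v"
      unfolding \<beta>g[OF g] xy(3) by (rule block_diag_mult_vec[OF c(3,4) xy(1,2), symmetric])
    also have "P *\<^sub>v (\<beta> g *\<^sub>v v) = (P * \<beta> g) *\<^sub>v v" using c P v' by (intro assoc_mult_mat_vec[symmetric]) auto
    finally show "(\<rho> g * P) *\<^sub>v v = (P * \<beta> g) *\<^sub>v v" .
  qed
  have "Q * \<rho> g = \<beta> g * Q" if g: "g \<in> carrier G" for g
  proof -
    note c = D(1)[OF g] representationD(1)[OF G \<beta>(1) g, unfolded \<beta>(2)]
    have "Q * \<rho> g = Q * (\<rho> g * P) * Q"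
    proof -
      have "Q * (\<rho> g * P) * Q = Q * \<rho> g * (P * Q)" using Q(1) P c
        by (simp add: assoc_mult_mat[of _ ?n ?n _ ?n _ ?n])
      then show ?thesis using Q c by simp
    qed
    also have "\<dots> = (Q * P) * \<beta> g * Q" unfolding PB[OF g] using Q(1) P c
      by (simp add: assoc_mult_mat[of _ ?n ?n _ ?n _ ?n])
    finally show ?thesis using Q c by simp
  qed
  moreover have "Q \<in> carrier (GL ?n)" unfolding GL_iff using Q P by auto
  ultimately have eq: "equivalent_rep G \<rho> \<beta>" unfolding equivalent_rep_def \<beta>(2) by auto
  have "k > 0"
  proof (rule ccontr)
    assume "\<not> k > 0"
    then have "W = {0\<^sub>v ?n}" unfolding C(3) using C(1) by (auto intro!: eq_vecI image_eqI[of _ _ "0\<^sub>v 0"] simp: scalar_prod_def)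
    then show False using Wne by blast
  qed
  moreover have "l > 0"
  proof (rule ccontr)
    assume "\<not> l > 0"
    then have Cn: "C \<in> carrier_mat ?n ?n" using C(1) kl by simp
    then obtain R where R: "R \<in> carrier_mat ?n ?n" "C * R = 1\<^sub>m ?n" using square_inverse_exists C(2) by blast
    have "carrier_vec ?n \<subseteq> W"
    proof
      fix w :: "complex vec" assume w: "w \<in> carrier_vec ?n"
      have "w = (C * R) *\<^sub>v w" using R w by simp
      also have "\<dots> = C *\<^sub>v (R *\<^sub>v w)" using R(1) Cn w by simp
      finally show "w \<in> W" unfolding C(3) using R(1) w kl \<open>\<not> l > 0\<close> by auto
    qed
    then show False using Wne W(1) unfolding subspace_vec_def by blast
  qed
  ultimately have "k < ?n" "l < ?n" using kl by auto
  then show ?thesis using \<tau>(1,2) \<tau>'(1,2) eq unfolding \<beta>_def by blast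
qed

lemma equivalent_direct_sum_append:
  assumes G: "group G" and r: "representation G \<tau>1" "representation G \<tau>2"
    and rs: "\<And>t. t \<in> set (ss @ ts) \<Longrightarrow> representation G t"
    and e1: "equivalent_rep G \<tau>1 (direct_sum_rep ss)" and e2: "equivalent_rep G \<tau>2 (direct_sum_rep ts)"
  shows "equivalent_rep G (direct_sum_rep [\<tau>1, \<tau>2]) (direct_sum_rep (ss @ ts))"
proof -
  let ?k = "rep_dim G \<tau>1" and ?l = "rep_dim G \<tau>2"
  have rs1: "representation G (direct_sum_rep ss)" and rs2: "representation G (direct_sum_rep ts)"
    using direct_sum_representation(1)[OF G] rs by auto
  have d: "rep_dim G (direct_sum_rep ss) = ?k" "rep_dim G (direct_sum_rep ts) = ?l"
    using e1 e2 unfolding equivalent_rep_def by auto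
  obtain S T where S: "S \<in> carrier (GL ?k)" "\<And>g. g \<in> carrier G \<Longrightarrow> S * \<tau>1 g = direct_sum_rep ss g * S"
    and T: "T \<in> carrier (GL ?l)" "\<And>g. g \<in> carrier G \<Longrightarrow> T * \<tau>2 g = direct_sum_rep ts g * T"
    using e1 e2 unfolding equivalent_rep_def by blast
  obtain S' T' where S': "S' \<in> carrier_mat ?k ?k" "S' * S = 1\<^sub>m ?k" "S * S' = 1\<^sub>m ?k"
    and T': "T' \<in> carrier_mat ?l ?l" "T' * T = 1\<^sub>m ?l" "T * T' = 1\<^sub>m ?l"
    using S(1) T(1) unfolding GL_iff by auto
  have Sc: "S \<in> carrier_mat ?k ?k" and Tc: "T \<in> carrier_mat ?l ?l" using S T unfolding GL_iff by auto
  let ?b = "\<lambda>X Y. four_block_mat X (0\<^sub>m ?k ?l) (0\<^sub>m ?l ?k) Y"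
  have dim: "rep_dim G (direct_sum_rep [\<tau>1, \<tau>2]) = ?k + ?l"
    "rep_dim G (direct_sum_rep (ss @ ts)) = ?k + ?l"
    using direct_sum_representation(2)[OF G, of "[\<tau>1,\<tau>2]"] direct_sum_representation(2)[OF G, of "ss @ ts"]
      direct_sum_representation(2)[OF G, of ss] direct_sum_representation(2)[OF G, of ts] r rs d by auto
  have "?b S T \<in> carrier (GL (?k + ?l))"
    unfolding GL_iff
    by (intro conjI bexI[of _ "?b S' T'"])
      (use S' T' Sc Tc in \<open>auto simp: mult_block_diag[OF S'(1) Sc T'(1) Tc] mult_block_diag[OF Sc S'(1) Tc T'(1)]\<close>)
  moreover have "?b S T * direct_sum_rep [\<tau>1, \<tau>2] g = direct_sum_rep (ss @ ts) g * ?b S T"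
    if g: "g \<in> carrier G" for g
  proof -
    note c = representationD(1)[OF G r(1) g] representationD(1)[OF G r(2) g]
      representationD(1)[OF G rs1 g, unfolded d] representationD(1)[OF G rs2 g, unfolded d]
    have 1: "direct_sum_rep [\<tau>1, \<tau>2] g = ?b (\<tau>1 g) (\<tau>2 g)"
      using c by (auto simp: direct_sum_rep_Cons[of \<tau>1])
    have 2: "direct_sum_rep (ss @ ts) g = ?b (direct_sum_rep ss g) (direct_sum_rep ts g)"
      using c unfolding direct_sum_rep_def map_append diag_block_mat_append by (auto simp: Let_def)
    show ?thesis unfolding 1 2
      by (simp add: mult_block_diag[OF Sc c(1) Tc c(2)] mult_block_diag[OF c(3) Sc c(4) Tc] S(2)[OF g] T(2)[OF g])
  qed
  ultimately show ?thesis unfolding equivalent_rep_def dim by blast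
qed

theorem complete_reducibility:
  assumes G: "group G" and fin: "finite (carrier G)" and \<rho>: "representation G \<rho>"
  shows "\<exists>\<tau>s. (\<forall>\<tau>\<in>set \<tau>s. irreducible_rep G \<tau>) \<and> equivalent_rep G \<rho> (direct_sum_rep \<tau>s)"
  using \<rho>
proof (induction "rep_dim G \<rho>" arbitrary: \<rho> rule: less_induct)
  case less
  consider "rep_dim G \<rho> = 0" | "irreducible_rep G \<rho>" | "rep_dim G \<rho> > 0" "\<not> irreducible_rep G \<rho>" by auto
  then show ?case
  proof cases
    case 1
    \<comment> \<open>Irreducible representations have positive degree, so the representation of
      degree 0 is the empty direct sum.\<close>
    have "equivalent_rep G \<rho> (direct_sum_rep [])"
      unfolding equivalent_rep_def 1
    proof (intro conjI bexI[of _ "1\<^sub>m 0"] ballI)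
      show "0 = rep_dim G (direct_sum_rep [])" by (simp add: rep_dim_def direct_sum_rep_def)
      fix g assume "g \<in> carrier G"
      then have "\<rho> g \<in> carrier_mat 0 0" using representationD(1)[OF G less.prems] 1 by metis
      then show "1\<^sub>m 0 * \<rho> g = direct_sum_rep [] g * 1\<^sub>m 0" by (intro eq_matI) (auto simp: direct_sum_rep_def)
    qed (auto simp: GL_iff)
    then show ?thesis by (intro exI[of _ "[]"]) simp
  next
    case 2
    show ?thesis using 2 equivalent_rep_refl[OF G less.prems] by (intro exI[of _ "[\<rho>]"]) simp
  next
    case 3
    obtain \<tau>1 \<tau>2 where t: "representation G \<tau>1" "representation G \<tau>2"
      "rep_dim G \<tau>1 < rep_dim G \<rho>" "rep_dim G \<tau>2 < rep_dim G \<rho>" "equivalent_rep G \<rho> (direct_sum_rep [\<tau>1, \<tau>2])"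
      using reducible_split[OF G fin less.prems 3] by blast
    obtain ss ts where st: "\<forall>\<tau>\<in>set ss. irreducible_rep G \<tau>" "equivalent_rep G \<tau>1 (direct_sum_rep ss)"
      "\<forall>\<tau>\<in>set ts. irreducible_rep G \<tau>" "equivalent_rep G \<tau>2 (direct_sum_rep ts)"
      using less.hyps[OF t(3) t(1)] less.hyps[OF t(4) t(2)] by blast
    have rs: "\<And>\<tau>. \<tau> \<in> set (ss @ ts) \<Longrightarrow> representation G \<tau>"
      using st(1,3) unfolding irreducible_rep_iff by auto
    have "equivalent_rep G (direct_sum_rep [\<tau>1, \<tau>2]) (direct_sum_rep (ss @ ts))"
      by (rule equivalent_direct_sum_append[OF G t(1,2) rs st(2,4)])
    then have "equivalent_rep G \<rho> (direct_sum_rep (ss @ ts))"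
      by (rule equivalent_rep_trans[OF t(5) _ G less.prems]; intro direct_sum_representation(1)[OF G])
        (use t(1,2) rs in auto)
    then show ?thesis using st(1,3) by (intro exI[of _ "ss @ ts"]) auto
  qed
qed

theorem multiplicity_rep_character:
  assumes G: "group G" and fin: "finite (carrier G)" and \<sigma>: "irreducible_rep G \<sigma>" and \<rho>: "representation G \<rho>"
  shows "of_nat (multiplicity_rep G \<sigma> \<rho>) =
    (\<Sum>g\<in>carrier G. mat_trace (\<rho> g) * mat_trace (\<sigma> (inv\<^bsub>G\<^esub> g))) / of_nat (card (carrier G))"
proof -
  interpret group G by fact
  let ?N = "of_nat (card (carrier G)) :: complex"
  let ?S = "\<Sum>g\<in>carrier G. mat_trace (\<rho> g) * mat_trace (\<sigma> (inv\<^bsub>G\<^esub> g))"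
  have N0: "?N \<noteq> 0" using fin one_closed by auto
  let ?P = "\<lambda>m. \<exists>\<tau>s. (\<forall>\<tau>\<in>set \<tau>s. irreducible_rep G \<tau>) \<and> equivalent_rep G \<rho> (direct_sum_rep \<tau>s) \<and>
    m = length (filter (equivalent_rep G \<sigma>) \<tau>s)"
  have val: "?S = ?N * of_nat m" if "?P m" for m
    using that decomposition_count[OF G fin \<sigma> \<rho>] by blast
  obtain m where m: "?P m" using complete_reducibility[OF G fin \<rho>] by blast
  have "m' = m" if "?P m'" for m' using val[OF that] val[OF m] N0 by simp
  then have "multiplicity_rep G \<sigma> \<rho> = m"
    unfolding multiplicity_rep_def using m by (intro the_equality) blast+
  then show ?thesis using val[OF m] N0 by simp
qed

subsection \<open>Rational power series in three variables\<close>

definition coeff3 :: "'a :: zero fps fps fps \<Rightarrow> nat \<Rightarrow> nat \<Rightarrow> nat \<Rightarrow> 'a" where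
  "coeff3 f p q r = fps_nth (fps_nth (fps_nth f p) q) r"

lemma coeff3_fps3 [simp]: "coeff3 (fps3 a) p q r = a p q r"
  by (simp add: coeff3_def fps3_def)

lemma fps3_eqI: "(\<And>p q r. coeff3 f p q r = coeff3 g p q r) \<Longrightarrow> f = g"
  by (intro fps_ext) (simp add: coeff3_def)

lemma coeff3_0 [simp]: "coeff3 0 p q r = 0"
  and coeff3_uminus [simp]: "coeff3 (- g) p q r = - (coeff3 g p q r :: 'a)"
  and coeff3_add [simp]: "coeff3 (f + g) p q r = coeff3 f p q r + (coeff3 g p q r :: 'a :: comm_ring_1)"
  by (simp_all add: coeff3_def)

lemma coeff3_sum: "coeff3 (\<Sum>i\<in>A. f i) p q r = (\<Sum>i\<in>A. coeff3 (f i) p q r :: 'a :: comm_ring_1)"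
  by (induction A rule: infinite_finite_induct) simp_all

lemma coeff3_mult:
  fixes f g :: "'a :: comm_ring_1 fps fps fps"
  shows "coeff3 (f * g) p q r =
    (\<Sum>i\<le>p. \<Sum>j\<le>q. \<Sum>k\<le>r. coeff3 f i j k * coeff3 g (p - i) (q - j) (r - k))"
  by (simp add: coeff3_def fps_mult_nth fps_sum_nth atMost_atLeast0)

definition fps3_const :: "complex \<Rightarrow> complex fps fps fps" where
  "fps3_const c = fps_const (fps_const (fps_const c))"

text \<open>Every index from 2 on denotes the third variable, which spares a range condition on
  \<open>k\<close> in \<open>poly_fps3\<close>.\<close>

definition fps3_var :: "nat \<Rightarrow> complex fps fps fps" where
  "fps3_var k = (if k = 0 then fps_X else if k = 1 then fps_const fps_X else fps_const (fps_const fps_X))"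

lemma coeff3_const: "coeff3 (fps3_const c) p q r = (if p = 0 \<and> q = 0 \<and> r = 0 then c else 0)"
  by (simp add: coeff3_def fps3_const_def)

lemma coeff3_const_mult [simp]: "coeff3 (fps3_const c * f) p q r = c * coeff3 f p q r"
  by (simp add: coeff3_def fps3_const_def)

lemma coeff3_var_mult:
  "coeff3 (fps3_var 0 * f) p q r = (if p = 0 then 0 else coeff3 f (p - 1) q r)"
  "coeff3 (fps3_var 1 * f) p q r = (if q = 0 then 0 else coeff3 f p (q - 1) r)"
  "coeff3 (fps3_var 2 * f) p q r = (if r = 0 then 0 else coeff3 f p q (r - 1))"
  by (simp_all add: coeff3_def fps3_var_def)

lemma coeff3_var: "coeff3 (fps3_var k) p q r =
    (if k = 0 then (if p = 1 \<and> q = 0 \<and> r = 0 then 1 else 0)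
     else if k = 1 then (if p = 0 \<and> q = 1 \<and> r = 0 then 1 else 0)
     else (if p = 0 \<and> q = 0 \<and> r = 1 then 1 else 0))"
  by (simp add: coeff3_def fps3_var_def)

text \<open>The polynomials, as the subalgebra generated by constants and variables; closure
  properties are then immediate, and finite support is extracted by induction where it is
  wanted.\<close>

inductive_set poly_fps3 :: "complex fps fps fps set" where
  const: "fps3_const c \<in> poly_fps3"
| var: "fps3_var k \<in> poly_fps3"
| add: "f \<in> poly_fps3 \<Longrightarrow> g \<in> poly_fps3 \<Longrightarrow> f + g \<in> poly_fps3"
| mult: "f \<in> poly_fps3 \<Longrightarrow> g \<in> poly_fps3 \<Longrightarrow> f * g \<in> poly_fps3"

lemma poly_fps3_bounded:
  assumes "f \<in> poly_fps3"
  shows "\<exists>n. \<forall>p q r. p \<ge> n \<or> q \<ge> n \<or> r \<ge> n \<longrightarrow> coeff3 f p q r = 0"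
  using assms
proof induction
  case (const c)
  then show ?case by (intro exI[of _ 1]) (auto simp: coeff3_const)
next
  case (var k)
  then show ?case by (intro exI[of _ 2]) (auto simp: coeff3_var)
next
  case (add f g)
  then obtain n m where "\<forall>p q r. p \<ge> n \<or> q \<ge> n \<or> r \<ge> n \<longrightarrow> coeff3 f p q r = 0"
    "\<forall>p q r. p \<ge> m \<or> q \<ge> m \<or> r \<ge> m \<longrightarrow> coeff3 g p q r = 0" by blast
  then show ?case by (intro exI[of _ "n + m"]) auto
next
  case (mult f g)
  then obtain n m where f: "\<And>p q r. p \<ge> n \<or> q \<ge> n \<or> r \<ge> n \<Longrightarrow> coeff3 f p q r = 0"
    and g: "\<And>p q r. p \<ge> m \<or> q \<ge> m \<or> r \<ge> m \<Longrightarrow> coeff3 g p q r = 0" by blast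
  have "coeff3 (f * g) p q r = 0" if "p \<ge> n + m \<or> q \<ge> n + m \<or> r \<ge> n + m" for p q r
    unfolding coeff3_mult
  proof (intro sum.neutral ballI)
    fix i j k
    have "i \<ge> n \<or> j \<ge> n \<or> k \<ge> n \<or> p - i \<ge> m \<or> q - j \<ge> m \<or> r - k \<ge> m" using that by linarith
    then show "coeff3 f i j k * coeff3 g (p - i) (q - j) (r - k) = 0" using f g by auto
  qed
  then show ?case by blast
qed

text \<open>The denominator has to be nonzero, not invertible as a power series. Since the ring is a
  domain, products of denominators are again admissible.\<close>

definition rational_fps3 :: "complex fps fps fps set" where
  "rational_fps3 = {f. \<exists>D\<in>poly_fps3. D \<noteq> 0 \<and> D * f \<in> poly_fps3}"

lemma rational_fps3_poly: "f \<in> poly_fps3 \<Longrightarrow> f \<in> rational_fps3"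
proof -
  assume f: "f \<in> poly_fps3"
  have "fps3_const 1 = 1" by (simp add: fps3_const_def)
  then show ?thesis
    unfolding rational_fps3_def using f poly_fps3.const[of 1] by (auto intro!: bexI[of _ 1])
qed

lemma rational_fps3_add:
  assumes "f \<in> rational_fps3" "g \<in> rational_fps3"
  shows "f + g \<in> rational_fps3"
proof -
  obtain D E where "D \<in> poly_fps3" "D \<noteq> 0" "D * f \<in> poly_fps3" "E \<in> poly_fps3" "E \<noteq> 0" "E * g \<in> poly_fps3"
    using assms unfolding rational_fps3_def by blast
  moreover have "(D * E) * (f + g) = E * (D * f) + D * (E * g)" by (simp add: algebra_simps)
  ultimately have "D * E \<in> poly_fps3" "D * E \<noteq> 0" "(D * E) * (f + g) \<in> poly_fps3"
    by (simp_all add: poly_fps3.add poly_fps3.mult)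
  then show ?thesis unfolding rational_fps3_def by blast
qed

lemma rational_fps3_mult_poly:
  assumes "f \<in> poly_fps3" "g \<in> rational_fps3"
  shows "f * g \<in> rational_fps3"
proof -
  obtain E where "E \<in> poly_fps3" "E \<noteq> 0" "E * g \<in> poly_fps3"
    using assms unfolding rational_fps3_def by blast
  moreover from this have "E * (f * g) \<in> poly_fps3"
    unfolding mult.left_commute[of E f g] using assms(1) by (blast intro: poly_fps3.mult)
  ultimately show ?thesis unfolding rational_fps3_def by blast
qed

lemma rational_fps3_divide:
  assumes "D \<in> poly_fps3" "D \<noteq> 0" "D * f \<in> rational_fps3"
  shows "f \<in> rational_fps3"
proof -
  obtain E where "E \<in> poly_fps3" "E \<noteq> 0" "E * (D * f) \<in> poly_fps3"
    using assms unfolding rational_fps3_def by blast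
  then have "E * D \<in> poly_fps3" "E * D \<noteq> 0" "(E * D) * f \<in> poly_fps3"
    using assms(1,2) by (simp_all add: poly_fps3.mult mult.assoc)
  then show ?thesis unfolding rational_fps3_def by blast
qed

lemma rational_fps3_sum:
  assumes "\<And>x. x \<in> A \<Longrightarrow> f x \<in> rational_fps3"
  shows "sum f A \<in> rational_fps3"
proof -
  have "fps3_const 0 = 0" by (simp add: fps3_const_def)
  then have "0 \<in> rational_fps3" using rational_fps3_poly poly_fps3.const by metis
  then show ?thesis using assms
    by (induction A rule: infinite_finite_induct) (auto intro: rational_fps3_add)
qed

subsection \<open>Dickson's lemma\<close>

text \<open>Some subsequence is monotone. If it decreases, it reaches its minimum and is constant
  from there on, hence also increasing.\<close>

lemma mono_subsequence_nat:
  fixes x :: "nat \<Rightarrow> nat"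
  shows "\<exists>f. strict_mono (f :: nat \<Rightarrow> nat) \<and> mono (\<lambda>k. x (f k))"
proof -
  obtain f where f: "strict_mono (f :: nat \<Rightarrow> nat)" "monoseq (\<lambda>k. x (f k))" using seq_monosub[of x] by auto
  from f(2) consider "\<forall>m n. m \<le> n \<longrightarrow> x (f m) \<le> x (f n)" | "\<forall>m n. m \<le> n \<longrightarrow> x (f n) \<le> x (f m)"
    unfolding monoseq_def by auto
  then show ?thesis
  proof cases
    case 1
    then show ?thesis using f(1) unfolding mono_def by blast
  next
    case 2
    obtain k where k: "\<And>m. x (f k) \<le> x (f m)"
      using ex_has_least_nat[of "\<lambda>_. True" 0 "\<lambda>m. x (f m)"] by auto
    have "strict_mono (\<lambda>m. f (m + k))" using f(1) unfolding strict_mono_def by simp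
    moreover have "x (f (m + k)) = x (f k)" for m using 2 k by (simp add: antisym)
    then have "mono (\<lambda>m. x (f (m + k)))" unfolding mono_def by simp
    ultimately show ?thesis by blast
  qed
qed

lemma mono_subsequence_tuple:
  fixes e :: "nat \<Rightarrow> nat \<Rightarrow> nat"
  shows "\<exists>f. strict_mono (f :: nat \<Rightarrow> nat) \<and> (\<forall>i<n. mono (\<lambda>k. e (f k) i))"
proof (induction n)
  case 0
  show ?case by (intro exI[of _ "\<lambda>k. k"]) (simp add: strict_mono_def)
next
  case (Suc n)
  then obtain f where f: "strict_mono (f :: nat \<Rightarrow> nat)" "\<And>i. i < n \<Longrightarrow> mono (\<lambda>k. e (f k) i)" by blast
  obtain h where h: "strict_mono (h :: nat \<Rightarrow> nat)" "mono (\<lambda>k. e (f (h k)) n)"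
    using mono_subsequence_nat[of "\<lambda>k. e (f k) n"] by auto
  have "strict_mono (\<lambda>k. f (h k))" using f(1) h(1) unfolding strict_mono_def by blast
  moreover have "mono (\<lambda>k. e (f (h k)) i)" if "i < n" for i
    using f(2)[OF that] strict_mono_mono[OF h(1)] unfolding mono_def by blast
  ultimately show ?case using h(2) by (intro exI[of _ "\<lambda>k. f (h k)"]) (auto simp: less_Suc_eq)
qed

definition exponents :: "nat \<Rightarrow> (nat \<Rightarrow> nat) set" where
  "exponents n = {e. \<forall>i\<ge>n. e i = 0}"

text \<open>The pointwise order on exponents is divisibility of monomials, so the complement of such
  a set is the exponent set of a monomial ideal.\<close>

definition down_closed :: "(nat \<Rightarrow> nat) set \<Rightarrow> bool" where
  "down_closed S \<longleftrightarrow> (\<forall>e f. f \<in> S \<longrightarrow> e \<le> f \<longrightarrow> e \<in> S)"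

text \<open>The ascending chain condition for monomial ideals. If every step lost an exponent
  \<open>e k\<close>, Dickson's lemma would give indices with \<open>e (f 0) \<le> e (f 1)\<close>;
  the larger exponent still lies in \<open>S (Suc (f 0))\<close>, and downward closure would keep
  the smaller one there as well.\<close>

lemma down_closed_stabilises:
  assumes dc: "\<And>k. down_closed (S k)" and dec: "\<And>k. S (Suc k) \<subseteq> S k"
  shows "\<exists>k. S (Suc k) \<inter> exponents n = S k \<inter> exponents n"
proof (rule ccontr)
  assume "\<not> ?thesis"
  then have "\<forall>k. \<exists>e. e \<in> exponents n \<and> e \<in> S k \<and> e \<notin> S (Suc k)" using dec by blast
  then obtain e where e: "\<And>k. e k \<in> exponents n" "\<And>k. e k \<in> S k" "\<And>k. e k \<notin> S (Suc k)" by metis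
  obtain f where f: "strict_mono (f :: nat \<Rightarrow> nat)" "\<And>i. i < n \<Longrightarrow> mono (\<lambda>k. e (f k) i)"
    using mono_subsequence_tuple[of n e] by auto
  have "e (f 0) \<le> e (f 1)"
  proof (rule le_funI)
    fix i show "e (f 0) i \<le> e (f 1) i"
      using monoD[OF f(2), of i 0 1] e(1)[of "f 0"] unfolding exponents_def by (cases "i < n") auto
  qed
  moreover have "S (f 1) \<subseteq> S (Suc (f 0))"
    using lift_Suc_antimono_le[of S, OF dec] strict_monoD[OF f(1), of 0 1] by simp
  ultimately show False using e(2)[of "f 1"] e(3)[of "f 0"] dc unfolding down_closed_def by blast
qed

subsection \<open>Hilbert series of down-closed sets of exponents\<close>

context
  fixes dg :: "nat \<Rightarrow> nat" and \<mu> :: "nat \<Rightarrow> complex"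
  assumes dg: "\<And>i. dg i < 3"
begin

definition multideg :: "nat \<Rightarrow> (nat \<Rightarrow> nat) \<Rightarrow> nat \<Rightarrow> nat" where
  "multideg n e k = (\<Sum>i<n. if dg i = k then e i else 0)"

definition exps_of_deg :: "nat \<Rightarrow> nat \<Rightarrow> nat \<Rightarrow> nat \<Rightarrow> (nat \<Rightarrow> nat) set" where
  "exps_of_deg n p q r = {e \<in> exponents n. multideg n e 0 = p \<and> multideg n e 1 = q \<and> multideg n e 2 = r}"

definition exp_weight :: "nat \<Rightarrow> (nat \<Rightarrow> nat) \<Rightarrow> complex" where
  "exp_weight n e = (\<Prod>i<n. \<mu> i ^ e i)"

definition hilbert_series :: "nat \<Rightarrow> (nat \<Rightarrow> nat) set \<Rightarrow> complex fps fps fps" where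
  "hilbert_series n S = fps3 (\<lambda>p q r. \<Sum>e\<in>S \<inter> exps_of_deg n p q r. exp_weight n e)"

lemma multideg_total: "multideg n e 0 + multideg n e 1 + multideg n e 2 = (\<Sum>i<n. e i)"
proof -
  have "(if dg i = 0 then e i else 0) + (if dg i = 1 then e i else 0) + (if dg i = 2 then e i else 0) = e i" for i
    using dg[of i] by (auto simp: less_Suc_eq numeral_3_eq_3)
  then show ?thesis unfolding multideg_def sum.distrib[symmetric] by (simp only:)
qed

lemma finite_exps_of_deg: "finite (exps_of_deg n p q r)"
proof (rule finite_subset)
  show "exps_of_deg n p q r \<subseteq> {e. \<forall>i. (i \<in> {..<n} \<longrightarrow> e i \<in> {..p + q + r}) \<and> (i \<notin> {..<n} \<longrightarrow> e i = 0)}"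
  proof
    fix e assume e: "e \<in> exps_of_deg n p q r"
    then have "(\<Sum>i<n. e i) = p + q + r" using multideg_total[of n e] unfolding exps_of_deg_def by simp
    then have "e i \<le> p + q + r" if "i < n" for i using that member_le_sum[of i "{..<n}" e] by simp
    then show "e \<in> {e. \<forall>i. (i \<in> {..<n} \<longrightarrow> e i \<in> {..p + q + r}) \<and> (i \<notin> {..<n} \<longrightarrow> e i = 0)}"
      using e unfolding exps_of_deg_def exponents_def by auto
  qed
qed (rule finite_set_of_finite_funs; simp)

text \<open>In terms of the complementary monomial ideal this is the colon ideal by the k-th power
  of the variable \<open>n\<close>.\<close>

definition shift_exps :: "nat \<Rightarrow> nat \<Rightarrow> (nat \<Rightarrow> nat) set \<Rightarrow> (nat \<Rightarrow> nat) set" where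
  "shift_exps n k S = {e. e(n := e n + k) \<in> S}"

lemma multideg_Suc: "multideg (Suc n) e k = multideg n e k + (if dg n = k then e n else 0)"
  by (simp add: multideg_def)

lemma multideg_upd: "multideg n (e(n := v)) k = multideg n e k"
  unfolding multideg_def by (intro sum.cong) auto

lemma exp_weight_upd: "exp_weight n (e(n := v)) = exp_weight n e"
  unfolding exp_weight_def by (intro prod.cong) auto

lemma exp_weight_Suc: "exp_weight (Suc n) e = exp_weight n e * \<mu> n ^ e n"
  unfolding exp_weight_def by simp

lemma exps_of_deg_Suc_zero:
  assumes "e n = 0"
  shows "e \<in> exps_of_deg (Suc n) p q r \<longleftrightarrow> e \<in> exps_of_deg n p q r"
proof -
  have "e \<in> exponents (Suc n) \<longleftrightarrow> e \<in> exponents n"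
  proof
    assume "e \<in> exponents (Suc n)"
    then have "e i = 0" if "n \<le> i" for i using that assms unfolding exponents_def by (cases "i = n") auto
    then show "e \<in> exponents n" unfolding exponents_def by simp
  qed (simp add: exponents_def)
  then show ?thesis unfolding exps_of_deg_def multideg_Suc using assms by auto
qed

lemma exps_of_deg_incr:
  "e(n := Suc (e n)) \<in> exps_of_deg (Suc n) p q r \<longleftrightarrow>
    (if dg n = 0 then p \<noteq> 0 \<and> e \<in> exps_of_deg (Suc n) (p - 1) q r
     else if dg n = 1 then q \<noteq> 0 \<and> e \<in> exps_of_deg (Suc n) p (q - 1) r
     else r \<noteq> 0 \<and> e \<in> exps_of_deg (Suc n) p q (r - 1))"
proof -
  define f where "f = e(n := Suc (e n))"
  have ex: "f \<in> exponents (Suc n) \<longleftrightarrow> e \<in> exponents (Suc n)"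
    unfolding exponents_def f_def by auto
  have "multideg (Suc n) f k = multideg (Suc n) e k + (if dg n = k then 1 else 0)" for k
    using multideg_upd[of n e "Suc (e n)" k] unfolding f_def by (simp add: multideg_Suc)
  note md = this[of 0] this[of 1] this[of 2]
  consider "dg n = 0" | "dg n = 1" | "dg n = 2" using dg[of n] by linarith
  then show ?thesis unfolding f_def[symmetric] exps_of_deg_def mem_Collect_eq ex md
    by cases (simp_all, linarith+)
qed

text \<open>The exponents of \<open>S\<close> are split according to whether variable
  \<open>n\<close> occurs. Where it does, dividing by it once is a bijection to the shifted set; it
  removes one factor \<open>\<mu> n\<close> from the weight and lowers the degree
  \<open>dg n\<close> by one.\<close>

lemma hilbert_series_Suc:
  "hilbert_series (Suc n) S = hilbert_series n {e \<in> S. e n = 0} +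
     fps3_const (\<mu> n) * (fps3_var (dg n) * hilbert_series (Suc n) (shift_exps n 1 S))"
proof -
  define T where "T = shift_exps n 1 S"
  show ?thesis unfolding T_def[symmetric]
  proof (rule fps3_eqI)
    fix p q r
    let ?A = "S \<inter> exps_of_deg (Suc n) p q r"
    let ?w = "exp_weight (Suc n)"
    have fin: "finite ?A" using finite_exps_of_deg by simp
    have 1: "(\<Sum>e\<in>{e\<in>?A. e n = 0}. ?w e) = (\<Sum>e\<in>{e \<in> S. e n = 0} \<inter> exps_of_deg n p q r. exp_weight n e)"
      by (rule sum.cong) (auto simp: exps_of_deg_Suc_zero exp_weight_Suc)
    let ?B = "{e \<in> T. e(n := Suc (e n)) \<in> exps_of_deg (Suc n) p q r}"
    have 2: "(\<Sum>e\<in>{e\<in>?A. e n \<noteq> 0}. ?w e) = (\<Sum>e\<in>?B. \<mu> n * ?w e)"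
    proof (rule sum.reindex_bij_witness[of _ "\<lambda>e. e(n := Suc (e n))" "\<lambda>e. e(n := e n - 1)"])
      fix e assume "e \<in> {e\<in>?A. e n \<noteq> 0}"
      then show "(e(n := e n - 1))(n := Suc ((e(n := e n - 1)) n)) = e" "e(n := e n - 1) \<in> ?B"
        by (auto simp: T_def shift_exps_def)
      show "\<mu> n * ?w (e(n := e n - 1)) = ?w e"
      proof -
        obtain m where "e n = Suc m" using \<open>e \<in> {e\<in>?A. e n \<noteq> 0}\<close> by (cases "e n") auto
        then show ?thesis using exp_weight_upd[of n e m] by (simp add: exp_weight_Suc)
      qed
    next
      fix e assume "e \<in> ?B"
      then show "(e(n := Suc (e n)))(n := (e(n := Suc (e n))) n - 1) = e"
        "e(n := Suc (e n)) \<in> {e\<in>?A. e n \<noteq> 0}" by (auto simp: T_def shift_exps_def)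
    qed
    have "?A = {e\<in>?A. e n = 0} \<union> {e\<in>?A. e n \<noteq> 0}" by blast
    then have "(\<Sum>e\<in>?A. ?w e) = (\<Sum>e\<in>{e\<in>?A. e n = 0} \<union> {e\<in>?A. e n \<noteq> 0}. ?w e)"
      by (rule arg_cong[where f = "sum ?w"])
    also have "\<dots> = (\<Sum>e\<in>{e\<in>?A. e n = 0}. ?w e) + (\<Sum>e\<in>{e\<in>?A. e n \<noteq> 0}. ?w e)"
      by (rule sum.union_disjoint; (rule finite_subset[OF _ fin])?) blast+
    also have "\<dots> = coeff3 (hilbert_series n {e \<in> S. e n = 0} +
       fps3_const (\<mu> n) * (fps3_var (dg n) * hilbert_series (Suc n) (T))) p q r"
    proof -
      have "(\<Sum>e\<in>?B. \<mu> n * ?w e) =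
          \<mu> n * coeff3 (fps3_var (dg n) * hilbert_series (Suc n) (T)) p q r"
      proof -
        let ?H = "hilbert_series (Suc n) (T)"
        have H: "coeff3 ?H a b c = (\<Sum>e\<in>T \<inter> exps_of_deg (Suc n) a b c. ?w e)" for a b c
          by (simp add: hilbert_series_def)
        consider "dg n = 0" | "dg n = 1" | "dg n = 2" using dg[of n] by linarith
        then show ?thesis
        proof cases
          case 1
          have "?B = (if p = 0 then {} else T \<inter> exps_of_deg (Suc n) (p - 1) q r)"
            using 1 by (simp add: exps_of_deg_incr Int_def)
          then show ?thesis using 1 by (simp add: coeff3_var_mult(1) H sum_distrib_left)
        next
          case 2
          have "?B = (if q = 0 then {} else T \<inter> exps_of_deg (Suc n) p (q - 1) r)"
            using 2 by (simp add: exps_of_deg_incr Int_def)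
          then show ?thesis using 2 by (simp only: coeff3_var_mult(2)) (simp add: H sum_distrib_left)
        next
          case 3
          have "?B = (if r = 0 then {} else T \<inter> exps_of_deg (Suc n) p q (r - 1))"
            using 3 by (simp add: exps_of_deg_incr Int_def)
          then show ?thesis using 3 by (simp add: coeff3_var_mult(3) H sum_distrib_left)
        qed
      qed
      then show ?thesis unfolding 1 2 by (simp add: hilbert_series_def)
    qed
    finally show "coeff3 (hilbert_series (Suc n) S) p q r = coeff3 (hilbert_series n {e \<in> S. e n = 0} +
       fps3_const (\<mu> n) * (fps3_var (dg n) * hilbert_series (Suc n) (T))) p q r"
      by (simp add: hilbert_series_def)
  qed
qed

lemma hilbert_series_cong:
  "S \<inter> exponents n = T \<inter> exponents n \<Longrightarrow> hilbert_series n S = hilbert_series n T"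
proof -
  assume "S \<inter> exponents n = T \<inter> exponents n"
  then have "S \<inter> exps_of_deg n p q r = T \<inter> exps_of_deg n p q r" for p q r
    unfolding exps_of_deg_def by blast
  then show ?thesis unfolding hilbert_series_def by simp
qed

text \<open>Induction on the number of variables. The shifts of \<open>S\<close> decrease and become
  stationary at some \<open>K\<close>; there the recursion is a linear equation for a single series
  with coefficient 1 - z. From \<open>K\<close> the recursion leads back to the shift by 0, which is
  \<open>S\<close>.\<close>

theorem hilbert_series_rational:
  assumes "down_closed S"
  shows "hilbert_series n S \<in> rational_fps3"
  using assms
proof (induction n arbitrary: S)
  case 0
  have "hilbert_series 0 S = fps3_const (if (\<lambda>i. 0) \<in> S then 1 else 0)"
  proof (rule fps3_eqI)
    fix p q r
    have "exps_of_deg 0 p q r = (if p = 0 \<and> q = 0 \<and> r = 0 then {\<lambda>i. 0} else {})"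
      unfolding exps_of_deg_def exponents_def multideg_def by auto
    then show "coeff3 (hilbert_series 0 S) p q r = coeff3 (fps3_const (if (\<lambda>i. 0) \<in> S then 1 else 0)) p q r"
      by (auto simp: hilbert_series_def coeff3_const exp_weight_def)
  qed
  then show ?case by (simp only: rational_fps3_poly[OF poly_fps3.const])
next
  case (Suc n)
  let ?S = "\<lambda>k. shift_exps n k S"
  have dc: "down_closed (?S k)" for k
    using Suc.prems unfolding down_closed_def shift_exps_def by (auto simp: le_fun_def)
  have "e(n := e n + k) \<le> e(n := e n + Suc k)" for e :: "nat \<Rightarrow> nat" and k by (auto simp: le_fun_def)
  then have dec: "?S (Suc k) \<subseteq> ?S k" for k
    using Suc.prems unfolding down_closed_def shift_exps_def by blast
  obtain K where K: "?S (Suc K) \<inter> exponents (Suc n) = ?S K \<inter> exponents (Suc n)"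
    using down_closed_stabilises[of ?S "Suc n", OF dc dec] by blast
  have shift: "shift_exps n 1 (?S k) = ?S (Suc k)" for k unfolding shift_exps_def by simp
  have IH: "hilbert_series n {e \<in> ?S k. e n = 0} \<in> rational_fps3" for k
  proof (rule Suc.IH)
    have "e n = 0" if "e \<le> f" "f n = 0" for e f :: "nat \<Rightarrow> nat" using le_funD[OF that(1), of n] that(2) by simp
    then show "down_closed {e \<in> ?S k. e n = 0}" using dc[of k] unfolding down_closed_def by blast
  qed
  let ?z = "fps3_const (\<mu> n) * fps3_var (dg n)"
  have z: "?z \<in> poly_fps3" by (intro poly_fps3.intros)
  have rec: "hilbert_series (Suc n) (?S k) =
      hilbert_series n {e \<in> ?S k. e n = 0} + ?z * hilbert_series (Suc n) (?S (Suc k))" for k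
    using hilbert_series_Suc[of n "?S k"] unfolding shift by (simp add: mult.assoc)
  \<comment> \<open>Downward induction from \<open>K\<close>. Once \<open>j\<close> reaches
    \<open>K\<close>, truncated subtraction keeps the index at 0 and the step is trivial.\<close>
  have "hilbert_series (Suc n) (?S (K - j)) \<in> rational_fps3" for j
  proof (induction j)
    case 0
    have "hilbert_series (Suc n) (?S (Suc K)) = hilbert_series (Suc n) (?S K)"
      using hilbert_series_cong[OF K] .
    then have "hilbert_series (Suc n) (?S K) = hilbert_series n {e \<in> ?S K. e n = 0} + ?z * hilbert_series (Suc n) (?S K)"
      using rec[of K] by simp
    \<comment> \<open>The generation rules of \<open>poly_fps3\<close> contain sums and products
      only, so 1 - z is written with the constant -1.\<close>
    moreover have neg: "fps3_const (- 1) * f = - f" for f by (rule fps3_eqI) simp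
    ultimately have eq: "(1 + fps3_const (-1) * ?z) * hilbert_series (Suc n) (?S K) = hilbert_series n {e \<in> ?S K. e n = 0}"
      unfolding neg by (simp add: algebra_simps)
    have "fps3_const 1 = 1" by (simp add: fps3_const_def)
    then have "1 + fps3_const (-1) * ?z \<in> poly_fps3"
      using poly_fps3.add[OF poly_fps3.const[of 1] poly_fps3.mult[OF poly_fps3.const[of "-1"] z]] by simp
    moreover have "coeff3 (1 + fps3_const (-1) * ?z) 0 0 0 = 1"
    proof -
      have "coeff3 ?z 0 0 0 = 0" by (simp add: coeff3_var)
      moreover have "coeff3 (1 :: complex fps fps fps) 0 0 0 = 1" by (simp add: coeff3_def)
      ultimately show ?thesis by simp
    qed
    then have "1 + fps3_const (-1) * ?z \<noteq> 0" by (rule contrapos_pn) simp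
    ultimately have "hilbert_series (Suc n) (?S K) \<in> rational_fps3"
      by (rule rational_fps3_divide) (simp only: eq IH)
    then show ?case by simp
  next
    case (Suc j)
    show ?case
    proof (cases "j < K")
      case True
      then have eq: "Suc (K - Suc j) = K - j" by simp
      show ?thesis unfolding rec[of "K - Suc j"] eq
        by (intro rational_fps3_add rational_fps3_mult_poly IH z Suc)
    next
      case False
      then show ?thesis using Suc by simp
    qed
  qed
  from this[of K] show ?case by (simp add: shift_exps_def)
qed

end

subsection \<open>Descent to rational coefficients\<close>

text \<open>Stated for any vector space because it serves twice: for the complex numbers over the
  rationals in the descent, and for complex functions on \<open>SL 4\<close> in the positivity
  argument.\<close>

lemma (in vector_space) separating_functional:
  assumes T: "subspace T" and x: "x \<notin> T"
  shows "\<exists>f. Vector_Spaces.linear scale (*) f \<and> f x = 1 \<and> (\<forall>y\<in>T. f y = 0)"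
proof -
  interpret vector_space_pair scale "(*) :: 'a \<Rightarrow> 'a \<Rightarrow> 'a"
    by unfold_locales (simp_all add: algebra_simps)
  obtain B where B: "B \<subseteq> T" "independent B" "T \<subseteq> span B"
    using basis_exists[of T] by metis
  have sB: "span B = T" using B T by (simp add: span_minimal subset_antisym)
  then have "independent (insert x B)" using B(2) x by (simp add: independent_insert)
  then obtain f where f: "Vector_Spaces.linear scale (*) f" "\<forall>y\<in>insert x B. f y = (if y = x then 1 else 0)"
    using linear_independent_extend[of "insert x B" "\<lambda>y. if y = x then 1 else 0"] by blast
  interpret f: Vector_Spaces.linear scale "(*)" f by fact
  have "x \<notin> B" using B(1) x by blast
  then have "f y = 0" if "y \<in> B" for y using f(2) that by auto
  then have "f y = 0" if "y \<in> T" for y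
    using that unfolding sB[symmetric] by (rule f.eq_0_on_span)
  then show ?thesis using f by (intro exI[of _ f]) simp
qed

lemma fps3_of_poly_surj:
  assumes "\<And>p q r. p \<ge> n \<or> q \<ge> n \<or> r \<ge> n \<Longrightarrow> a p q r = 0"
  shows "\<exists>f. \<forall>p q r. coeff (coeff (coeff f p) q) r = (a p q r :: rat)"
proof -
  let ?f = "\<Sum>i<n. monom (\<Sum>j<n. monom (\<Sum>k<n. monom (a i j k) k) j) i"
  have "coeff (coeff (coeff ?f p) q) r = a p q r" for p q r
  proof -
    have 1: "coeff ?f p = (if p < n then \<Sum>j<n. monom (\<Sum>k<n. monom (a p j k) k) j else 0)"
      by (simp add: coeff_sum if_distrib cong: if_cong)
    have 2: "coeff (\<Sum>j<n. monom (\<Sum>k<n. monom (a p j k) k) j) q = (if q < n then \<Sum>k<n. monom (a p q k) k else 0)"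
      by (simp add: coeff_sum if_distrib cong: if_cong)
    have 3: "coeff (\<Sum>k<n. monom (a p q k) k) r = (if r < n then a p q r else 0)"
      by (simp add: coeff_sum if_distrib cong: if_cong)
    show ?thesis unfolding 1 using 2 3 assms[of p q r] by (auto simp: not_less)
  qed
  then show ?thesis by blast
qed

lemma rational_fps3_common_denominator:
  assumes "\<And>i. i \<le> (l :: nat) \<Longrightarrow> f i \<in> rational_fps3"
  shows "\<exists>D\<in>poly_fps3. D \<noteq> 0 \<and> (\<forall>i\<le>l. D * f i \<in> poly_fps3)"
  using assms
proof (induction l)
  case 0
  then show ?case unfolding rational_fps3_def by auto
next
  case (Suc l)
  then obtain D where D: "D \<in> poly_fps3" "D \<noteq> 0" "\<forall>i\<le>l. D * f i \<in> poly_fps3" by auto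
  obtain E where E: "E \<in> poly_fps3" "E \<noteq> 0" "E * f (Suc l) \<in> poly_fps3"
    using Suc.prems[of "Suc l"] unfolding rational_fps3_def by auto
  have "D * E * f i \<in> poly_fps3" if "i \<le> Suc l" for i
  proof (cases "i = Suc l")
    case True
    then show ?thesis using poly_fps3.mult[OF D(1) E(3)] by (simp add: mult.assoc)
  next
    case False
    then have "D * f i \<in> poly_fps3" using D(3) that by simp
    then have "E * (D * f i) \<in> poly_fps3" by (rule poly_fps3.mult[OF E(1)])
    then show ?thesis by (simp add: mult.assoc mult.left_commute)
  qed
  moreover have "D * E \<in> poly_fps3" "D * E \<noteq> 0" using D E by (simp_all add: poly_fps3.mult)
  ultimately show ?case by blast
qed

text \<open>A rational-linear functional \<open>f\<close> applied to all coefficients commutes with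
  multiplication by a series with natural coefficients, so it carries \<open>D * F i\<close> to the
  image of \<open>D\<close> times \<open>F i\<close>. Normalising \<open>f\<close> to 1 at one
  nonzero coefficient of \<open>D\<close> keeps the new denominator nonzero; a common
  \<open>D\<close> is taken beforehand so that one functional serves all \<open>i\<close>.\<close>

theorem rational_fps3_descent:
  fixes m :: "nat \<Rightarrow> nat \<Rightarrow> nat \<Rightarrow> nat \<Rightarrow> nat"
  assumes "\<And>i. i \<le> l \<Longrightarrow> fps3 (\<lambda>p q r. of_nat (m i p q r)) \<in> rational_fps3"
  shows "\<exists>N D. D \<noteq> 0 \<and> (\<forall>i\<le>l. to_fract (fps3 (\<lambda>p q r. of_nat (m i p q r)) :: complex fps fps fps) =
    to_fract (fps3_of_poly (N i)) / to_fract (fps3_of_poly D))"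
proof -
  let ?F = "\<lambda>i. fps3 (\<lambda>p q r. of_nat (m i p q r)) :: complex fps fps fps"
  obtain D where D: "D \<in> poly_fps3" "D \<noteq> 0" "\<And>i. i \<le> l \<Longrightarrow> D * ?F i \<in> poly_fps3"
    using rational_fps3_common_denominator[of l ?F] assms by blast
  obtain p0 q0 r0 where c: "coeff3 D p0 q0 r0 \<noteq> 0" using D(2) fps3_eqI[of D 0] by auto
  interpret Q: vector_space "\<lambda>(q :: rat) (z :: complex). of_rat q * z"
    by unfold_locales (simp_all add: algebra_simps of_rat_add of_rat_mult)
  obtain f where f: "Vector_Spaces.linear (\<lambda>q z. of_rat q * z) (*) f" "f (coeff3 D p0 q0 r0) = (1 :: rat)"
    using Q.separating_functional[OF Q.subspace_single_0, of "coeff3 D p0 q0 r0"] c by auto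
  interpret f: Vector_Spaces.linear "\<lambda>(q :: rat) (z :: complex). of_rat q * z" "(*)" f by fact
  have f_nat: "f (z * of_nat k) = f z * of_nat k" for z k
    using f.scale[of "of_nat k" z] by (simp add: mult.commute)
  have ex: "\<exists>g. \<forall>p q r. coeff (coeff (coeff g p) q) r = f (coeff3 G p q r)" if G: "G \<in> poly_fps3" for G
  proof -
    obtain n where n: "\<forall>p q r. p \<ge> n \<or> q \<ge> n \<or> r \<ge> n \<longrightarrow> coeff3 G p q r = 0"
      using poly_fps3_bounded[OF G] by blast
    show ?thesis
    proof (rule fps3_of_poly_surj[of n])
      fix p q r assume "n \<le> p \<or> n \<le> q \<or> n \<le> r"
      then have "coeff3 G p q r = 0" using n by blast
      then show "f (coeff3 G p q r) = 0" by (simp add: f.zero)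
    qed
  qed
  obtain D' where D': "\<And>p q r. coeff (coeff (coeff D' p) q) r = f (coeff3 D p q r)" using ex[OF D(1)] by blast
  have "\<forall>i. \<exists>N. i \<le> l \<longrightarrow> (\<forall>p q r. coeff (coeff (coeff N p) q) r = f (coeff3 (D * ?F i) p q r))"
    using ex[OF D(3)] by blast
  then obtain N where N: "\<And>i p q r. i \<le> l \<Longrightarrow> coeff (coeff (coeff (N i) p) q) r = f (coeff3 (D * ?F i) p q r)"
    by metis
  have c3: "coeff3 (fps3_of_poly g) p q r = of_rat (coeff (coeff (coeff g p) q) r)" for g p q r
    by (simp add: fps3_of_poly_def)
  have eq: "fps3_of_poly D' * ?F i = fps3_of_poly (N i)" if i: "i \<le> l" for i
  proof (rule fps3_eqI)
    fix p q r
    have "coeff3 (fps3_of_poly (N i)) p q r = of_rat (f (coeff3 (D * ?F i) p q r))"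
      unfolding c3 N[OF i] ..
    also have "coeff3 (D * ?F i) p q r =
        (\<Sum>a\<le>p. \<Sum>b\<le>q. \<Sum>c\<le>r. coeff3 D a b c * of_nat (m i (p - a) (q - b) (r - c)))"
      by (simp add: coeff3_mult)
    also have "f \<dots> = (\<Sum>a\<le>p. \<Sum>b\<le>q. \<Sum>c\<le>r. f (coeff3 D a b c) * of_nat (m i (p - a) (q - b) (r - c)))"
      by (simp add: f.sum f_nat)
    also have "of_rat \<dots> = coeff3 (fps3_of_poly D' * ?F i) p q r"
      by (simp add: coeff3_mult c3 D' of_rat_sum of_rat_mult)
    finally show "coeff3 (fps3_of_poly D' * ?F i) p q r = coeff3 (fps3_of_poly (N i)) p q r" ..
  qed
  have "coeff (coeff (coeff D' p0) q0) r0 = 1" unfolding D' f(2) ..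
  then have "D' \<noteq> 0" by auto
  moreover have nz: "fps3_of_poly D' \<noteq> 0"
  proof
    assume "fps3_of_poly D' = 0"
    then have "coeff3 (fps3_of_poly D') p0 q0 r0 = 0" by simp
    then show False unfolding c3 D' f(2) by simp
  qed
  moreover have "to_fract (?F i) = to_fract (fps3_of_poly (N i)) / to_fract (fps3_of_poly D')" if "i \<le> l" for i
    using nz by (simp add: eq[OF that, symmetric] to_fract_mult)
  ultimately show ?thesis by blast
qed

subsection \<open>Standard monomials\<close>

lemma sum_apply: "(\<Sum>i\<in>A. f i) x = (\<Sum>i\<in>A. (f i x :: 'a :: comm_monoid_add))"
  by (induction A rule: infinite_finite_induct) simp_all


definition lex_less :: "(nat \<Rightarrow> nat) \<Rightarrow> (nat \<Rightarrow> nat) \<Rightarrow> bool" where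
  "lex_less e f \<longleftrightarrow> (\<exists>k. e k < f k \<and> (\<forall>i<k. e i = f i))"

lemma lex_less_irrefl [simp]: "\<not> lex_less e e"
  unfolding lex_less_def by simp

lemma lex_less_trans:
  assumes "lex_less e f" "lex_less f g"
  shows "lex_less e g"
proof -
  obtain k l where "e k < f k" "\<forall>i<k. e i = f i" "f l < g l" "\<forall>i<l. f i = g i"
    using assms unfolding lex_less_def by blast
  then show ?thesis unfolding lex_less_def
    by (intro exI[of _ "min k l"]) (cases k l rule: linorder_cases; simp)
qed

lemma lex_less_total:
  assumes "e \<noteq> f"
  shows "lex_less e f \<or> lex_less f e"
proof -
  define k where "k = (LEAST i. e i \<noteq> f i)"
  have "\<exists>i. e i \<noteq> f i" using assms by auto
  then have "e k \<noteq> f k" "\<forall>i<k. e i = f i"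
    unfolding k_def by (rule LeastI_ex, use not_less_Least in blast)
  then show ?thesis unfolding lex_less_def by (metis linorder_neqE_nat)
qed

lemma lex_less_add: "lex_less e f \<Longrightarrow> lex_less (\<lambda>i. e i + h i) (\<lambda>i. f i + h i)"
  unfolding lex_less_def by auto

interpretation fun_vs: vector_space "\<lambda>(c :: complex) (f :: 'x \<Rightarrow> complex) x. c * f x"
  by unfold_locales (simp_all add: fun_eq_iff algebra_simps)

locale monomial_functions =
  fixes X :: "'x set" and y :: "nat \<Rightarrow> 'x \<Rightarrow> complex" and n :: nat and dg :: "nat \<Rightarrow> nat"
  assumes dg: "\<And>i. dg i < 3"
begin

abbreviation exps where "exps \<equiv> exps_of_deg dg n"

text \<open>Extending by zero outside \<open>X\<close> makes equality as functions the same as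
  equality on \<open>X\<close>, so spans can be formed in the space of all functions.\<close>

definition mono_fun :: "(nat \<Rightarrow> nat) \<Rightarrow> 'x \<Rightarrow> complex" where
  "mono_fun e x = (if x \<in> X then \<Prod>i<n. y i x ^ e i else 0)"

definition smaller :: "(nat \<Rightarrow> nat) \<Rightarrow> (nat \<Rightarrow> nat) set" where
  "smaller e = {f \<in> exponents n. lex_less f e \<and> (\<forall>k. multideg dg n f k = multideg dg n e k)}"

definition standard :: "(nat \<Rightarrow> nat) set" where
  "standard = {e \<in> exponents n. mono_fun e \<notin> fun_vs.span (mono_fun ` smaller e)}"

lemma mono_fun_add: "mono_fun (\<lambda>i. e i + h i) = (\<lambda>x. mono_fun e x * mono_fun h x)"
  unfolding mono_fun_def by (auto simp: fun_eq_iff power_add prod.distrib)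

lemma mult_span:
  assumes "F \<in> fun_vs.span S"
  shows "(\<lambda>x. F x * h x) \<in> fun_vs.span ((\<lambda>F x. F x * h x) ` S)"
  using assms
proof (induction rule: fun_vs.span_induct_alt)
  case base
  then show ?case using fun_vs.span_zero[of "(\<lambda>F x. F x * h x) ` S"] by (simp add: zero_fun_def)
next
  case (step c G F)
  have "(\<lambda>x. c * (G x * h x)) + (\<lambda>x. F x * h x) \<in> fun_vs.span ((\<lambda>F x. F x * h x) ` S)"
    by (intro fun_vs.span_add fun_vs.span_scale step) (use step in \<open>auto intro!: fun_vs.span_base\<close>)
  then show ?case by (simp add: plus_fun_def algebra_simps)
qed

lemma multideg_add: "multideg dg n (\<lambda>i. e i + h i) k = multideg dg n e k + multideg dg n h k"
  unfolding multideg_def[OF dg] by (simp add: sum.distrib[symmetric] if_distrib) (intro sum.cong; simp)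

text \<open>A relation expressing the monomial of \<open>e\<close> by smaller ones can be multiplied
  by the monomial of f - e. Lexicographic order and equality of multidegrees survive the addition of
  an exponent, so \<open>f\<close> would not be standard either.\<close>

lemma down_closed_standard: "down_closed standard"
  unfolding down_closed_def
proof (intro allI impI)
  fix e f :: "nat \<Rightarrow> nat" assume f: "f \<in> standard" and le: "e \<le> f"
  define h where "h = (\<lambda>i. f i - e i)"
  have feh: "f = (\<lambda>i. e i + h i)" unfolding h_def using le by (auto simp: le_fun_def)
  have fx: "f \<in> exponents n" using f unfolding standard_def by simp
  have "e i = 0" if "n \<le> i" for i using le_funD[OF le, of i] fx that unfolding exponents_def by auto
  then have ex: "e \<in> exponents n" unfolding exponents_def by simp
  show "e \<in> standard"
  proof (rule ccontr)
    assume "e \<notin> standard"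
    then have "mono_fun e \<in> fun_vs.span (mono_fun ` smaller e)" using ex unfolding standard_def by simp
    then have "mono_fun f \<in> fun_vs.span ((\<lambda>F x. F x * mono_fun h x) ` mono_fun ` smaller e)"
      unfolding feh mono_fun_add by (rule mult_span)
    moreover have "(\<lambda>F x. F x * mono_fun h x) ` mono_fun ` smaller e \<subseteq> mono_fun ` smaller f"
    proof
      fix F assume "F \<in> (\<lambda>F x. F x * mono_fun h x) ` mono_fun ` smaller e"
      then obtain g where g: "g \<in> smaller e" "F = mono_fun (\<lambda>i. g i + h i)"
        unfolding mono_fun_add by auto
      have "(\<lambda>i. g i + h i) \<in> exponents n" using g(1) fx unfolding smaller_def exponents_def h_def by auto
      then have "(\<lambda>i. g i + h i) \<in> smaller f"
        using g(1) lex_less_add[of g e h] unfolding smaller_def feh by (simp add: multideg_add)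
      then show "F \<in> mono_fun ` smaller f" using g(2) by blast
    qed
    ultimately have "mono_fun f \<in> fun_vs.span (mono_fun ` smaller f)" using fun_vs.span_mono by blast
    then show False using f unfolding standard_def by simp
  qed
qed

lemma multideg_eq_0: "k \<ge> 3 \<Longrightarrow> multideg dg n e k = 0"
  unfolding multideg_def[OF dg] using dg by (intro sum.neutral) (auto simp: not_less[symmetric])

lemma smaller_exps:
  assumes e: "e \<in> exps p q r"
  shows "smaller e = {f \<in> exps p q r. lex_less f e}"
proof -
  have "(\<forall>k. multideg dg n f k = multideg dg n e k) \<longleftrightarrow>
      multideg dg n f 0 = p \<and> multideg dg n f 1 = q \<and> multideg dg n f 2 = r" for f
  proof
    assume f: "multideg dg n f 0 = p \<and> multideg dg n f 1 = q \<and> multideg dg n f 2 = r"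
    show "\<forall>k. multideg dg n f k = multideg dg n e k"
    proof
      fix k :: nat
      consider "k = 0" | "k = 1" | "k = 2" | "k \<ge> 3" by linarith
      then show "multideg dg n f k = multideg dg n e k"
        using f e unfolding exps_of_deg_def[OF dg] by cases (simp_all add: multideg_eq_0)
    qed
  qed (use e in \<open>simp add: exps_of_deg_def[OF dg]\<close>)
  then show ?thesis unfolding smaller_def exps_of_deg_def[OF dg] by auto
qed

text \<open>On arbitrary functions the lexicographic order is not well-founded. Within one
  multidegree there are only finitely many exponents, so the cardinality of \<open>smaller e\<close>
  serves as the measure.\<close>

lemma smaller_induct:
  assumes e: "e \<in> exps p q r"
    and step: "\<And>e. e \<in> exps p q r \<Longrightarrow> (\<And>f. f \<in> smaller e \<Longrightarrow> P f) \<Longrightarrow> P e"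
  shows "P e"
  using e
proof (induction "card (smaller e)" arbitrary: e rule: less_induct)
  case less
  show ?case
  proof (rule step[OF less.prems])
    fix f assume f: "f \<in> smaller e"
    then have fe: "f \<in> exps p q r" using smaller_exps[OF less.prems] by simp
    have "finite (smaller e)" using smaller_exps[OF less.prems] finite_exps_of_deg[OF dg] by simp
    moreover have "smaller f \<subseteq> smaller e"
      using f unfolding smaller_exps[OF less.prems] smaller_exps[OF fe] by (auto intro: lex_less_trans)
    moreover have "f \<notin> smaller f" unfolding smaller_def by simp
    moreover from calculation f have "smaller f \<subset> smaller e" by blast
    ultimately show "P f" using less.hyps[OF psubset_card_mono fe] by blast
  qed
qed

lemma mono_fun_in_span_standard:
  assumes "e \<in> exps p q r"
  shows "mono_fun e \<in> fun_vs.span (mono_fun ` (standard \<inter> exps p q r))"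
  using assms
proof (rule smaller_induct[of e p q r "\<lambda>e. mono_fun e \<in> fun_vs.span (mono_fun ` (standard \<inter> exps p q r))"])
  fix e assume 1: "e \<in> exps p q r"
    "\<And>f. f \<in> smaller e \<Longrightarrow> mono_fun f \<in> fun_vs.span (mono_fun ` (standard \<inter> exps p q r))"
  show "mono_fun e \<in> fun_vs.span (mono_fun ` (standard \<inter> exps p q r))"
  proof (cases "e \<in> standard")
    case True
    then show ?thesis using 1 by (auto intro: fun_vs.span_base)
  next
    case False
    then have "mono_fun e \<in> fun_vs.span (mono_fun ` smaller e)"
      using 1(1) unfolding standard_def exps_of_deg_def[OF dg] by simp
    moreover have "mono_fun ` smaller e \<subseteq> fun_vs.span (mono_fun ` (standard \<inter> exps p q r))"
      using 1(2) by auto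
    ultimately show ?thesis using fun_vs.span_minimal fun_vs.subspace_span by blast
  qed
qed

text \<open>In a nontrivial relation the lexicographically largest exponent with nonzero coefficient
  could be solved for, and would then not be standard.\<close>

lemma standard_independent:
  assumes zero: "(\<Sum>e\<in>standard \<inter> exps p q r. (\<lambda>x. a e * mono_fun e x)) = 0"
    and e: "e \<in> standard \<inter> exps p q r"
  shows "a e = 0"
proof (rule ccontr)
  let ?S = "standard \<inter> exps p q r"
  assume "a e \<noteq> 0"
  have fin: "finite ?S" using finite_exps_of_deg[OF dg] by simp
  define N where "N = {f \<in> ?S. a f \<noteq> 0}"
  have "finite N" unfolding N_def by (rule finite_subset[OF _ fin]) blast
  have "N \<noteq> {}" using e \<open>a e \<noteq> 0\<close> unfolding N_def by auto
  have "\<exists>m\<in>N. \<forall>f\<in>N. \<not> lex_less m f"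
  proof -
    \<comment> \<open>The relation is reversed on purpose: its minimal elements are the
      lexicographically largest ones.\<close>
    have wf: "wf {(f, g). f \<in> N \<and> g \<in> N \<and> lex_less g f}"
    proof (rule finite_acyclic_wf)
      show "finite {(f, g). f \<in> N \<and> g \<in> N \<and> lex_less g f}"
        by (rule finite_subset[of _ "N \<times> N"]) (use \<open>finite N\<close> in auto)
      have "trans {(f, g). f \<in> N \<and> g \<in> N \<and> lex_less g f}"
        by (rule transI) (auto intro: lex_less_trans)
      then show "acyclic {(f, g). f \<in> N \<and> g \<in> N \<and> lex_less g f}"
        unfolding acyclic_def by (simp add: trancl_id)
    qed
    obtain x where "x \<in> N" using \<open>N \<noteq> {}\<close> by blast
    show ?thesis by (rule wfE_min[OF wf \<open>x \<in> N\<close>]) blast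
  qed
  then obtain m where m: "m \<in> N" "\<And>f. f \<in> N \<Longrightarrow> \<not> lex_less m f" by blast
  have mS: "m \<in> ?S" and am: "a m \<noteq> 0" using m(1) unfolding N_def by auto
  have zx: "(\<Sum>f\<in>?S. a f * mono_fun f x) = 0" for x
    using fun_cong[OF zero, of x] by (simp add: sum_apply zero_fun_def)
  have "mono_fun m = (\<Sum>f\<in>?S - {m}. (\<lambda>x. (- a f / a m) * mono_fun f x))"
  proof
    fix x
    have "a m * mono_fun m x = - (\<Sum>f\<in>?S - {m}. a f * mono_fun f x)"
      using zx[of x] sum.remove[OF fin mS, of "\<lambda>f. a f * mono_fun f x"] by (simp add: eq_neg_iff_add_eq_0)
    then have "mono_fun m x = - (\<Sum>f\<in>?S - {m}. a f * mono_fun f x) / a m"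
      using am by (metis nonzero_mult_div_cancel_left)
    also have "\<dots> = (\<Sum>f\<in>?S - {m}. (- a f / a m) * mono_fun f x)"
      by (simp add: sum_negf sum_divide_distrib)
    finally show "mono_fun m x = (\<Sum>f\<in>?S - {m}. (\<lambda>x. (- a f / a m) * mono_fun f x)) x"
      by (simp add: sum_apply)
  qed
  also have "\<dots> \<in> fun_vs.span (mono_fun ` smaller m)"
  proof (rule fun_vs.span_sum)
    fix f assume f: "f \<in> ?S - {m}"
    show "(\<lambda>x. (- a f / a m) * mono_fun f x) \<in> fun_vs.span (mono_fun ` smaller m)"
    proof (cases "a f = 0")
      case True
      then show ?thesis using fun_vs.span_zero[of "mono_fun ` smaller m"] by (simp add: zero_fun_def)
    next
      case False
      then have "f \<in> N" using f unfolding N_def by simp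
      then have "lex_less f m" using m(2) lex_less_total[of f m] f by blast
      then have "f \<in> smaller m" using smaller_exps[of m p q r] f mS by simp
      then show ?thesis by (intro fun_vs.span_scale fun_vs.span_base imageI)
    qed
  qed
  finally show False using mS unfolding standard_def by simp
qed

end

lemma scalar_prod_row_transpose:
  fixes u v :: "complex vec"
  assumes "M \<in> carrier_mat m n" "u \<in> carrier_vec m" "v \<in> carrier_vec n"
  shows "(transpose_mat M *\<^sub>v u) \<bullet> v = u \<bullet> (M *\<^sub>v v)"
  using transpose_vec_mult_scalar[OF assms(1,3,2)] assms
  by (simp add: comm_scalar_prod[of _ n])

context monomial_functions
begin

text \<open>
  The kernel \<open>K(A,B) = \<eta> B \<bullet> w A\<close> is a positive combination of products of monomials.  If some monomial
  were not a coefficient function \<open>\<zeta> \<bullet> w\<close>, a linear functional \<open>f\<close> killing all coefficient functions but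
  not that monomial would, applied to \<open>K(-, B)\<close>, conjugated, and applied once more, give
  \<open>\<Sum> c e \<bar>f (mono_fun e)\<bar>\<^sup>2 = 0\<close>.
\<close>

lemma coefficient_rows_exist:
  fixes w :: "'x \<Rightarrow> complex vec" and c :: "(nat \<Rightarrow> nat) \<Rightarrow> real" and cj :: "'x \<Rightarrow> 'x"
  assumes w: "\<And>A. A \<in> X \<Longrightarrow> w A \<in> carrier_vec d"
    and \<eta>: "\<And>B. B \<in> X \<Longrightarrow> \<eta> B \<in> carrier_vec d"
    and kernel: "\<And>A B. A \<in> X \<Longrightarrow> B \<in> X \<Longrightarrow>
      \<eta> B \<bullet> w A = (\<Sum>e\<in>exps p q r. of_real (c e) * mono_fun e A * mono_fun e B)"
    and pos: "\<And>e. e \<in> exps p q r \<Longrightarrow> c e > 0"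
    and cj: "\<And>A. A \<in> X \<Longrightarrow> cj A \<in> X" "\<And>A i. A \<in> X \<Longrightarrow> i < n \<Longrightarrow> y i (cj A) = cnj (y i A)"
    and e0: "e0 \<in> exps p q r"
  shows "\<exists>\<zeta>\<in>carrier_vec d. \<forall>A\<in>X. \<zeta> \<bullet> w A = mono_fun e0 A"
proof -
  let ?E = "exps p q r"
  have fin: "finite ?E" by (rule finite_exps_of_deg[OF dg])
  define \<Phi> where "\<Phi> = (\<lambda>\<zeta> A. if A \<in> X then \<zeta> \<bullet> w A else 0)"
  define T where "T = \<Phi> ` carrier_vec d"
  have sT: "fun_vs.subspace T"
  proof (rule fun_vs.subspaceI)
    show "0 \<in> T" unfolding T_def
      by (rule image_eqI[of _ _ "0\<^sub>v d"]) (use w in \<open>auto simp: \<Phi>_def fun_eq_iff\<close>)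
  next
    fix F G assume "F \<in> T" "G \<in> T"
    then obtain a b where ab: "a \<in> carrier_vec d" "b \<in> carrier_vec d" "F = \<Phi> a" "G = \<Phi> b" unfolding T_def by auto
    then show "F + G \<in> T" unfolding T_def
      by (intro image_eqI[of _ _ "a + b"]) (auto simp: \<Phi>_def fun_eq_iff add_scalar_prod_distrib[OF ab(1,2) w])
  next
    fix k F assume "F \<in> T"
    then obtain a where a: "a \<in> carrier_vec d" "F = \<Phi> a" unfolding T_def by auto
    then show "(\<lambda>x. k * F x) \<in> T" unfolding T_def
      by (intro image_eqI[of _ _ "k \<cdot>\<^sub>v a"]) (auto simp: \<Phi>_def fun_eq_iff smult_scalar_prod_distrib[OF a(1) w])
  qed
  have "mono_fun e0 \<in> T"
  proof (rule ccontr)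
    assume "mono_fun e0 \<notin> T"
    from fun_vs.separating_functional[OF sT this] obtain f
      where f: "Vector_Spaces.linear (\<lambda>c (f :: 'x \<Rightarrow> complex) x. c * f x) (*) f" "f (mono_fun e0) = 1" "\<And>F. F \<in> T \<Longrightarrow> f F = 0"
      by blast
    interpret f: Vector_Spaces.linear "\<lambda>c (f :: 'x \<Rightarrow> complex) x. c * f x" "(*)" f by fact
    have f_comb: "f (\<Sum>e\<in>S. (\<lambda>x. a e * mono_fun e x)) = (\<Sum>e\<in>S. a e * f (mono_fun e))" for S a
      by (simp add: f.sum f.scale)
    have k0: "(\<Sum>e\<in>?E. of_real (c e) * mono_fun e B * f (mono_fun e)) = 0" if B: "B \<in> X" for B
    proof -
      have "\<Phi> (\<eta> B) = (\<Sum>e\<in>?E. (\<lambda>x. (of_real (c e) * mono_fun e B) * mono_fun e x))"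
      proof
        fix A
        show "\<Phi> (\<eta> B) A = (\<Sum>e\<in>?E. (\<lambda>x. (of_real (c e) * mono_fun e B) * mono_fun e x)) A"
        proof (cases "A \<in> X")
          case True
          then have "\<Phi> (\<eta> B) A = (\<Sum>e\<in>?E. of_real (c e) * mono_fun e A * mono_fun e B)"
            unfolding \<Phi>_def kernel[OF True B] by simp
          then show ?thesis unfolding sum_apply by (simp only: ac_simps)
        next
          case False
          then show ?thesis unfolding sum_apply \<Phi>_def mono_fun_def by simp
        qed
      qed
      moreover have "\<Phi> (\<eta> B) \<in> T" unfolding T_def using \<eta>[OF B] by blast
      ultimately show ?thesis using f(3) f_comb[of "\<lambda>e. of_real (c e) * mono_fun e B" ?E] by simp
    qed
    have mcj: "mono_fun e (cj B) = cnj (mono_fun e B)" if "B \<in> X" for e B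
      using cj that unfolding mono_fun_def by auto
    have "(\<Sum>e\<in>?E. (\<lambda>x. (of_real (c e) * cnj (f (mono_fun e))) * mono_fun e x)) = 0"
    proof
      fix B
      show "(\<Sum>e\<in>?E. (\<lambda>x. (of_real (c e) * cnj (f (mono_fun e))) * mono_fun e x)) B = 0 B"
      proof (cases "B \<in> X")
        case True
        have "cnj (\<Sum>e\<in>?E. of_real (c e) * mono_fun e (cj B) * f (mono_fun e)) = 0"
          using k0[OF cj(1)[OF True]] by simp
        then have "(\<Sum>e\<in>?E. of_real (c e) * mono_fun e B * cnj (f (mono_fun e))) = 0"
          by (simp add: mcj[OF True])
        then show ?thesis unfolding sum_apply zero_fun_apply by (simp only: ac_simps)
      next
        case False
        then show ?thesis by (simp add: sum_apply mono_fun_def)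
      qed
    qed
    then have "f (\<Sum>e\<in>?E. (\<lambda>x. (of_real (c e) * cnj (f (mono_fun e))) * mono_fun e x)) = 0"
      using f.zero by simp
    then have "(\<Sum>e\<in>?E. (of_real (c e) * cnj (f (mono_fun e))) * f (mono_fun e)) = 0"
      unfolding f_comb .
    also have "(\<Sum>e\<in>?E. (of_real (c e) * cnj (f (mono_fun e))) * f (mono_fun e)) =
        of_real (\<Sum>e\<in>?E. c e * (cmod (f (mono_fun e)))\<^sup>2)"
      unfolding of_real_sum
    proof (rule sum.cong[OF refl])
      fix e
      have "cnj (f (mono_fun e)) * f (mono_fun e) = of_real ((cmod (f (mono_fun e)))\<^sup>2)"
        using complex_norm_square[of "f (mono_fun e)"] by (simp add: mult.commute)
      then show "of_real (c e) * cnj (f (mono_fun e)) * f (mono_fun e) = of_real (c e * (cmod (f (mono_fun e)))\<^sup>2)"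
        by (simp add: mult.assoc)
    qed
    finally have "(\<Sum>e\<in>?E. c e * (cmod (f (mono_fun e)))\<^sup>2) = 0" by (simp only: of_real_eq_0_iff)
    moreover have "(\<Sum>e\<in>?E. c e * (cmod (f (mono_fun e)))\<^sup>2) \<ge> c e0 * (cmod (f (mono_fun e0)))\<^sup>2"
      by (rule member_le_sum[OF e0 _ fin]) (use pos in \<open>simp add: less_imp_le\<close>)
    ultimately show False using pos[OF e0] unfolding f(2) by simp
  qed
  then obtain \<zeta> where "\<zeta> \<in> carrier_vec d" "mono_fun e0 = \<Phi> \<zeta>" unfolding T_def by blast
  then show ?thesis by (intro bexI[of _ \<zeta>]) (auto simp: \<Phi>_def)
qed

text \<open>Each monomial is the coefficient function of a row, and since \<open>t\<close> scales
  the coordinates, this row is an eigenvector of the transpose of \<open>M\<close>. The rows of the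
  standard monomials form \<open>Z\<close>: their spanning makes \<open>Z\<close> injective, their
  independence makes its transpose injective, so \<open>Z\<close> is square and diagonalises
  \<open>M\<close>.\<close>

theorem trace_standard_monomials:
  fixes w :: "'x \<Rightarrow> complex vec" and c :: "(nat \<Rightarrow> nat) \<Rightarrow> real" and cj t :: "'x \<Rightarrow> 'x"
  assumes w: "\<And>A. A \<in> X \<Longrightarrow> w A \<in> carrier_vec d"
    and \<eta>: "\<And>B. B \<in> X \<Longrightarrow> \<eta> B \<in> carrier_vec d"
    and kernel: "\<And>A B. A \<in> X \<Longrightarrow> B \<in> X \<Longrightarrow>
      \<eta> B \<bullet> w A = (\<Sum>e\<in>exps p q r. of_real (c e) * mono_fun e A * mono_fun e B)"
    and pos: "\<And>e. e \<in> exps p q r \<Longrightarrow> c e > 0"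
    and cj: "\<And>A. A \<in> X \<Longrightarrow> cj A \<in> X" "\<And>A i. A \<in> X \<Longrightarrow> i < n \<Longrightarrow> y i (cj A) = cnj (y i A)"
    and w_span: "\<And>\<zeta>. \<zeta> \<in> carrier_vec d \<Longrightarrow> (\<And>A. A \<in> X \<Longrightarrow> \<zeta> \<bullet> w A = 0) \<Longrightarrow> \<zeta> = 0\<^sub>v d"
    and \<eta>_span: "\<And>u. u \<in> carrier_vec d \<Longrightarrow> (\<And>B. B \<in> X \<Longrightarrow> \<eta> B \<bullet> u = 0) \<Longrightarrow> u = 0\<^sub>v d"
    and M: "M \<in> carrier_mat d d"
    and t: "\<And>A. A \<in> X \<Longrightarrow> t A \<in> X" "\<And>A. A \<in> X \<Longrightarrow> M *\<^sub>v w A = w (t A)"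
      "\<And>A i. A \<in> X \<Longrightarrow> i < n \<Longrightarrow> y i (t A) = \<mu> i * y i A"
  shows "mat_trace M = (\<Sum>e\<in>standard \<inter> exps p q r. exp_weight \<mu> n e)"
proof -
  let ?E = "exps p q r" let ?S = "standard \<inter> ?E"
  have fin: "finite ?E" by (rule finite_exps_of_deg[OF dg])
  have "\<forall>e. \<exists>\<zeta>. e \<in> ?E \<longrightarrow> \<zeta> \<in> carrier_vec d \<and> (\<forall>A\<in>X. \<zeta> \<bullet> w A = mono_fun e A)"
    using coefficient_rows_exist[OF w \<eta> kernel pos cj] by blast
  then obtain \<zeta> where \<zeta>: "\<And>e. e \<in> ?E \<Longrightarrow> \<zeta> e \<in> carrier_vec d"
    "\<And>e A. e \<in> ?E \<Longrightarrow> A \<in> X \<Longrightarrow> \<zeta> e \<bullet> w A = mono_fun e A" by metis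
  have w_inj: "a = b" if "a \<in> carrier_vec d" "b \<in> carrier_vec d" "\<And>A. A \<in> X \<Longrightarrow> a \<bullet> w A = b \<bullet> w A" for a b
  proof -
    have "a - b = 0\<^sub>v d"
      by (rule w_span) (use that w minus_scalar_prod_distrib[OF that(1,2) w] in auto)
    then have "(a - b) $ i = 0" if "i < d" for i using that by simp
    then show ?thesis using that(1,2) by (intro eq_vecI) auto
  qed
  obtain es where es: "set es = ?S" "distinct es" using finite_distinct_list[of ?S] fin by auto
  define m where "m = length es"
  have esE: "es ! a \<in> ?S" if "a < m" for a using es(1) nth_mem[of a es] that unfolding m_def by simp
  define Z where "Z = mat m d (\<lambda>(a, j). \<zeta> (es ! a) $ j)"
  have Z: "Z \<in> carrier_mat m d" unfolding Z_def by simp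
  have rowZ: "row Z a = \<zeta> (es ! a)" if "a < m" for a
  proof -
    have "\<zeta> (es ! a) \<in> carrier_vec d" using \<zeta>(1) esE[OF that] by simp
    then show ?thesis using that unfolding Z_def by (intro eq_vecI) auto
  qed
  have injZ: "inj_mat Z"
  proof (rule inj_matI[OF Z])
    fix u :: "complex vec" assume u: "u \<in> carrier_vec d" and Zu: "Z *\<^sub>v u = 0\<^sub>v m"
    have std: "\<zeta> e \<bullet> u = 0" if e: "e \<in> ?S" for e
    proof -
      obtain a where a: "a < m" "es ! a = e" using es(1) e unfolding m_def by (metis in_set_conv_nth)
      have "(Z *\<^sub>v u) $ a = 0" unfolding Zu using a by simp
      then show ?thesis using a rowZ[OF a(1)] Z by simp
    qed
    \<comment> \<open>The coefficient functions whose row annihilates \<open>u\<close>. This space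
      contains the standard monomials, hence all monomials, hence by the kernel identity the
      coefficient function of each \<open>\<eta> B\<close>; then \<open>\<eta>_span\<close> forces u
      = 0.\<close>
    define V where "V = {F. \<exists>a\<in>carrier_vec d. a \<bullet> u = 0 \<and> (\<forall>A\<in>X. F A = a \<bullet> w A) \<and> (\<forall>A. A \<notin> X \<longrightarrow> F A = 0)}"
    have sV: "fun_vs.subspace V"
    proof (rule fun_vs.subspaceI)
      show "0 \<in> V" unfolding V_def using w u by (auto intro!: bexI[of _ "0\<^sub>v d"])
    next
      fix F G assume "F \<in> V" "G \<in> V"
      then obtain a b where ab: "a \<in> carrier_vec d" "b \<in> carrier_vec d" "a \<bullet> u = 0" "b \<bullet> u = 0"
        "\<And>A. A \<in> X \<Longrightarrow> F A = a \<bullet> w A" "\<And>A. A \<notin> X \<Longrightarrow> F A = 0"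
        "\<And>A. A \<in> X \<Longrightarrow> G A = b \<bullet> w A" "\<And>A. A \<notin> X \<Longrightarrow> G A = 0" unfolding V_def by blast
      show "F + G \<in> V" unfolding V_def
        by (rule CollectI, rule bexI[of _ "a + b"])
          (use ab in \<open>auto simp: add_scalar_prod_distrib[OF ab(1,2) w] add_scalar_prod_distrib[OF ab(1,2) u]\<close>)
    next
      fix k F assume "F \<in> V"
      then obtain a where a: "a \<in> carrier_vec d" "a \<bullet> u = 0"
        "\<And>A. A \<in> X \<Longrightarrow> F A = a \<bullet> w A" "\<And>A. A \<notin> X \<Longrightarrow> F A = 0" unfolding V_def by blast
      show "(\<lambda>x. k * F x) \<in> V" unfolding V_def
        by (rule CollectI, rule bexI[of _ "k \<cdot>\<^sub>v a"])
          (use a in \<open>auto simp: smult_scalar_prod_distrib[OF a(1) w] smult_scalar_prod_distrib[OF a(1) u]\<close>)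
    qed
    have "mono_fun ` ?S \<subseteq> V"
      unfolding V_def using std \<zeta> by (auto intro!: bexI[of _ "\<zeta> _"] simp: mono_fun_def[of _ _])
    then have "fun_vs.span (mono_fun ` ?S) \<subseteq> V" using sV by (rule fun_vs.span_minimal)
    then have mV: "mono_fun e \<in> V" if "e \<in> ?E" for e using mono_fun_in_span_standard[OF that] by blast
    show "u = 0\<^sub>v d"
    proof (rule \<eta>_span[OF u])
      fix B assume B: "B \<in> X"
      have "(\<Sum>e\<in>?E. (\<lambda>x. (of_real (c e) * mono_fun e B) * mono_fun e x)) \<in> V"
        using mV by (intro fun_vs.subspace_sum[OF sV] fun_vs.subspace_scale[OF sV])
      then obtain a where a: "a \<in> carrier_vec d" "a \<bullet> u = 0"
        "\<And>A. A \<in> X \<Longrightarrow> (\<Sum>e\<in>?E. (\<lambda>x. (of_real (c e) * mono_fun e B) * mono_fun e x)) A = a \<bullet> w A"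
        unfolding V_def by blast
      have "a \<bullet> w A = \<eta> B \<bullet> w A" if A: "A \<in> X" for A
        using a(3)[OF A] kernel[OF A B] unfolding sum_apply by (simp only: ac_simps)
      then have "a = \<eta> B" using w_inj[OF a(1) \<eta>[OF B]] by blast
      then show "\<eta> B \<bullet> u = 0" using a(2) by simp
    qed
  qed
  have injZT: "inj_mat (transpose_mat Z)"
  proof (rule inj_matI)
    show "transpose_mat Z \<in> carrier_mat d m" using Z by simp
    fix b :: "complex vec" assume b: "b \<in> carrier_vec m" and 0: "transpose_mat Z *\<^sub>v b = 0\<^sub>v d"
    \<comment> \<open>Evaluating a relation between the rows on the vectors \<open>w A\<close> turns
      it into a relation between standard monomials.\<close>
    have sum0: "(\<Sum>a<m. b $ a * mono_fun (es ! a) A) = 0" if A: "A \<in> X" for A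
    proof -
      have "(\<Sum>a<m. b $ a * mono_fun (es ! a) A) = (\<Sum>a<m. b $ a * (Z *\<^sub>v w A) $ a)"
        using rowZ \<zeta>(2)[OF _ A] esE Z by (intro sum.cong) auto
      also have "\<dots> = b \<bullet> (Z *\<^sub>v w A)" using Z by (simp add: scalar_prod_def atLeast0LessThan)
      also have "\<dots> = (transpose_mat Z *\<^sub>v b) \<bullet> w A" by (rule scalar_prod_row_transpose[OF Z b w[OF A], symmetric])
      finally show ?thesis unfolding 0 using w[OF A] by simp
    qed
    define idx where "idx = (\<lambda>e. THE a. a < m \<and> es ! a = e)"
    have idx: "idx (es ! a) = a" if "a < m" for a
      unfolding idx_def using that es(2) unfolding m_def by (auto simp: nth_eq_iff_index_eq)
    have bij: "bij_betw ((!) es) {..<m} ?S"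
      using es bij_betw_nth[of es "{..<m}" ?S] unfolding m_def by simp
    have "(\<Sum>e\<in>?S. (\<lambda>x. b $ idx e * mono_fun e x)) = 0"
    proof
      fix A
      have "(\<Sum>e\<in>?S. b $ idx e * mono_fun e A) = (\<Sum>a<m. b $ idx (es ! a) * mono_fun (es ! a) A)"
        by (rule sum.reindex_bij_betw[OF bij, symmetric])
      also have "\<dots> = (\<Sum>a<m. b $ a * mono_fun (es ! a) A)" using idx by (intro sum.cong) auto
      also have "\<dots> = 0" using sum0[of A] by (cases "A \<in> X") (auto simp: mono_fun_def)
      finally show "(\<Sum>e\<in>?S. (\<lambda>x. b $ idx e * mono_fun e x)) A = 0 A" by (simp add: sum_apply)
    qed
    then have "b $ idx e = 0" if "e \<in> ?S" for e
      using standard_independent[of "\<lambda>e. b $ idx e" p q r e] that by simp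
    then have "b $ a = 0" if "a < m" for a using idx[OF that] esE[OF that] by metis
    then show "b = 0\<^sub>v m" using b by (intro eq_vecI) auto
  qed
  have md: "m = d" using inj_mat_dim_le[OF Z injZ] inj_mat_dim_le[OF _ injZT, of d m] Z by auto
  have Zd: "Z \<in> carrier_mat d d" using Z md by simp
  obtain Z' where Z': "Z' \<in> carrier_mat d d" "Z * Z' = 1\<^sub>m d" "Z' * Z = 1\<^sub>m d"
    using square_inverse_exists[OF Zd injZ] by blast
  define L where "L = mat d d (\<lambda>(a, b). if a = b then exp_weight \<mu> n (es ! a) else 0)"
  have L: "L \<in> carrier_mat d d" unfolding L_def by simp
  have weight: "mono_fun e (t A) = exp_weight \<mu> n e * mono_fun e A" if "A \<in> X" for e A
    using that t(1,3) unfolding mono_fun_def exp_weight_def[OF dg]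
    by (simp add: power_mult_distrib prod.distrib)
  have eig: "transpose_mat M *\<^sub>v \<zeta> e = exp_weight \<mu> n e \<cdot>\<^sub>v \<zeta> e" if e: "e \<in> ?E" for e
  proof (rule w_inj)
    fix A assume A: "A \<in> X"
    have "(transpose_mat M *\<^sub>v \<zeta> e) \<bullet> w A = \<zeta> e \<bullet> (M *\<^sub>v w A)"
      by (rule scalar_prod_row_transpose[OF M \<zeta>(1)[OF e] w[OF A]])
    then show "(transpose_mat M *\<^sub>v \<zeta> e) \<bullet> w A = (exp_weight \<mu> n e \<cdot>\<^sub>v \<zeta> e) \<bullet> w A"
      using \<zeta>(2)[OF e A] \<zeta>(2)[OF e t(1)[OF A]] t(2)[OF A] weight[OF A] smult_scalar_prod_distrib[OF \<zeta>(1)[OF e] w[OF A]]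
      by simp
  qed (use M \<zeta>(1)[OF e] in auto)
  have ZM: "Z * M = L * Z"
  proof (rule eq_matI)
    fix a j assume "a < dim_row (L * Z)" "j < dim_col (L * Z)"
    then have a: "a < d" and j: "j < d" using L Zd by auto
    have "(Z * M) $$ (a, j) = \<zeta> (es ! a) \<bullet> col M j" using Zd M a j rowZ md by simp
    also have "\<dots> = (transpose_mat M *\<^sub>v \<zeta> (es ! a)) $ j"
      using M j \<zeta>(1) esE[of a] a md by (simp add: comm_scalar_prod[of _ d])
    also have "\<dots> = exp_weight \<mu> n (es ! a) * \<zeta> (es ! a) $ j"
      using eig[of "es ! a"] esE[of a] a md j \<zeta>(1)[of "es ! a"] by simp
    also have "\<dots> = (L * Z) $$ (a, j)"
      using a j md by (simp add: L_def Z_def scalar_prod_def if_distrib[of "\<lambda>x. x * _"] cong: if_cong)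
    finally show "(Z * M) $$ (a, j) = (L * Z) $$ (a, j)" .
  qed (use Zd M L in auto)
  have "M = Z' * (Z * M)" using Z' Zd M by (simp flip: assoc_mult_mat[of _ d d _ d _ d])
  also have "\<dots> = Z' * L * Z" unfolding ZM using Z'(1) L Zd by simp
  finally have "mat_trace M = mat_trace (Z' * L * Z)" by simp
  also have "\<dots> = mat_trace L" using mat_trace_conj[OF Z'(1) Zd L Z'(2)] .
  also have "\<dots> = (\<Sum>a<m. exp_weight \<mu> n (es ! a))" unfolding mat_trace_def L_def md by simp
  also have "\<dots> = (\<Sum>e\<in>?S. exp_weight \<mu> n e)"
  proof (rule sum.reindex_bij_betw)
    show "bij_betw ((!) es) {..<m} ?S" using es bij_betw_nth[of es "{..<m}" ?S] unfolding m_def by simp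
  qed
  finally show ?thesis .
qed

end

subsection \<open>Polynomial functions of matrices\<close>

text \<open>The order of quantifiers matters: \<open>N\<close> depends on \<open>f\<close> only and
  not on the curve. An averaging over roots of unity can thus be fixed before the group element is
  known.\<close>

lemma polynomial_fun_curve:
  assumes "polynomial_fun n f"
  shows "\<exists>N. \<forall>m e. (\<forall>i<n. \<forall>j<n. degree (m i j) \<le> e) \<longrightarrow>
    (\<exists>p. degree p \<le> N * e \<and> (\<forall>M z. (\<forall>i<n. \<forall>j<n. M $$ (i,j) = poly (m i j) z) \<longrightarrow> f M = poly p z))"
  using assms
proof induction
  case (const c)
  show ?case by (intro exI[of _ 0] allI impI exI[of _ "[:c:]"]) simp
next
  case (entry i j)
  show ?case
  proof (rule exI[of _ 1], intro allI impI)
    fix m :: "nat \<Rightarrow> nat \<Rightarrow> complex poly" and e assume "\<forall>i<n. \<forall>j<n. degree (m i j) \<le> e"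
    then show "\<exists>p. degree p \<le> 1 * e \<and> (\<forall>M z. (\<forall>i<n. \<forall>j<n. M $$ (i,j) = poly (m i j) z) \<longrightarrow> M $$ (i,j) = poly p z)"
      using entry by (intro exI[of _ "m i j"]) simp
  qed
next
  case (add f g)
  then obtain N M where IH: "\<And>m e. (\<forall>i<n. \<forall>j<n. degree (m i j) \<le> e) \<Longrightarrow>
      \<exists>p. degree p \<le> N * e \<and> (\<forall>M z. (\<forall>i<n. \<forall>j<n. M $$ (i,j) = poly (m i j) z) \<longrightarrow> f M = poly p z)"
    "\<And>m e. (\<forall>i<n. \<forall>j<n. degree (m i j) \<le> e) \<Longrightarrow>
      \<exists>p. degree p \<le> M * e \<and> (\<forall>M z. (\<forall>i<n. \<forall>j<n. M $$ (i,j) = poly (m i j) z) \<longrightarrow> g M = poly p z)"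
    by blast
  show ?case
  proof (intro exI[of _ "N + M"] allI impI)
    fix m :: "nat \<Rightarrow> nat \<Rightarrow> complex poly" and e assume deg: "\<forall>i<n. \<forall>j<n. degree (m i j) \<le> e"
    obtain p q where p: "degree p \<le> N * e" "\<forall>M z. (\<forall>i<n. \<forall>j<n. M $$ (i,j) = poly (m i j) z) \<longrightarrow> f M = poly p z"
      and q: "degree q \<le> M * e" "\<forall>M z. (\<forall>i<n. \<forall>j<n. M $$ (i,j) = poly (m i j) z) \<longrightarrow> g M = poly q z"
      using IH[OF deg] by blast
    have "degree (p + q) \<le> (N + M) * e"
      using degree_add_le_max[of p q] p(1) q(1) by (simp add: add_mult_distrib)
    moreover have "\<forall>M z. (\<forall>i<n. \<forall>j<n. M $$ (i,j) = poly (m i j) z) \<longrightarrow> f M + g M = poly (p + q) z"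
    proof (intro allI impI)
      fix M z assume M: "\<forall>i<n. \<forall>j<n. M $$ (i,j) = poly (m i j) z"
      have "f M = poly p z" "g M = poly q z" using p(2) q(2) M by blast+
      then show "f M + g M = poly (p + q) z" by simp
    qed
    ultimately show "\<exists>p. degree p \<le> (N + M) * e \<and>
        (\<forall>M z. (\<forall>i<n. \<forall>j<n. M $$ (i,j) = poly (m i j) z) \<longrightarrow> f M + g M = poly p z)" by blast
  qed
next
  case (mult f g)
  then obtain N M where IH: "\<And>m e. (\<forall>i<n. \<forall>j<n. degree (m i j) \<le> e) \<Longrightarrow>
      \<exists>p. degree p \<le> N * e \<and> (\<forall>M z. (\<forall>i<n. \<forall>j<n. M $$ (i,j) = poly (m i j) z) \<longrightarrow> f M = poly p z)"
    "\<And>m e. (\<forall>i<n. \<forall>j<n. degree (m i j) \<le> e) \<Longrightarrow>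
      \<exists>p. degree p \<le> M * e \<and> (\<forall>M z. (\<forall>i<n. \<forall>j<n. M $$ (i,j) = poly (m i j) z) \<longrightarrow> g M = poly p z)"
    by blast
  show ?case
  proof (intro exI[of _ "N + M"] allI impI)
    fix m :: "nat \<Rightarrow> nat \<Rightarrow> complex poly" and e assume deg: "\<forall>i<n. \<forall>j<n. degree (m i j) \<le> e"
    obtain p q where p: "degree p \<le> N * e" "\<forall>M z. (\<forall>i<n. \<forall>j<n. M $$ (i,j) = poly (m i j) z) \<longrightarrow> f M = poly p z"
      and q: "degree q \<le> M * e" "\<forall>M z. (\<forall>i<n. \<forall>j<n. M $$ (i,j) = poly (m i j) z) \<longrightarrow> g M = poly q z"
      using IH[OF deg] by blast
    have "degree (p * q) \<le> (N + M) * e"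
      using degree_mult_le[of p q] p(1) q(1) by (simp add: add_mult_distrib)
    moreover have "\<forall>M z. (\<forall>i<n. \<forall>j<n. M $$ (i,j) = poly (m i j) z) \<longrightarrow> f M * g M = poly (p * q) z"
    proof (intro allI impI)
      fix M z assume M: "\<forall>i<n. \<forall>j<n. M $$ (i,j) = poly (m i j) z"
      have "f M = poly p z" "g M = poly q z" using p(2) q(2) M by blast+
      then show "f M * g M = poly (p * q) z" by simp
    qed
    ultimately show "\<exists>p. degree p \<le> (N + M) * e \<and>
        (\<forall>M z. (\<forall>i<n. \<forall>j<n. M $$ (i,j) = poly (m i j) z) \<longrightarrow> f M * g M = poly p z)" by blast
  qed
qed

lemma polynomial_fun_tendsto:
  assumes "polynomial_fun n f"
    and "\<And>i j. i < n \<Longrightarrow> j < n \<Longrightarrow> ((\<lambda>z. M z $$ (i,j)) \<longlongrightarrow> L $$ (i,j)) F"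
  shows "((\<lambda>z. f (M z)) \<longlongrightarrow> f L) F"
  using assms by induction (auto intro!: tendsto_intros)

lemma polynomial_fun_sum:
  assumes "\<And>i. i \<in> S \<Longrightarrow> polynomial_fun n (f i)"
  shows "polynomial_fun n (\<lambda>A. \<Sum>i\<in>S. f i A)"
  using assms by (induction S rule: infinite_finite_induct) (auto intro: polynomial_fun.intros)

lemma polynomial_fun_prod:
  assumes "\<And>i. i \<in> S \<Longrightarrow> polynomial_fun n (f i)"
  shows "polynomial_fun n (\<lambda>A. \<Prod>i\<in>S. f i A)"
  using assms by (induction S rule: infinite_finite_induct) (auto intro: polynomial_fun.intros)

lemma polynomial_fun_det: "\<exists>f. polynomial_fun n f \<and> (\<forall>A\<in>carrier_mat n n. f A = det A)"
proof (intro exI conjI ballI)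
  let ?f = "\<lambda>A. \<Sum>p | p permutes {0..<n}. signof p * (\<Prod>i = 0..<n. A $$ (i, p i))"
  show "polynomial_fun n ?f"
    by (intro polynomial_fun_sum polynomial_fun.mult polynomial_fun.const polynomial_fun_prod polynomial_fun.entry)
      (auto simp: permutes_in_image)
  show "?f A = det A" if "A \<in> carrier_mat n n" for A using det_def'[OF that] by simp
qed

text \<open>For 0 < i < K the i-th powers of the K-th roots of unity sum to zero by the geometric
  series, so only the constant coefficient survives.\<close>

lemma average_roots_of_unity:
  assumes "degree P < K"
  shows "(\<Sum>j<K. poly P (cis (2 * pi * real j / real K))) = of_nat K * poly P 0"
proof -
  have K: "K > 0" using assms by simp
  have s: "(\<Sum>j<K. cis (2 * pi * real j / real K) ^ i) = (if i = 0 then of_nat K else 0)" if i: "i < K" for i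
  proof (cases "i = 0")
    case False
    define q where "q = cis (2 * pi * real i / real K)"
    have "q \<noteq> 1"
    proof
      assume "q = 1"
      then have "cis (2 * pi * real i / real K) = cis (2 * pi * real 0 / real K)" unfolding q_def by simp
      moreover have "inj_on (\<lambda>k. cis (2 * pi * real k / real K)) {..<K}"
        using bij_betw_roots_unity[OF K] unfolding bij_betw_def by blast
      ultimately show False using i K False unfolding inj_on_def by auto
    qed
    have "cis (2 * pi * real j / real K) ^ i = q ^ j" for j
      unfolding q_def by (simp add: DeMoivre mult_ac)
    then have "(\<Sum>j<K. cis (2 * pi * real j / real K) ^ i) = (\<Sum>j<K. q ^ j)" by simp
    also have "\<dots> = (q ^ K - 1) / (q - 1)" using geometric_sum[OF \<open>q \<noteq> 1\<close>] by simp
    also have "q ^ K = cis (2 * pi * real i)" unfolding q_def using K by (simp add: DeMoivre)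
    also have "cis (2 * pi * real i) = 1" by (rule cis_multiple_2pi) simp
    finally show ?thesis using False by simp
  qed simp
  have "(\<Sum>j<K. poly P (cis (2 * pi * real j / real K))) =
      (\<Sum>j<K. \<Sum>i\<le>degree P. coeff P i * cis (2 * pi * real j / real K) ^ i)"
    by (simp only: poly_altdef)
  also have "\<dots> = (\<Sum>i\<le>degree P. coeff P i * (\<Sum>j<K. cis (2 * pi * real j / real K) ^ i))"
    unfolding sum_distrib_left by (rule sum.swap)
  also have "\<dots> = (\<Sum>i\<le>degree P. coeff P i * (if i = 0 then of_nat K else 0))"
    by (intro sum.cong refl arg_cong2[where f = "(*)"] s) (use assms in simp)
  also have "\<dots> = coeff P 0 * of_nat K" by (simp add: if_distrib cong: if_cong)
  finally show ?thesis by (simp add: poly_0_coeff_0 mult.commute)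
qed

section \<open>The special linear group\<close>

lemma carrier_SL: "carrier (SL n) = {A \<in> carrier_mat n n. det A = 1}"
  and mult_SL: "A \<otimes>\<^bsub>SL n\<^esub> B = A * B"
  and one_SL: "\<one>\<^bsub>SL n\<^esub> = 1\<^sub>m n"
  unfolding SL_def GL_def units_of_def by (simp_all add: ring_mat_simps)

lemma SL_inverse:
  assumes "A \<in> carrier (SL n)"
  shows "\<exists>B\<in>carrier (SL n). B * A = 1\<^sub>m n \<and> A * B = 1\<^sub>m n"
proof -
  have A: "A \<in> carrier_mat n n" "det A = 1" using assms unfolding carrier_SL by auto
  have B: "adj_mat A \<in> carrier_mat n n" "A * adj_mat A = 1\<^sub>m n" "adj_mat A * A = 1\<^sub>m n"
    using adj_mat[OF A(1)] A(2) by auto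
  have "det A * det (adj_mat A) = 1" using det_mult[OF A(1) B(1)] B(2) by simp
  then show ?thesis using A B unfolding carrier_SL by (intro bexI[of _ "adj_mat A"]) auto
qed

lemma group_SL: "group (SL n)"
proof (rule groupI)
  fix x assume "x \<in> carrier (SL n)"
  then show "\<exists>y\<in>carrier (SL n). y \<otimes>\<^bsub>SL n\<^esub> x = \<one>\<^bsub>SL n\<^esub>"
    using SL_inverse unfolding mult_SL one_SL by blast
qed (auto simp: mult_SL one_SL carrier_SL det_mult)

lemma sum_lt_4: "(\<Sum>k = 0..<4::nat. f k) = f 0 + f 1 + f 2 + (f 3 :: complex)"
  by (simp add: eval_nat_numeral)

lemma less_4_cases: "i < (4 :: nat) \<longleftrightarrow> i = 0 \<or> i = 1 \<or> i = 2 \<or> i = 3"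
  by auto

lemma prod_lt_4: "(\<Prod>k<4::nat. f k) = f 0 * f 1 * f 2 * (f 3 :: complex)"
  by (simp add: eval_nat_numeral)

subsection \<open>Extremal matrix coefficients of highest weight representations\<close>

definition diagm :: "(nat \<Rightarrow> complex) \<Rightarrow> complex mat" where
  "diagm x = mat 4 4 (\<lambda>(i,j). if i = j then x i else 0)"

lemma diagm_carrier [simp]: "diagm x \<in> carrier_mat 4 4"
  unfolding diagm_def by simp

lemma diagm_index [simp]: "i < 4 \<Longrightarrow> j < 4 \<Longrightarrow> diagm x $$ (i,j) = (if i = j then x i else 0)"
  unfolding diagm_def by simp

lemma diagm_mult_left:
  assumes "A \<in> carrier_mat 4 4" "i < 4" "j < 4"
  shows "(diagm x * A) $$ (i,j) = x i * A $$ (i,j)"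
proof -
  have "(diagm x * A) $$ (i,j) = (\<Sum>k = 0..<4. (if i = k then x i else 0) * A $$ (k,j))"
    using assms by (simp add: scalar_prod_def diagm_def)
  also have "\<dots> = (\<Sum>k = 0..<4. (if i = k then x i * A $$ (k,j) else 0))"
    by (intro sum.cong) auto
  finally have "(diagm x * A) $$ (i,j) = (\<Sum>k = 0..<4. (if i = k then x i * A $$ (k,j) else 0))" .
  then show ?thesis using assms by simp
qed

lemma diagm_mult_right:
  assumes "A \<in> carrier_mat 4 4" "i < 4" "j < 4"
  shows "(A * diagm x) $$ (i,j) = A $$ (i,j) * x j"
proof -
  have "(A * diagm x) $$ (i,j) = (\<Sum>k = 0..<4. A $$ (i,k) * (if k = j then x k else 0))"
    using assms by (simp add: scalar_prod_def diagm_def)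
  also have "\<dots> = (\<Sum>k = 0..<4. (if k = j then A $$ (i,k) * x j else 0))"
    by (intro sum.cong) auto
  finally have "(A * diagm x) $$ (i,j) = (\<Sum>k = 0..<4. (if k = j then A $$ (i,k) * x j else 0))" .
  then show ?thesis using assms by simp
qed

lemma diagm_mult: "diagm x * diagm y = diagm (\<lambda>i. x i * y i)"
proof (rule eq_matI)
  fix i j assume "i < dim_row (diagm (\<lambda>i. x i * y i))" "j < dim_col (diagm (\<lambda>i. x i * y i))"
  then have "i < 4" "j < 4" by (simp_all add: diagm_def)
  then show "(diagm x * diagm y) $$ (i,j) = diagm (\<lambda>i. x i * y i) $$ (i,j)"
    by (subst diagm_mult_left) auto
qed (auto simp: diagm_def)

lemma diagm_one: "(\<And>i. i < 4 \<Longrightarrow> x i = 1) \<Longrightarrow> diagm x = 1\<^sub>m 4"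
  by (intro eq_matI) (auto simp: diagm_def)

lemma diagonal_diagm: "diagonal_mat (diagm x)"
  unfolding diagonal_mat_def diagm_def by simp

lemma det_upper_triangular_prod:
  assumes "A \<in> carrier_mat n n" "upper_triangular A"
  shows "det A = (\<Prod>i<n. A $$ (i,i))"
  using det_upper_triangular[OF assms(2,1)] assms(1)
  by (simp add: diag_mat_def prod.list_conv_set_nth atLeast0LessThan)

lemma det_diagm: "det (diagm x) = (\<Prod>i<4. x i)"
  by (subst det_upper_triangular_prod[of _ 4]) (auto simp: diagm_def)

lemma diagm_SL: "(\<Prod>i<4. x i) = 1 \<Longrightarrow> diagm x \<in> carrier (SL 4)"
  unfolding carrier_SL by (simp add: det_diagm)

text \<open>The exponents -3, -1, 1, 3 add up to 0, giving determinant 1, and increase in steps of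
  2. Conjugation therefore multiplies the entry (i,j) by z to the power 2 (i - j), which contracts a
  lower triangular matrix to its diagonal as z tends to 0; the inverse conjugation does the same for
  upper triangular ones.\<close>

definition torus :: "complex \<Rightarrow> complex mat" where
  "torus z = diagm (\<lambda>i. z powi (2 * int i - 3))"

lemma torus_SL: "z \<noteq> 0 \<Longrightarrow> torus z \<in> carrier (SL 4)"
  unfolding torus_def by (rule diagm_SL) (simp add: prod_lt_4 power_int_minus field_simps)

lemma torus_inverse: "z \<noteq> 0 \<Longrightarrow> torus z * torus (inverse z) = 1\<^sub>m 4"
  "z \<noteq> 0 \<Longrightarrow> torus (inverse z) * torus z = 1\<^sub>m 4"
  unfolding torus_def diagm_mult
  by (auto intro!: diagm_one simp: power_int_inverse)

lemma torus_conj: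
  assumes "A \<in> carrier_mat 4 4" "i < 4" "j < 4" "z \<noteq> 0"
  shows "(torus z * A * torus (inverse z)) $$ (i,j) = A $$ (i,j) * z powi (2 * (int i - int j))"
proof -
  have "(torus z * A * torus (inverse z)) $$ (i,j) = (torus z * A) $$ (i,j) * inverse z powi (2 * int j - 3)"
    unfolding torus_def by (rule diagm_mult_right[OF mult_carrier_mat[OF diagm_carrier assms(1)] assms(2,3)])
  also have "(torus z * A) $$ (i,j) = z powi (2 * int i - 3) * A $$ (i,j)"
    unfolding torus_def using assms by (intro diagm_mult_left) auto
  also have "inverse z powi (2 * int j - 3) = z powi (3 - 2 * int j)"
    by (simp add: power_int_inverse flip: power_int_minus)
  also have "z powi (2 * int i - 3) * A $$ (i,j) * z powi (3 - 2 * int j) =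
      A $$ (i,j) * (z powi (2 * int i - 3) * z powi (3 - 2 * int j))" by simp
  also have "z powi (2 * int i - 3) * z powi (3 - 2 * int j) = z powi (2 * (int i - int j))"
    using assms(4) by (simp flip: power_int_add)
  finally show ?thesis .
qed

lemma torus_conj_lower:
  assumes "A \<in> carrier_mat 4 4" "i < 4" "j < 4" "z \<noteq> 0" "\<And>i j. i < j \<Longrightarrow> j < 4 \<Longrightarrow> A $$ (i,j) = 0"
  shows "(torus z * A * torus (inverse z)) $$ (i,j) = poly (monom (A $$ (i,j)) (2 * (i - j))) z"
proof (cases "i < j")
  case True
  then show ?thesis using assms(5)[OF True assms(3)] torus_conj[OF assms(1-4)] by simp
next
  case False
  then have "z powi (2 * (int i - int j)) = z ^ (2 * (i - j))"
    by (metis int_ops(6) linorder_not_less nat_less_le of_nat_diff of_nat_mult of_nat_numeral power_int_of_nat)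
  then show ?thesis using torus_conj[OF assms(1-4)] by (simp add: poly_monom)
qed

lemma torus_conj_upper:
  assumes "A \<in> carrier_mat 4 4" "i < 4" "j < 4" "z \<noteq> 0" "upper_triangular A"
  shows "(torus (inverse z) * A * torus z) $$ (i,j) = poly (monom (A $$ (i,j)) (2 * (j - i))) z"
proof -
  have eq: "(torus (inverse z) * A * torus z) $$ (i,j) = A $$ (i,j) * inverse z powi (2 * (int i - int j))"
    using torus_conj[OF assms(1-3), of "inverse z"] assms(4) by simp
  show ?thesis
  proof (cases "j < i")
    case True
    then show ?thesis using assms eq unfolding upper_triangular_def by auto
  next
    case False
    have "inverse z powi (2 * (int i - int j)) = z powi (2 * (int j - int i))"
      by (simp add: power_int_inverse flip: power_int_minus)
    also have "2 * (int j - int i) = int (2 * (j - i))" using False by (simp add: of_nat_diff)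
    finally show ?thesis using eq by (simp only: poly_monom power_int_of_nat)
  qed
qed

definition hw_char :: "nat \<Rightarrow> nat \<Rightarrow> nat \<Rightarrow> complex mat \<Rightarrow> complex" where
  "hw_char p q r A = fundamental_weight 1 A ^ p * fundamental_weight 2 A ^ q * fundamental_weight 3 A ^ r"

lemma hw_char_expand:
  "hw_char p q r A = (A $$ (0,0)) ^ p * (A $$ (0,0) * A $$ (1,1)) ^ q * (A $$ (0,0) * A $$ (1,1) * A $$ (2,2)) ^ r"
  unfolding hw_char_def fundamental_weight_def by (simp add: eval_nat_numeral)

locale highest_weight_rep =
  fixes p q r :: nat and \<rho> :: "complex mat \<Rightarrow> complex mat"
  assumes irr: "irreducible_rep_SL4 p q r \<rho>"
begin

definition d :: nat where "d = rep_dim (SL 4) \<rho>"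

definition v :: "complex vec" where
  "v = (SOME v. v \<in> carrier_vec d \<and> v \<noteq> 0\<^sub>v d \<and>
    (\<forall>A\<in>carrier (SL 4). upper_triangular A \<and> (\<forall>i<4. A $$ (i, i) = 1) \<longrightarrow> \<rho> A *\<^sub>v v = v) \<and>
    (\<forall>A\<in>carrier (SL 4). diagonal_mat A \<longrightarrow> \<rho> A *\<^sub>v v = hw_char p q r A \<cdot>\<^sub>v v))"

lemma v_props: "v \<in> carrier_vec d" "v \<noteq> 0\<^sub>v d"
  "\<And>A. A \<in> carrier (SL 4) \<Longrightarrow> upper_triangular A \<Longrightarrow> (\<And>i. i < 4 \<Longrightarrow> A $$ (i, i) = 1) \<Longrightarrow> \<rho> A *\<^sub>v v = v"
  "\<And>A. A \<in> carrier (SL 4) \<Longrightarrow> diagonal_mat A \<Longrightarrow> \<rho> A *\<^sub>v v = hw_char p q r A \<cdot>\<^sub>v v"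
proof -
  have "\<exists>v. v \<in> carrier_vec d \<and> v \<noteq> 0\<^sub>v d \<and>
    (\<forall>A\<in>carrier (SL 4). upper_triangular A \<and> (\<forall>i<4. A $$ (i, i) = 1) \<longrightarrow> \<rho> A *\<^sub>v v = v) \<and>
    (\<forall>A\<in>carrier (SL 4). diagonal_mat A \<longrightarrow> \<rho> A *\<^sub>v v = hw_char p q r A \<cdot>\<^sub>v v)"
    using irr unfolding irreducible_rep_SL4_def has_highest_weight_SL_def d_def hw_char_def by blast
  from someI_ex[OF this, folded v_def]
  show "v \<in> carrier_vec d" "v \<noteq> 0\<^sub>v d"
    "\<And>A. A \<in> carrier (SL 4) \<Longrightarrow> upper_triangular A \<Longrightarrow> (\<And>i. i < 4 \<Longrightarrow> A $$ (i, i) = 1) \<Longrightarrow> \<rho> A *\<^sub>v v = v"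
    "\<And>A. A \<in> carrier (SL 4) \<Longrightarrow> diagonal_mat A \<Longrightarrow> \<rho> A *\<^sub>v v = hw_char p q r A \<cdot>\<^sub>v v" by blast+
qed

lemma rep: "representation (SL 4) \<rho>"
  using irr unfolding irreducible_rep_SL4_def irreducible_rep_def by blast

lemma rho_carrier: "A \<in> carrier (SL 4) \<Longrightarrow> \<rho> A \<in> carrier_mat d d"
  and rho_mult: "A \<in> carrier (SL 4) \<Longrightarrow> B \<in> carrier (SL 4) \<Longrightarrow> \<rho> (A * B) = \<rho> A * \<rho> B"
  and rho_one: "\<rho> (1\<^sub>m 4) = 1\<^sub>m d"
  using representationD[OF group_SL rep] unfolding mult_SL one_SL d_def by auto

lemma SL_mult: "A \<in> carrier (SL 4) \<Longrightarrow> B \<in> carrier (SL 4) \<Longrightarrow> A * B \<in> carrier (SL 4)"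
  using monoid.m_closed[OF group.is_monoid[OF group_SL], of A 4 B] unfolding mult_SL .

lemma rho_mult_vec:
  assumes "A \<in> carrier (SL 4)" "B \<in> carrier (SL 4)" "u \<in> carrier_vec d"
  shows "\<rho> (A * B) *\<^sub>v u = \<rho> A *\<^sub>v (\<rho> B *\<^sub>v u)"
  unfolding rho_mult[OF assms(1,2)]
  by (rule assoc_mult_mat_vec[OF rho_carrier[OF assms(1)] rho_carrier[OF assms(2)] assms(3)])

lemma coefficient_polynomial:
  assumes \<eta>: "\<eta> \<in> carrier_vec d" and u: "u \<in> carrier_vec d"
  shows "\<exists>f. polynomial_fun 4 f \<and> (\<forall>A\<in>carrier (SL 4). \<eta> \<bullet> (\<rho> A *\<^sub>v u) = f A)"
proof -
  have "\<forall>i j. \<exists>f. i < d \<longrightarrow> j < d \<longrightarrow> polynomial_fun 4 f \<and> (\<forall>A\<in>carrier (SL 4). \<rho> A $$ (i, j) = f A)"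
    using irr unfolding irreducible_rep_SL4_def rational_rep_SL_def d_def by blast
  then obtain F where F: "\<And>i j. i < d \<Longrightarrow> j < d \<Longrightarrow> polynomial_fun 4 (F i j)"
    "\<And>i j A. i < d \<Longrightarrow> j < d \<Longrightarrow> A \<in> carrier (SL 4) \<Longrightarrow> \<rho> A $$ (i, j) = F i j A" by metis
  have "\<eta> \<bullet> (\<rho> A *\<^sub>v u) = (\<Sum>i<d. \<eta> $ i * (\<Sum>j<d. F i j A * u $ j))" if A: "A \<in> carrier (SL 4)" for A
    using rho_carrier[OF A] F(2)[OF _ _ A] u by (simp add: scalar_prod_def atLeast0LessThan)
  moreover have "polynomial_fun 4 (\<lambda>A. \<Sum>i<d. \<eta> $ i * (\<Sum>j<d. F i j A * u $ j))"
    by (intro polynomial_fun_sum polynomial_fun.mult polynomial_fun.const F(1)) auto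
  ultimately show ?thesis by (intro exI[of _ "\<lambda>A. \<Sum>i<d. \<eta> $ i * (\<Sum>j<d. F i j A * u $ j)"]) auto
qed

text \<open>\<open>A\<close> is its diagonal part times an upper unitriangular matrix. The second
  factor fixes \<open>v\<close>, and the first acts by a character that only sees the
  diagonal.\<close>

lemma upper_triangular_weight:
  assumes A: "A \<in> carrier (SL 4)" and ut: "upper_triangular A"
  shows "\<rho> A *\<^sub>v v = hw_char p q r A \<cdot>\<^sub>v v"
proof -
  have Ac: "A \<in> carrier_mat 4 4" and "det A = 1" using A unfolding carrier_SL by auto
  then have pr: "(\<Prod>i<4. A $$ (i,i)) = 1" using det_upper_triangular_prod[OF Ac ut] by simp
  then have nz: "A $$ (i,i) \<noteq> 0" if "i < 4" for i using that by (metis finite_lessThan lessThan_iff prod_zero_iff zero_neq_one)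
  define D where "D = diagm (\<lambda>i. A $$ (i,i))"
  define E where "E = diagm (\<lambda>i. 1 / A $$ (i,i))"
  have D: "D \<in> carrier (SL 4)" unfolding D_def by (rule diagm_SL) (fact pr)
  have E: "E \<in> carrier (SL 4)" unfolding E_def using pr by (intro diagm_SL) (simp add: prod_dividef)
  have U: "E * A \<in> carrier (SL 4)" using SL_mult[OF E A] .
  have ent: "(E * A) $$ (i,j) = A $$ (i,j) / A $$ (i,i)" if "i < 4" "j < 4" for i j
    unfolding E_def using diagm_mult_left[OF Ac that] by simp
  have "upper_triangular (E * A)"
    unfolding upper_triangular_def using ut Ac ent
    by (auto simp: upper_triangular_def E_def diagm_def)
  moreover have "(E * A) $$ (i,i) = 1" if "i < 4" for i using ent[OF that that] nz[OF that] by simp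
  ultimately have Uv: "\<rho> (E * A) *\<^sub>v v = v" using v_props(3)[OF U] by blast
  have "D * E = 1\<^sub>m 4" unfolding D_def E_def diagm_mult using nz by (intro diagm_one) simp
  then have "D * (E * A) = A"
    using assoc_mult_mat[of D 4 4 E 4 A 4, symmetric] Ac unfolding D_def E_def by simp
  then have "\<rho> A *\<^sub>v v = \<rho> D *\<^sub>v (\<rho> (E * A) *\<^sub>v v)" using rho_mult_vec[OF D U v_props(1)] by simp
  also have "\<dots> = hw_char p q r D \<cdot>\<^sub>v v"
    unfolding Uv by (rule v_props(4)[OF D]) (simp add: D_def diagonal_diagm)
  also have "hw_char p q r D = hw_char p q r A" unfolding hw_char_expand D_def by simp
  finally show ?thesis .
qed

text \<open>
  For lower unitriangular \<open>A\<close>, conjugation by \<open>torus z\<close> makes \<open>A\<close> a polynomial curve through the identity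
  at \<open>z = 0\<close>.  Averaging a functional over sufficiently many roots of unity \<open>z\<close>, with the inverse weight of \<open>v\<close>,
  evaluates the resulting polynomial at \<open>0\<close>; this isolates the lowest weight row without a weight
  decomposition.
\<close>

lemma extremal_row_exists:
  "\<exists>\<xi>\<in>carrier_vec d. \<forall>A\<in>carrier (SL 4).
     (\<forall>i j. i < j \<longrightarrow> j < 4 \<longrightarrow> A $$ (i,j) = 0) \<and> (\<forall>i<4. A $$ (i,i) = 1) \<longrightarrow> \<xi> \<bullet> (\<rho> A *\<^sub>v v) = 1"
proof -
  obtain k where k: "k < d" "v $ k \<noteq> 0"
    using v_props(1,2) by (metis carrier_vecD eq_vecI index_zero_vec(1,2))
  define \<eta> where "\<eta> = (1 / v $ k) \<cdot>\<^sub>v unit_vec d k"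
  have \<eta>: "\<eta> \<in> carrier_vec d" unfolding \<eta>_def by simp
  have \<eta>v: "\<eta> \<bullet> v = 1" unfolding \<eta>_def using k v_props(1) by simp
  obtain F where F: "polynomial_fun 4 F" "\<And>A. A \<in> carrier (SL 4) \<Longrightarrow> \<eta> \<bullet> (\<rho> A *\<^sub>v v) = F A"
    using coefficient_polynomial[OF \<eta> v_props(1)] by blast
  obtain N where N: "\<And>m e. (\<forall>i<4. \<forall>j<4. degree (m i j) \<le> e) \<Longrightarrow>
    \<exists>p. degree p \<le> N * e \<and> (\<forall>M z. (\<forall>i<4. \<forall>j<4. M $$ (i,j) = poly (m i j) z) \<longrightarrow> F M = poly p z)"
    using polynomial_fun_curve[OF F(1)] by blast
  \<comment> \<open>Along the conjugated curve the entries have degree at most 2 * 3 = 6, so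
    \<open>F\<close> has degree at most \<open>N * 6\<close>, which must stay below the number
    \<open>K\<close> of roots. \<open>K\<close> must not depend on \<open>A\<close>, as one \<xi>
    has to serve all lower unitriangular matrices.\<close>
  define K where "K = N * 6 + 1"
  define \<omega> where "\<omega> = (\<lambda>j. cis (2 * pi * real j / real K))"
  define ch where "ch = (\<lambda>j. hw_char p q r (torus (\<omega> j)))"
  have \<omega>: "\<omega> j \<noteq> 0" for j unfolding \<omega>_def by simp
  have ch: "ch j \<noteq> 0" for j unfolding ch_def hw_char_expand torus_def using \<omega>[of j] by simp
  note TS = torus_SL[OF \<omega>]
  have Tr: "\<rho> (torus (\<omega> j)) \<in> carrier_mat d d" for j by (rule rho_carrier[OF TS])
  define \<xi> where "\<xi> = vec d (\<lambda>a. \<Sum>j<K. (1 / (of_nat K * ch j)) * (transpose_mat (\<rho> (torus (\<omega> j))) *\<^sub>v \<eta>) $ a)"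
  have \<xi>: "\<xi> \<in> carrier_vec d" unfolding \<xi>_def by simp
  have \<xi>u: "\<xi> \<bullet> u = (\<Sum>j<K. (1 / (of_nat K * ch j)) * (\<eta> \<bullet> (\<rho> (torus (\<omega> j)) *\<^sub>v u)))"
    if u: "u \<in> carrier_vec d" for u
  proof -
    have "\<xi> \<bullet> u = (\<Sum>a<d. \<Sum>j<K. (1 / (of_nat K * ch j)) * ((transpose_mat (\<rho> (torus (\<omega> j))) *\<^sub>v \<eta>) $ a * u $ a))"
      using u unfolding \<xi>_def scalar_prod_def by (simp add: atLeast0LessThan sum_distrib_right mult.assoc)
    also have "\<dots> = (\<Sum>j<K. \<Sum>a<d. (1 / (of_nat K * ch j)) * ((transpose_mat (\<rho> (torus (\<omega> j))) *\<^sub>v \<eta>) $ a * u $ a))"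
      by (rule sum.swap)
    also have "\<dots> = (\<Sum>j<K. (1 / (of_nat K * ch j)) * ((transpose_mat (\<rho> (torus (\<omega> j))) *\<^sub>v \<eta>) \<bullet> u))"
      using u unfolding scalar_prod_def by (simp add: atLeast0LessThan sum_distrib_left)
    also have "\<dots> = (\<Sum>j<K. (1 / (of_nat K * ch j)) * (\<eta> \<bullet> (\<rho> (torus (\<omega> j)) *\<^sub>v u)))"
      by (simp only: scalar_prod_row_transpose[OF Tr \<eta> u])
    finally show ?thesis .
  qed
  show ?thesis
  proof (rule bexI[OF _ \<xi>], intro ballI impI, elim conjE)
    fix A assume A: "A \<in> carrier (SL 4)" and lt: "\<forall>i j. i < j \<longrightarrow> j < 4 \<longrightarrow> A $$ (i,j) = 0"
      and diag: "\<forall>i<4. A $$ (i,i) = 1"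
    have Ac: "A \<in> carrier_mat 4 4" using A unfolding carrier_SL by simp
    define m where "m = (\<lambda>i j. monom (A $$ (i,j)) (2 * (i - j)))"
    have "degree (m i j) \<le> 6" if "i < 4" "j < 4" for i j
      unfolding m_def by (rule order_trans[OF degree_monom_le]) (use that in simp)
    then obtain P where P: "degree P \<le> N * 6"
      "\<And>M z. (\<forall>i<4. \<forall>j<4. M $$ (i,j) = poly (m i j) z) \<Longrightarrow> F M = poly P z"
      using N[of m 6] by blast
    have P0: "poly P 0 = 1"
    proof -
      have "(1\<^sub>m 4 :: complex mat) $$ (i,j) = poly (m i j) 0" if "i < 4" "j < 4" for i j
      proof (cases i j rule: linorder_cases)
        case less
        then show ?thesis using lt that by (simp add: m_def)
      next
        case equal
        then show ?thesis using diag that by (simp add: m_def poly_monom)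
      next
        case greater
        then show ?thesis using that by (simp add: m_def poly_monom)
      qed
      then have "F (1\<^sub>m 4) = poly P 0" using P(2) by blast
      moreover have "1\<^sub>m 4 \<in> carrier (SL 4)" unfolding carrier_SL by simp
      then have "F (1\<^sub>m 4) = \<eta> \<bullet> (\<rho> (1\<^sub>m 4) *\<^sub>v v)" using F(2) by simp
      ultimately show ?thesis using \<eta>v v_props(1) unfolding rho_one by simp
    qed
    have summand: "\<eta> \<bullet> (\<rho> (torus (\<omega> j)) *\<^sub>v (\<rho> A *\<^sub>v v)) = ch j * poly P (\<omega> j)" for j
    proof -
      define z where "z = \<omega> j"
      have z: "z \<noteq> 0" unfolding z_def by (rule \<omega>)
      define B where "B = torus z * A * torus (inverse z)"
      have TI: "torus (inverse z) \<in> carrier (SL 4)" using z by (intro torus_SL) simp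
      have T: "torus z \<in> carrier (SL 4)" using z by (rule torus_SL)
      have B: "B \<in> carrier (SL 4)" unfolding B_def by (intro SL_mult T A TI)
      have c: "torus z \<in> carrier_mat 4 4" "torus (inverse z) \<in> carrier_mat 4 4" unfolding torus_def by auto
      \<comment> \<open>Moving the torus element past \<open>A\<close> replaces \<open>A\<close> by
        its conjugate \<open>B\<close> and lets the torus act on \<open>v\<close> by the weight
        \<open>ch j\<close>, which the definition of \<xi> divides out.\<close>
      have "B * torus z = torus z * A * (torus (inverse z) * torus z)"
        unfolding B_def using c Ac by (intro assoc_mult_mat) auto
      then have BT: "torus z * A = B * torus z" unfolding torus_inverse(2)[OF z] using c Ac by simp
      have "\<rho> (torus z) *\<^sub>v (\<rho> A *\<^sub>v v) = \<rho> (B * torus z) *\<^sub>v v"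
        unfolding BT[symmetric] by (rule rho_mult_vec[OF T A v_props(1), symmetric])
      also have "\<dots> = \<rho> B *\<^sub>v (ch j \<cdot>\<^sub>v v)"
        unfolding rho_mult_vec[OF B T v_props(1)] ch_def z_def[symmetric]
        by (subst v_props(4)[OF T]) (simp_all add: torus_def diagonal_diagm)
      also have "\<dots> = ch j \<cdot>\<^sub>v (\<rho> B *\<^sub>v v)" by (rule mult_mat_vec[OF rho_carrier[OF B] v_props(1)])
      finally have "\<eta> \<bullet> (\<rho> (torus z) *\<^sub>v (\<rho> A *\<^sub>v v)) = ch j * (\<eta> \<bullet> (\<rho> B *\<^sub>v v))"
        using \<eta> rho_carrier[OF B] v_props(1) by simp
      also have "\<eta> \<bullet> (\<rho> B *\<^sub>v v) = F B" by (rule F(2)[OF B])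
      also have "F B = poly P z"
        by (rule P(2)) (use torus_conj_lower[OF Ac _ _ z] lt in \<open>simp add: B_def m_def\<close>)
      finally show ?thesis unfolding z_def .
    qed
    have "\<xi> \<bullet> (\<rho> A *\<^sub>v v) = (\<Sum>j<K. (1 / (of_nat K * ch j)) * (ch j * poly P (\<omega> j)))"
      using rho_carrier[OF A] v_props(1) by (subst \<xi>u) (auto simp: summand)
    also have "\<dots> = (\<Sum>j<K. poly P (\<omega> j)) / of_nat K"
      using ch by (simp add: sum_divide_distrib)
    also have "(\<Sum>j<K. poly P (\<omega> j)) = of_nat K * poly P 0"
      unfolding \<omega>_def by (rule average_roots_of_unity) (use P(1) in \<open>simp add: K_def\<close>)
    finally have "\<xi> \<bullet> (\<rho> A *\<^sub>v v) = of_nat K * 1 / of_nat K" unfolding P0 .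
    moreover have "of_nat K \<noteq> (0 :: complex)" unfolding of_nat_eq_0_iff K_def by simp
    ultimately show "\<xi> \<bullet> (\<rho> A *\<^sub>v v) = 1" by simp
  qed
qed

end

section \<open>Leading minors and the big cell\<close>

definition minor2 :: "complex mat \<Rightarrow> nat \<Rightarrow> nat \<Rightarrow> complex" where
  "minor2 A i j = A $$ (i,0) * A $$ (j,1) - A $$ (j,0) * A $$ (i,1)"

text \<open>A product of powers of the three leading principal minors, the cofactor at (3,3) being
  the one of size 3. It is invariant under lower unitriangular matrices from the left and restricts
  to \<open>hw_char\<close> on upper triangular ones, as the extremal coefficient must.\<close>

definition flag_monomial :: "nat \<Rightarrow> nat \<Rightarrow> nat \<Rightarrow> complex mat \<Rightarrow> complex" where
  "flag_monomial p q r A = (A $$ (0,0)) ^ p * (minor2 A 0 1) ^ q * (cofactor A 3 3) ^ r"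

lemma det_2_expand:
  assumes "A \<in> carrier_mat 2 2"
  shows "det A = A $$ (0,0) * A $$ (1,1) - A $$ (0,1) * (A $$ (1,0) :: complex)"
proof -
  have "det A = (\<Sum>j<2. A $$ (0,j) * cofactor A 0 j)" by (rule laplace_expansion_row[OF assms]) simp
  also have "\<dots> = A $$ (0,0) * cofactor A 0 0 + A $$ (0,1) * cofactor A 0 1" by (simp add: eval_nat_numeral)
  also have "cofactor A 0 0 = A $$ (1,1)" unfolding cofactor_def
    by (subst det_single) (use assms in \<open>auto simp: mat_delete_def\<close>)
  also have "cofactor A 0 1 = - A $$ (1,0)" unfolding cofactor_def
    by (subst det_single) (use assms in \<open>auto simp: mat_delete_def\<close>)
  finally show ?thesis by simp
qed

lemma det_3_expand:
  assumes "A \<in> carrier_mat 3 3"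
  shows "det A = A $$ (0,0) * (A $$ (1,1) * A $$ (2,2) - A $$ (1,2) * A $$ (2,1))
    - A $$ (0,1) * (A $$ (1,0) * A $$ (2,2) - A $$ (1,2) * A $$ (2,0))
    + A $$ (0,2) * (A $$ (1,0) * A $$ (2,1) - A $$ (1,1) * (A $$ (2,0) :: complex))"
proof -
  have "det A = (\<Sum>j<3. A $$ (0,j) * cofactor A 0 j)" by (rule laplace_expansion_row[OF assms]) simp
  also have "\<dots> = A $$ (0,0) * cofactor A 0 0 + A $$ (0,1) * cofactor A 0 1 + A $$ (0,2) * cofactor A 0 2"
    by (simp add: eval_nat_numeral)
  also have "cofactor A 0 0 = A $$ (1,1) * A $$ (2,2) - A $$ (1,2) * A $$ (2,1)" unfolding cofactor_def
    by (subst det_2_expand) (use assms in \<open>auto simp: mat_delete_def numeral_2_eq_2\<close>)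
  also have "cofactor A 0 1 = - (A $$ (1,0) * A $$ (2,2) - A $$ (1,2) * A $$ (2,0))" unfolding cofactor_def
    by (subst det_2_expand) (use assms in \<open>auto simp: mat_delete_def numeral_2_eq_2\<close>)
  also have "cofactor A 0 2 = A $$ (1,0) * A $$ (2,1) - A $$ (1,1) * A $$ (2,0)" unfolding cofactor_def
    by (subst det_2_expand) (use assms in \<open>auto simp: mat_delete_def numeral_2_eq_2\<close>)
  finally show ?thesis by (simp add: algebra_simps)
qed

lemma cofactor_3_3:
  fixes A :: "complex mat"
  assumes "A \<in> carrier_mat 4 4"
  shows "cofactor A 3 3 = A $$ (0,0) * (A $$ (1,1) * A $$ (2,2) - A $$ (1,2) * A $$ (2,1))
    - A $$ (0,1) * (A $$ (1,0) * A $$ (2,2) - A $$ (1,2) * A $$ (2,0))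
    + A $$ (0,2) * (A $$ (1,0) * A $$ (2,1) - A $$ (1,1) * A $$ (2,0))"
  unfolding cofactor_def by (subst det_3_expand) (use assms in \<open>auto simp: mat_delete_def\<close>)

text \<open>Gaussian elimination without row exchanges. The pivots divided by are
  \<open>a 0 0\<close>, \<open>u11\<close> and \<open>u22\<close>, and their successive products are
  the leading minors assumed nonzero.\<close>

lemma lu_decomposition:
  assumes A: "A \<in> carrier_mat 4 4"
    and nz: "A $$ (0,0) \<noteq> 0" "minor2 A 0 1 \<noteq> 0" "cofactor A 3 3 \<noteq> 0"
  shows "\<exists>L\<in>carrier_mat 4 4. \<exists>U\<in>carrier_mat 4 4. A = L * U \<and>
    (\<forall>i j. i < j \<longrightarrow> j < 4 \<longrightarrow> L $$ (i,j) = 0) \<and> (\<forall>i<4. L $$ (i,i) = 1) \<and> upper_triangular U \<and>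
    U $$ (0,0) = A $$ (0,0) \<and> U $$ (0,0) * U $$ (1,1) = minor2 A 0 1 \<and>
    U $$ (0,0) * U $$ (1,1) * U $$ (2,2) = cofactor A 3 3"
proof -
  define a where "a = (\<lambda>i j. A $$ (i,j))"
  define l1 l2 l3 where l: "l1 = a 1 0 / a 0 0" "l2 = a 2 0 / a 0 0" "l3 = a 3 0 / a 0 0"
  define u11 u12 u13 where u1: "u11 = a 1 1 - l1 * a 0 1" "u12 = a 1 2 - l1 * a 0 2" "u13 = a 1 3 - l1 * a 0 3"
  define k2 k3 where k: "k2 = (a 2 1 - l2 * a 0 1) / u11" "k3 = (a 3 1 - l3 * a 0 1) / u11"
  define u22 u23 where u2: "u22 = a 2 2 - l2 * a 0 2 - k2 * u12" "u23 = a 2 3 - l2 * a 0 3 - k2 * u13"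
  define m3 where "m3 = (a 3 2 - l3 * a 0 2 - k3 * u12) / u22"
  define u33 where "u33 = a 3 3 - l3 * a 0 3 - k3 * u13 - m3 * u23"
  have a0: "a 0 0 \<noteq> 0" using nz(1) unfolding a_def .
  have la: "l1 * a 0 0 = a 1 0" "l2 * a 0 0 = a 2 0" "l3 * a 0 0 = a 3 0" using a0 unfolding l by auto
  have e1: "a 0 0 * u11 = minor2 A 0 1" unfolding u1 minor2_def using la(1)
    by (simp add: a_def algebra_simps)
  then have u11: "u11 \<noteq> 0" using nz(2) by auto
  have ka: "k2 * u11 = a 2 1 - l2 * a 0 1" "k3 * u11 = a 3 1 - l3 * a 0 1" using u11 unfolding k by auto
  have e2: "a 0 0 * u11 * u22 = cofactor A 3 3"
  proof -
    have "a 0 0 * u11 * u22 = a 0 0 * (u11 * (a 2 2 - l2 * a 0 2) - (k2 * u11) * u12)"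
      unfolding u2 by (simp add: algebra_simps)
    also have "\<dots> = a 0 0 * (u11 * (a 2 2 - l2 * a 0 2) - (a 2 1 - l2 * a 0 1) * u12)" unfolding ka ..
    also have "\<dots> = a 0 0 * (a 1 1 * a 2 2 - a 1 2 * a 2 1) - a 0 1 * ((l1 * a 0 0) * a 2 2 - a 1 2 * (l2 * a 0 0))
        + a 0 2 * ((l1 * a 0 0) * a 2 1 - a 1 1 * (l2 * a 0 0))"
      unfolding u1 by (simp add: algebra_simps)
    finally show ?thesis unfolding la cofactor_3_3[OF A] by (simp add: a_def)
  qed
  then have u22: "u22 \<noteq> 0" using nz(3) by auto
  have ma: "m3 * u22 = a 3 2 - l3 * a 0 2 - k3 * u12" using u22 unfolding m3_def by simp
  define L where "L = mat 4 4 (\<lambda>(i,j). [[1, 0, 0, 0], [l1, 1, 0, 0], [l2, k2, 1, 0], [l3, k3, m3, 1]] ! i ! j)"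
  define U where "U = mat 4 4 (\<lambda>(i,j). [[a 0 0, a 0 1, a 0 2, a 0 3], [0, u11, u12, u13], [0, 0, u22, u23], [0, 0, 0, u33]] ! i ! j)"
  have L: "L \<in> carrier_mat 4 4" and U: "U \<in> carrier_mat 4 4" unfolding L_def U_def by auto
  have "A = L * U"
  proof (rule eq_matI)
    fix i j assume "i < dim_row (L * U)" "j < dim_col (L * U)"
    then have ij: "i < 4" "j < 4" using L U by auto
    have "(L * U) $$ (i,j) = (\<Sum>k = 0..<4. L $$ (i,k) * U $$ (k,j))" using ij L U by (simp add: scalar_prod_def)
    also have "\<dots> = a i j"
      using ij la ka ma unfolding sum_lt_4 less_4_cases L_def U_def
      by (auto simp: u1 u2 u33_def numeral_3_eq_3 numeral_2_eq_2)
    finally show "A $$ (i,j) = (L * U) $$ (i,j)" unfolding a_def by simp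
  qed (use A L U in auto)
  moreover have "\<forall>i j. i < j \<longrightarrow> j < 4 \<longrightarrow> L $$ (i,j) = 0"
    unfolding L_def less_4_cases by (auto simp: less_Suc_eq numeral_3_eq_3 numeral_2_eq_2)
  moreover have "\<forall>i<4. L $$ (i,i) = 1" unfolding L_def less_4_cases by (auto simp: numeral_3_eq_3 numeral_2_eq_2)
  moreover have "upper_triangular U"
    unfolding upper_triangular_def U_def by (auto simp: less_4_cases less_Suc_eq numeral_3_eq_3 numeral_2_eq_2)
  moreover have "U $$ (0,0) = a 0 0" "U $$ (1,1) = u11" "U $$ (2,2) = u22"
    unfolding U_def by (simp_all add: numeral_2_eq_2)
  ultimately show ?thesis using e1 e2 L U unfolding a_def by (intro bexI[of _ L] bexI[of _ U]) simp_all
qed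

lemma eventually_poly_nonzero:
  fixes P :: "complex poly"
  assumes "P \<noteq> 0"
  shows "eventually (\<lambda>z. poly P z \<noteq> 0) (at a)"
proof -
  have "finite ({z. poly P z = 0} - {a})" using poly_roots_finite[OF assms] by simp
  then have "open (- ({z. poly P z = 0} - {a}))" by (intro open_Compl finite_imp_closed)
  then show ?thesis unfolding eventually_at_topological by (intro exI[of _ "- ({z. poly P z = 0} - {a})"]) auto
qed

context highest_weight_rep
begin

text \<open>In A = L U the factor \<open>U\<close> acts on \<open>v\<close> through
  \<open>hw_char\<close>, the factor \<open>L\<close> contributes the value 1 of \<xi>, and the
  partial products of the diagonal of \<open>U\<close> are the leading minors of
  \<open>A\<close>.\<close>

lemma extremal_coefficient_big_cell:
  assumes \<xi>: "\<And>A. A \<in> carrier (SL 4) \<Longrightarrow> (\<forall>i j. i < j \<longrightarrow> j < 4 \<longrightarrow> A $$ (i,j) = 0) \<Longrightarrow>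
      (\<forall>i<4. A $$ (i,i) = 1) \<Longrightarrow> \<xi> \<bullet> (\<rho> A *\<^sub>v v) = 1" "\<xi> \<in> carrier_vec d"
    and A: "A \<in> carrier (SL 4)" and nz: "A $$ (0,0) \<noteq> 0" "minor2 A 0 1 \<noteq> 0" "cofactor A 3 3 \<noteq> 0"
  shows "\<xi> \<bullet> (\<rho> A *\<^sub>v v) = flag_monomial p q r A"
proof -
  have Ac: "A \<in> carrier_mat 4 4" "det A = 1" using A unfolding carrier_SL by auto
  obtain L U where L: "L \<in> carrier_mat 4 4" "\<forall>i j. i < j \<longrightarrow> j < 4 \<longrightarrow> L $$ (i,j) = 0" "\<forall>i<4. L $$ (i,i) = 1"
    and U: "U \<in> carrier_mat 4 4" "upper_triangular U" and AU: "A = L * U"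
    and e: "U $$ (0,0) = A $$ (0,0)" "U $$ (0,0) * U $$ (1,1) = minor2 A 0 1"
      "U $$ (0,0) * U $$ (1,1) * U $$ (2,2) = cofactor A 3 3"
    using lu_decomposition[OF Ac(1) nz] by blast
  have "det L = det (transpose_mat L)" using det_transpose[OF L(1)] by simp
  also have "\<dots> = (\<Prod>i<4. transpose_mat L $$ (i,i))"
    by (rule det_upper_triangular_prod) (use L in \<open>auto simp: upper_triangular_def\<close>)
  also have "\<dots> = 1" using L by simp
  finally have LS: "L \<in> carrier (SL 4)" using L(1) unfolding carrier_SL by simp
  have US: "U \<in> carrier (SL 4)" using det_mult[OF L(1) U(1)] LS Ac(2) U(1) unfolding AU carrier_SL by simp
  have "\<rho> A *\<^sub>v v = \<rho> L *\<^sub>v (hw_char p q r U \<cdot>\<^sub>v v)"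
    unfolding AU rho_mult_vec[OF LS US v_props(1)] upper_triangular_weight[OF US U(2)] ..
  also have "\<dots> = hw_char p q r U \<cdot>\<^sub>v (\<rho> L *\<^sub>v v)" by (rule mult_mat_vec[OF rho_carrier[OF LS] v_props(1)])
  finally have "\<xi> \<bullet> (\<rho> A *\<^sub>v v) = hw_char p q r U * (\<xi> \<bullet> (\<rho> L *\<^sub>v v))"
    using \<xi>(2) rho_carrier[OF LS] v_props(1) by simp
  also have "\<xi> \<bullet> (\<rho> L *\<^sub>v v) = 1" using \<xi>(1)[OF LS L(2,3)] .
  finally show ?thesis unfolding hw_char_expand e(3) unfolding e(2) unfolding e(1) flag_monomial_def by simp
qed

text \<open>
  The big cell is dense: \<open>A\<close> is the limit at \<open>z = 1\<close> of \<open>(1 - z) 1 + z A\<close> with the last column rescaled to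
  determinant 1, which leaves the three leading minors unchanged.
\<close>

theorem extremal_coefficient:
  "\<exists>\<xi>\<in>carrier_vec d. \<forall>A\<in>carrier (SL 4). \<xi> \<bullet> (\<rho> A *\<^sub>v v) = flag_monomial p q r A"
proof -
  obtain \<xi> where \<xi>: "\<xi> \<in> carrier_vec d" "\<And>A. A \<in> carrier (SL 4) \<Longrightarrow> (\<forall>i j. i < j \<longrightarrow> j < 4 \<longrightarrow> A $$ (i,j) = 0) \<Longrightarrow>
      (\<forall>i<4. A $$ (i,i) = 1) \<Longrightarrow> \<xi> \<bullet> (\<rho> A *\<^sub>v v) = 1"
    using extremal_row_exists by blast
  obtain F where F: "polynomial_fun 4 F" "\<And>A. A \<in> carrier (SL 4) \<Longrightarrow> \<xi> \<bullet> (\<rho> A *\<^sub>v v) = F A"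
    using coefficient_polynomial[OF \<xi>(1) v_props(1)] by blast
  show ?thesis
  proof (rule bexI[OF _ \<xi>(1)], rule ballI)
    fix A assume A: "A \<in> carrier (SL 4)"
    have Ac: "A \<in> carrier_mat 4 4" "det A = 1" using A unfolding carrier_SL by auto
    define E where "E = (\<lambda>z::complex. mat 4 4 (\<lambda>(i,j). (1 - z) * (if i = j then 1 else 0) + z * A $$ (i,j)))"
    define m where "m = (\<lambda>i j. [:(if i = j then 1 else 0), A $$ (i,j) - (if i = j then 1 else 0):])"
    have Ec: "E z \<in> carrier_mat 4 4" for z unfolding E_def by simp
    have Em: "E z $$ (i,j) = poly (m i j) z" if "i < 4" "j < 4" for i j z
      using that unfolding E_def m_def by (simp add: algebra_simps)
    have E0: "E 0 = 1\<^sub>m 4" unfolding E_def by (intro eq_matI) auto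
    have E1: "E 1 = A" unfolding E_def using Ac by (intro eq_matI) auto
    have "\<exists>P. \<forall>z. det (E z) = poly P z"
    proof -
      obtain f where f: "polynomial_fun 4 f" "\<forall>A\<in>carrier_mat 4 4. f A = det A" using polynomial_fun_det by blast
      define e where "e = Max ((\<lambda>(i,j). degree (m i j)) ` ({..<4} \<times> {..<4}))"
      have "\<forall>i<4. \<forall>j<4. degree (m i j) \<le> e" unfolding e_def by (auto intro!: Max_ge)
      then obtain P where "\<forall>M z. (\<forall>i<4. \<forall>j<4. M $$ (i,j) = poly (m i j) z) \<longrightarrow> f M = poly P z"
        using polynomial_fun_curve[OF f(1)] by blast
      then show ?thesis using Em f(2) Ec by metis
    qed
    then obtain P where P: "\<And>z. det (E z) = poly P z" by blast
    define B where "B = (\<lambda>z. E z * diagm (\<lambda>i. if i = 3 then 1 / poly P z else 1))"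
    have Bij: "B z $$ (i,j) = E z $$ (i,j) * (if j = 3 then 1 / poly P z else 1)" if "i < 4" "j < 4" for i j z
      unfolding B_def by (rule diagm_mult_right[OF Ec that])
    have Bc: "B z \<in> carrier_mat 4 4" for z unfolding B_def by (rule mult_carrier_mat[OF Ec diagm_carrier])
    have BS: "B z \<in> carrier (SL 4)" if "poly P z \<noteq> 0" for z
      unfolding carrier_SL using that Bc det_mult[OF Ec diagm_carrier] by (simp add: B_def det_diagm prod_lt_4 P)
    define P1 where "P1 = m 0 0"
    define P2 where "P2 = m 0 0 * m 1 1 - m 1 0 * m 0 1"
    define P3 where "P3 = m 0 0 * (m 1 1 * m 2 2 - m 1 2 * m 2 1) - m 0 1 * (m 1 0 * m 2 2 - m 1 2 * m 2 0)
      + m 0 2 * (m 1 0 * m 2 1 - m 1 1 * m 2 0)"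
    have v1: "B z $$ (0,0) = poly P1 z" for z by (simp add: Bij Em P1_def)
    have v2: "minor2 (B z) 0 1 = poly P2 z" for z by (simp add: minor2_def Bij Em P2_def)
    have v3: "cofactor (B z) 3 3 = poly P3 z" for z unfolding cofactor_3_3[OF Bc] by (simp add: Bij Em P3_def)
    have "poly P 0 = 1" using P[of 0] unfolding E0 by simp
    moreover have "poly P1 0 = 1" "poly P2 0 = 1" "poly P3 0 = 1" by (simp_all add: P1_def P2_def P3_def m_def)
    ultimately have "P \<noteq> 0" "P1 \<noteq> 0" "P2 \<noteq> 0" "P3 \<noteq> 0" by auto
    then have ev: "eventually (\<lambda>z. poly P z \<noteq> 0 \<and> poly P1 z \<noteq> 0 \<and> poly P2 z \<noteq> 0 \<and> poly P3 z \<noteq> 0) (at 1)"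
      by (intro eventually_conj eventually_poly_nonzero)
    have evF: "eventually (\<lambda>z. F (B z) = flag_monomial p q r (B z)) (at 1)"
    proof (rule eventually_mono[OF ev], elim conjE)
      fix z assume nz: "poly P z \<noteq> 0" "poly P1 z \<noteq> 0" "poly P2 z \<noteq> 0" "poly P3 z \<noteq> 0"
      have "\<xi> \<bullet> (\<rho> (B z) *\<^sub>v v) = flag_monomial p q r (B z)"
        by (rule extremal_coefficient_big_cell[OF \<xi>(2,1) BS[OF nz(1)]]) (simp_all only: v1 v2 v3 nz not_False_eq_True)
      then show "F (B z) = flag_monomial p q r (B z)" unfolding F(2)[OF BS[OF nz(1)]] .
    qed
    have PA: "poly P 1 = 1" using P[of 1] Ac unfolding E1 by simp
    have lim: "((\<lambda>z. B z $$ (i,j)) \<longlongrightarrow> A $$ (i,j)) (at 1)" if ij: "i < 4" "j < 4" for i j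
    proof -
      have "((\<lambda>z. poly (m i j) z * (if j = 3 then 1 / poly P z else 1)) \<longlongrightarrow>
          poly (m i j) 1 * (if j = 3 then 1 / poly P 1 else 1)) (at 1)"
      proof (cases "j = 3")
        case True
        have "poly P 1 \<noteq> 0" using PA by simp
        then have "((\<lambda>z. poly (m i j) z * (1 / poly P z)) \<longlongrightarrow> poly (m i j) 1 * (1 / poly P 1)) (at 1)"
          by (intro tendsto_intros)
        then show ?thesis using True by simp
      next
        case False
        have "((\<lambda>z. poly (m i j) z) \<longlongrightarrow> poly (m i j) 1) (at 1)" by (intro tendsto_intros)
        then show ?thesis using False by simp
      qed
      moreover have "poly (m i j) 1 = A $$ (i,j)" using Em[OF ij, of 1] unfolding E1 by simp
      moreover have "A $$ (i,j) * (if j = 3 then 1 / 1 else 1) = A $$ (i,j)" by simp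
      ultimately show ?thesis unfolding Bij[OF ij] Em[OF ij] PA by (simp only:)
    qed
    have "((\<lambda>z. F (B z)) \<longlongrightarrow> F A) (at 1)" by (rule polynomial_fun_tendsto[OF F(1) lim])
    moreover have "((\<lambda>z. flag_monomial p q r (B z)) \<longlongrightarrow> flag_monomial p q r A) (at 1)"
      unfolding flag_monomial_def minor2_def cofactor_3_3[OF Bc] cofactor_3_3[OF Ac(1)]
      by (intro tendsto_intros lim) simp_all
    then have "((\<lambda>z. F (B z)) \<longlongrightarrow> flag_monomial p q r A) (at 1)"
      by (rule Lim_transform_eventually) (rule eventually_mono[OF evF], simp only:)
    ultimately have "F A = flag_monomial p q r A" by (rule tendsto_unique[OF at_neq_bot])
    then show "\<xi> \<bullet> (\<rho> A *\<^sub>v v) = flag_monomial p q r A" using F(2)[OF A] by simp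
  qed
qed

end

section \<open>The multinomial theorem in three groups of variables\<close>

definition exps_of_degrees :: "(nat \<Rightarrow> nat) \<Rightarrow> nat \<Rightarrow> (nat \<Rightarrow> nat) \<Rightarrow> (nat \<Rightarrow> nat) set" where
  "exps_of_degrees dg n P = {e \<in> exponents n. \<forall>k<3. multideg dg n e k = P k}"

text \<open>What matters later is positivity of the coefficients, not their values. They are
  produced by induction on the number of variables, expanding the power that contains the new
  variable by the binomial theorem.\<close>

lemma multinomial_positive:
  assumes dg: "\<And>i. dg i < (3 :: nat)"
  shows "\<exists>c :: (nat \<Rightarrow> nat) \<Rightarrow> real. (\<forall>e. c e > 0) \<and> (\<forall>a :: nat \<Rightarrow> complex.
    (\<Prod>k<3. (\<Sum>i<n. if dg i = k then a i else 0) ^ P k) =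
    (\<Sum>e\<in>exps_of_degrees dg n P. of_real (c e) * (\<Prod>i<n. a i ^ e i)))"
proof (induction n arbitrary: P)
  case 0
  show ?case
  proof (intro exI[of _ "\<lambda>_. 1"] conjI allI)
    fix a :: "nat \<Rightarrow> complex"
    have md: "multideg dg 0 e k = 0" for e k by (simp add: multideg_def[OF dg])
    show "(\<Prod>k<3. (\<Sum>i<0. if dg i = k then a i else 0) ^ P k) =
        (\<Sum>e\<in>exps_of_degrees dg 0 P. of_real 1 * (\<Prod>i<0. a i ^ e i))"
    proof (cases "\<forall>k<3. P k = 0")
      case True
      then have "exps_of_degrees dg 0 P = {\<lambda>_. 0}"
        unfolding exps_of_degrees_def exponents_def md by auto
      then show ?thesis using True by simp
    next
      case False
      then have "exps_of_degrees dg 0 P = {}" unfolding exps_of_degrees_def md by auto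
      moreover obtain k where "k < 3" "P k \<noteq> 0" using False by auto
      then have "(\<Prod>k<3. (0 :: complex) ^ P k) = 0" by (intro prod_zero) (auto intro!: bexI[of _ k])
      ultimately show ?thesis by simp
    qed
  qed simp
next
  case (Suc n)
  define k0 where "k0 = dg n"
  have k0: "k0 < 3" unfolding k0_def by (rule dg)
  \<comment> \<open>The degrees left for the first \<open>n\<close> variables when the new variable,
    which belongs to group \<open>k0\<close>, is used \<open>j\<close> times.\<close>
  define Q where "Q = (\<lambda>j. P(k0 := P k0 - j))"
  have "\<forall>j. \<exists>c :: (nat \<Rightarrow> nat) \<Rightarrow> real. (\<forall>e. c e > 0) \<and> (\<forall>a :: nat \<Rightarrow> complex.
    (\<Prod>k<3. (\<Sum>i<n. if dg i = k then a i else 0) ^ Q j k) =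
    (\<Sum>e\<in>exps_of_degrees dg n (Q j). of_real (c e) * (\<Prod>i<n. a i ^ e i)))"
    using Suc.IH by blast
  from choice[OF this] obtain c :: "nat \<Rightarrow> (nat \<Rightarrow> nat) \<Rightarrow> real" where c0: "\<forall>j. (\<forall>e. c j e > 0) \<and>
    (\<forall>a :: nat \<Rightarrow> complex. (\<Prod>k<3. (\<Sum>i<n. if dg i = k then a i else 0) ^ Q j k) =
    (\<Sum>e\<in>exps_of_degrees dg n (Q j). of_real (c j e) * (\<Prod>i<n. a i ^ e i)))" ..
  have c: "c j e > 0"
    "(\<Prod>k<3. (\<Sum>i<n. if dg i = k then (a i :: complex) else 0) ^ Q j k) =
      (\<Sum>e\<in>exps_of_degrees dg n (Q j). of_real (c j e) * (\<Prod>i<n. a i ^ e i))" for j e a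
    using c0[THEN spec, of j] by simp_all
  \<comment> \<open>The value 1 is a filler: no exponent of multidegree \<open>P\<close> has
    \<open>e n > P k0\<close>, but positivity is claimed for all \<open>e\<close>.\<close>
  define c' where "c' = (\<lambda>e. if e n \<le> P k0 then real (P k0 choose e n) * c (e n) (e(n := 0)) else 1)"
  show ?case
  proof (intro exI[of _ c'] conjI allI)
    show "c' e > 0" for e unfolding c'_def using c(1) by simp
    fix a :: "nat \<Rightarrow> complex"
    define S where "S = (\<lambda>k. \<Sum>i<n. if dg i = k then a i else 0)"
    have split: "(\<Prod>k<3. f k) = f k0 * (\<Prod>k\<in>{..<3}-{k0}. f k)" for f :: "nat \<Rightarrow> complex"
      using k0 by (intro prod.remove) auto
    have "(\<Prod>k<3. (\<Sum>i<Suc n. if dg i = k then a i else 0) ^ P k) =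
        (S k0 + a n) ^ P k0 * (\<Prod>k\<in>{..<3}-{k0}. S k ^ P k)"
      unfolding split S_def by (auto simp: k0_def intro!: prod.cong)
    also have "(S k0 + a n) ^ P k0 = (\<Sum>j\<le>P k0. of_nat (P k0 choose j) * a n ^ j * S k0 ^ (P k0 - j))"
      unfolding add.commute[of "S k0"] by (rule binomial_ring)
    also have "\<dots> * (\<Prod>k\<in>{..<3}-{k0}. S k ^ P k) =
        (\<Sum>j\<le>P k0. of_nat (P k0 choose j) * a n ^ j * (\<Prod>k<3. S k ^ Q j k))"
    proof -
      have "(\<Prod>k<3. S k ^ Q j k) = S k0 ^ (P k0 - j) * (\<Prod>k\<in>{..<3}-{k0}. S k ^ P k)" for j
        unfolding split Q_def by (auto intro!: prod.cong)
      then show ?thesis by (simp add: sum_distrib_right mult.assoc)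
    qed
    also have "\<dots> = (\<Sum>j\<le>P k0. \<Sum>e\<in>exps_of_degrees dg n (Q j).
        of_nat (P k0 choose j) * a n ^ j * (of_real (c j e) * (\<Prod>i<n. a i ^ e i)))"
      unfolding S_def c(2) sum_distrib_left ..
    also have "\<dots> = (\<Sum>(j, e)\<in>(SIGMA j:{..P k0}. exps_of_degrees dg n (Q j)).
        of_nat (P k0 choose j) * a n ^ j * (of_real (c j e) * (\<Prod>i<n. a i ^ e i)))"
    proof (rule sum.Sigma)
      show "\<forall>j\<in>{..P k0}. finite (exps_of_degrees dg n (Q j))"
      proof
        fix j
        have "exps_of_degrees dg n (Q j) \<subseteq> exps_of_deg dg n (Q j 0) (Q j 1) (Q j 2)"
        proof
          fix e assume "e \<in> exps_of_degrees dg n (Q j)"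
          then have "e \<in> exponents n" "\<forall>k<3. multideg dg n e k = Q j k" unfolding exps_of_degrees_def by simp_all
          then show "e \<in> exps_of_deg dg n (Q j 0) (Q j 1) (Q j 2)" by (simp add: exps_of_deg_def[OF dg])
        qed
        then show "finite (exps_of_degrees dg n (Q j))" by (rule finite_subset) (rule finite_exps_of_deg[OF dg])
      qed
    qed simp
    also have "\<dots> = (\<Sum>e\<in>exps_of_degrees dg (Suc n) P. of_real (c' e) * (\<Prod>i<Suc n. a i ^ e i))"
    proof (rule sum.reindex_bij_witness[of _ "\<lambda>e. (e n, e(n := 0))" "\<lambda>(j, e). e(n := j)"])
      fix x assume "x \<in> (SIGMA j:{..P k0}. exps_of_degrees dg n (Q j))"
      then obtain j e where x: "x = (j, e)" "j \<le> P k0" "e \<in> exps_of_degrees dg n (Q j)" by auto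
      have en: "e n = 0" "\<forall>i\<ge>n. e i = 0" using x(3) unfolding exps_of_degrees_def exponents_def by auto
      have md: "multideg dg (Suc n) (e(n := j)) k = Q j k + (if k0 = k then j else 0)" if "k < 3" for k
        using x(3) that multideg_upd[where n = n and e = e and v = j and k = k, OF dg] unfolding exps_of_degrees_def k0_def
        by (simp add: multideg_Suc[OF dg])
      show "(\<lambda>e. (e n, e(n := 0))) (case x of (j, e) \<Rightarrow> e(n := j)) = x" unfolding x(1) using en(1) by auto
      show "(case x of (j, e) \<Rightarrow> e(n := j)) \<in> exps_of_degrees dg (Suc n) P"
        unfolding x(1) exps_of_degrees_def using en(2) md x(2) by (auto simp: exponents_def Q_def)
      have "(\<Prod>i<n. a i ^ (e(n := j)) i) = (\<Prod>i<n. a i ^ e i)" by (intro prod.cong) auto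
      moreover have "(e(n := j))(n := 0) = e" using en(1) by auto
      ultimately show "of_real (c' (case x of (j, e) \<Rightarrow> e(n := j))) * (\<Prod>i<Suc n. a i ^ (case x of (j, e) \<Rightarrow> e(n := j)) i) =
          (case x of (j, e) \<Rightarrow> of_nat (P k0 choose j) * a n ^ j * (of_real (c j e) * (\<Prod>i<n. a i ^ e i)))"
        unfolding x(1) c'_def using x(2) by simp
    next
      fix e assume e: "e \<in> exps_of_degrees dg (Suc n) P"
      have md: "multideg dg n (e(n := 0)) k + (if k0 = k then e n else 0) = P k" if "k < 3" for k
        using e that multideg_upd[where n = n and e = e and v = 0 and k = k, OF dg] unfolding exps_of_degrees_def k0_def
        by (simp add: multideg_Suc[OF dg])
      show "(case (e n, e(n := 0)) of (j, e) \<Rightarrow> e(n := j)) = e" by simp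
      have "e(n := 0) \<in> exponents n" using e unfolding exps_of_degrees_def exponents_def by (auto simp: Suc_le_eq)
      moreover have "e n \<le> P k0" using md[OF k0] by simp
      moreover have "multideg dg n (e(n := 0)) k = Q (e n) k" if "k < 3" for k
        using md[OF that] unfolding Q_def by (cases "k = k0") auto
      ultimately show "(e n, e(n := 0)) \<in> (SIGMA j:{..P k0}. exps_of_degrees dg n (Q j))"
        unfolding exps_of_degrees_def by simp
    qed
    finally show "(\<Prod>k<3. (\<Sum>i<Suc n. if dg i = k then a i else 0) ^ P k) =
      (\<Sum>e\<in>exps_of_degrees dg (Suc n) P. of_real (c' e) * (\<Prod>i<Suc n. a i ^ e i))" .
  qed
qed

lemma multinomial_three_degrees:
  assumes dg: "\<And>i. dg i < (3 :: nat)"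
  shows "\<exists>c :: (nat \<Rightarrow> nat) \<Rightarrow> real. (\<forall>e. c e > 0) \<and> (\<forall>a :: nat \<Rightarrow> complex.
    (\<Sum>i<n. if dg i = 0 then a i else 0) ^ p * (\<Sum>i<n. if dg i = 1 then a i else 0) ^ q *
    (\<Sum>i<n. if dg i = 2 then a i else 0) ^ r =
    (\<Sum>e\<in>exps_of_deg dg n p q r. of_real (c e) * (\<Prod>i<n. a i ^ e i)))"
proof -
  define P where "P = (\<lambda>k :: nat. if k = 0 then p else if k = 1 then q else r)"
  have "k < 3 \<longleftrightarrow> k = 0 \<or> k = 1 \<or> k = 2" for k :: nat by auto
  then have 1: "exps_of_degrees dg n P = exps_of_deg dg n p q r"
    unfolding exps_of_degrees_def exps_of_deg_def[OF dg] P_def by auto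
  have 2: "(\<Prod>k<3. f k ^ P k) = f 0 ^ p * f 1 ^ q * f 2 ^ r" for f :: "nat \<Rightarrow> complex"
    by (simp add: P_def numeral_3_eq_3 numeral_2_eq_2)
  show ?thesis using multinomial_positive[of dg n P, OF dg] unfolding 1 2 .
qed

subsection \<open>The coordinates of the flag variety\<close>

text \<open>
  The coordinates 0 to 3, 4 to 9 and 10 to 13 are the minors of the first one, two and three columns.  The
  last ones are taken as cofactors along the last column, that is, as entries of the last row of the
  inverse, so that Cauchy--Binet becomes multiplicativity of the adjugate.
\<close>

definition pair_index :: "nat \<Rightarrow> nat \<times> nat" where
  "pair_index i = [(0,1), (0,2), (0,3), (1,2), (1,3), (2,3)] ! i"

definition flag_coord :: "nat \<Rightarrow> complex mat \<Rightarrow> complex" where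
  "flag_coord i A = (if i < 4 then A $$ (i,0)
     else if i < 10 then minor2 A (fst (pair_index (i - 4))) (snd (pair_index (i - 4)))
     else cofactor A (i - 10) 3)"

definition flag_deg :: "nat \<Rightarrow> nat" where
  "flag_deg i = (if i < 4 then 0 else if i < 10 then 1 else 2)"

lemma flag_deg_less: "flag_deg i < 3"
  unfolding flag_deg_def by simp

lemma sum_lt_14:
  "(\<Sum>i<14. f i) = f 0 + f 1 + f 2 + f 3 + (f 4 + f 5 + f 6 + f 7 + f 8 + f 9) + (f 10 + f 11 + f 12 + (f 13 :: complex))"
  for f :: "nat \<Rightarrow> complex"
  by (simp add: eval_nat_numeral)

text \<open>At determinant 1 the adjugate is the inverse, which reverses products.\<close>

lemma adj_mat_mult:
  fixes A B :: "complex mat"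
  assumes A: "A \<in> carrier_mat n n" "det A = 1" and B: "B \<in> carrier_mat n n" "det B = 1"
  shows "adj_mat (A * B) = adj_mat B * adj_mat A"
proof -
  have a: "adj_mat A \<in> carrier_mat n n" "A * adj_mat A = 1\<^sub>m n" using adj_mat[OF A(1)] A(2) by auto
  have b: "adj_mat B \<in> carrier_mat n n" "B * adj_mat B = 1\<^sub>m n" using adj_mat[OF B(1)] B(2) by auto
  have AB: "A * B \<in> carrier_mat n n" using A(1) B(1) by simp
  have c: "adj_mat (A * B) \<in> carrier_mat n n" "adj_mat (A * B) * (A * B) = 1\<^sub>m n"
    using adj_mat[OF AB] det_mult[OF A(1) B(1)] A(2) B(2) by auto
  have "(A * B) * (adj_mat B * adj_mat A) = A * (B * adj_mat B) * adj_mat A"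
    using A(1) B(1) a(1) b(1) by (simp add: assoc_mult_mat[of _ n n _ n _ n])
  also have "\<dots> = 1\<^sub>m n" unfolding b(2) using A(1) a by simp
  finally have e: "(A * B) * (adj_mat B * adj_mat A) = 1\<^sub>m n" .
  have ba: "adj_mat B * adj_mat A \<in> carrier_mat n n" using a(1) b(1) by simp
  have "adj_mat (A * B) = adj_mat (A * B) * ((A * B) * (adj_mat B * adj_mat A))"
    unfolding e using c(1) by simp
  also have "\<dots> = (adj_mat (A * B) * (A * B)) * (adj_mat B * adj_mat A)"
    by (rule assoc_mult_mat[OF c(1) AB ba, symmetric])
  also have "\<dots> = adj_mat B * adj_mat A" unfolding c(2) using ba by (rule left_mult_one_mat)
  finally show ?thesis .
qed

lemma cofactor_adj: "A \<in> carrier_mat 4 4 \<Longrightarrow> i < 4 \<Longrightarrow> j < 4 \<Longrightarrow> cofactor A i j = adj_mat A $$ (j,i)"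
  unfolding adj_mat_def by simp

lemma mat_delete_transpose:
  "A \<in> carrier_mat n n \<Longrightarrow> i < n \<Longrightarrow> j < n \<Longrightarrow> mat_delete (transpose_mat A) i j = transpose_mat (mat_delete A j i)"
  by (intro eq_matI) (auto simp: mat_delete_def)

lemma cofactor_transpose:
  fixes A :: "complex mat"
  assumes A: "A \<in> carrier_mat n n" "i < n" "j < n"
  shows "cofactor (transpose_mat A) i j = cofactor A j i"
  unfolding cofactor_def mat_delete_transpose[OF assms]
  using det_transpose[of "mat_delete A j i" "n - 1"] mat_delete_carrier[OF A(1)] by (simp add: add.commute)

text \<open>The Cauchy-Binet formula for the leading minor of size 2, verified by expanding both
  sides.\<close>

lemma minor2_mult_transpose:
  assumes A: "A \<in> carrier_mat 4 4" and B: "B \<in> carrier_mat 4 4"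
  shows "minor2 (transpose_mat B * A) 0 1 = (\<Sum>k<6. minor2 A (fst (pair_index k)) (snd (pair_index k)) *
    minor2 B (fst (pair_index k)) (snd (pair_index k)))"
proof -
  have ent: "(transpose_mat B * A) $$ (i,j) = B $$ (0,i) * A $$ (0,j) + B $$ (1,i) * A $$ (1,j) +
      B $$ (2,i) * A $$ (2,j) + B $$ (3,i) * A $$ (3,j)" if "i < 4" "j < 4" for i j
    using that A B by (simp add: scalar_prod_def sum_lt_4)
  have s: "(\<Sum>k<6. f k) = f 0 + f 1 + f 2 + f 3 + f 4 + (f 5 :: complex)" for f :: "nat \<Rightarrow> complex"
    by (simp add: eval_nat_numeral)
  have pi: "pair_index 0 = (0,1)" "pair_index 1 = (0,2)" "pair_index 2 = (0,3)"
    "pair_index 3 = (1,2)" "pair_index 4 = (1,3)" "pair_index 5 = (2,3)"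
    by (simp_all add: pair_index_def)
  show ?thesis unfolding s pi fst_conv snd_conv minor2_def by (simp add: ent) (simp add: algebra_simps)
qed

text \<open>By Cauchy-Binet each leading minor of the product is a sum, over row sets, of a minor of
  \<open>A\<close> times the same minor of \<open>B\<close>. Transposing \<open>B\<close> is what
  makes the same coordinate functions appear in both factors.\<close>

lemma flag_monomial_kernel:
  assumes A: "A \<in> carrier (SL 4)" and B: "B \<in> carrier (SL 4)"
  shows "flag_monomial p q r (transpose_mat B * A) =
    (\<Sum>i<14. if flag_deg i = 0 then flag_coord i A * flag_coord i B else 0) ^ p *
    (\<Sum>i<14. if flag_deg i = 1 then flag_coord i A * flag_coord i B else 0) ^ q *
    (\<Sum>i<14. if flag_deg i = 2 then flag_coord i A * flag_coord i B else 0) ^ r"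
proof -
  have Ac: "A \<in> carrier_mat 4 4" "det A = 1" and Bc: "B \<in> carrier_mat 4 4" "det B = 1"
    using A B unfolding carrier_SL by auto
  have Bt: "transpose_mat B \<in> carrier_mat 4 4" "det (transpose_mat B) = 1" using Bc det_transpose[OF Bc(1)] by auto
  have "(transpose_mat B * A) $$ (0,0) = (\<Sum>i<14. if flag_deg i = 0 then flag_coord i A * flag_coord i B else 0)"
    unfolding sum_lt_14 flag_deg_def flag_coord_def using Ac(1) Bc(1)
    by (simp add: scalar_prod_def sum_lt_4 mult.commute)
  moreover have "minor2 (transpose_mat B * A) 0 1 = (\<Sum>i<14. if flag_deg i = 1 then flag_coord i A * flag_coord i B else 0)"
  proof -
    have "(\<Sum>k<6. f k) = f 0 + f 1 + f 2 + f 3 + f 4 + (f 5 :: complex)" for f :: "nat \<Rightarrow> complex"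
      by (simp add: eval_nat_numeral)
    then show ?thesis unfolding minor2_mult_transpose[OF Ac(1) Bc(1)] sum_lt_14 flag_deg_def flag_coord_def by simp
  qed
  moreover have "cofactor (transpose_mat B * A) 3 3 = (\<Sum>i<14. if flag_deg i = 2 then flag_coord i A * flag_coord i B else 0)"
  proof -
    have "cofactor (transpose_mat B * A) 3 3 = (adj_mat A * adj_mat (transpose_mat B)) $$ (3,3)"
      using Ac Bt by (simp add: cofactor_adj adj_mat_mult[OF Bt Ac])
    also have "\<dots> = (\<Sum>k = 0..<4. adj_mat A $$ (3,k) * adj_mat (transpose_mat B) $$ (k,3))"
      using adj_mat(1)[OF Ac(1)] adj_mat(1)[OF Bt(1)] by (simp add: scalar_prod_def)
    also have "\<dots> = (\<Sum>k = 0..<4. cofactor A k 3 * cofactor B k 3)"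
      using Ac(1) Bc(1) Bt(1) by (intro sum.cong refl) (simp add: cofactor_transpose[of _ 4] flip: cofactor_adj)
    finally show ?thesis unfolding sum_lt_14 flag_deg_def flag_coord_def sum_lt_4 by simp
  qed
  ultimately show ?thesis unfolding flag_monomial_def by simp
qed

text \<open>A minor of the first three columns omits one row; as the product of all
  \<open>x i\<close> is 1, the product of the remaining three is the inverse of the omitted
  one.\<close>

definition flag_weight :: "(nat \<Rightarrow> complex) \<Rightarrow> nat \<Rightarrow> complex" where
  "flag_weight x i = (if i < 4 then x i
     else if i < 10 then x (fst (pair_index (i - 4))) * x (snd (pair_index (i - 4)))
     else 1 / x (i - 10))"

lemma pair_index_less: "i < 6 \<Longrightarrow> fst (pair_index i) < 4 \<and> snd (pair_index i) < 4"
proof -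
  assume "i < 6"
  then have "i = 0 \<or> i = 1 \<or> i = 2 \<or> i = 3 \<or> i = 4 \<or> i = 5" by auto
  then show ?thesis by (auto simp: pair_index_def)
qed

lemma flag_coord_torus:
  assumes x: "(\<Prod>i<4. x i) = 1" and A: "A \<in> carrier (SL 4)" and i: "i < 14"
  shows "flag_coord i (diagm x * A) = flag_weight x i * flag_coord i A"
proof -
  have Ac: "A \<in> carrier_mat 4 4" "det A = 1" using A unfolding carrier_SL by auto
  have D: "diagm x \<in> carrier_mat 4 4" "det (diagm x) = 1" using x by (simp_all add: det_diagm)
  have nz: "x j \<noteq> 0" if "j < 4" for j
    using x that by (metis finite_lessThan lessThan_iff prod_zero_iff zero_neq_one)
  have adjx: "adj_mat (diagm x) = diagm (\<lambda>j. 1 / x j)"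
  proof -
    have a: "adj_mat (diagm x) \<in> carrier_mat 4 4" "adj_mat (diagm x) * diagm x = 1\<^sub>m 4" using adj_mat[OF D(1)] D(2) by auto
    have e: "diagm x * diagm (\<lambda>j. 1 / x j) = 1\<^sub>m 4" unfolding diagm_mult using nz by (intro diagm_one) simp
    have "adj_mat (diagm x) = adj_mat (diagm x) * (diagm x * diagm (\<lambda>j. 1 / x j))" unfolding e using a(1) by simp
    also have "\<dots> = (adj_mat (diagm x) * diagm x) * diagm (\<lambda>j. 1 / x j)"
      by (rule assoc_mult_mat[OF a(1) D(1) diagm_carrier, symmetric])
    finally show ?thesis unfolding a(2) left_mult_one_mat[OF diagm_carrier] .
  qed
  consider "i < 4" | "4 \<le> i" "i < 10" | "10 \<le> i" by linarith
  then show ?thesis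
  proof cases
    case 1
    then show ?thesis unfolding flag_coord_def flag_weight_def using diagm_mult_left[OF Ac(1), of i 0 x] by simp
  next
    case 2
    then have "fst (pair_index (i - 4)) < 4" "snd (pair_index (i - 4)) < 4" using pair_index_less[of "i - 4"] by auto
    then show ?thesis unfolding flag_coord_def flag_weight_def minor2_def using 2 diagm_mult_left[OF Ac(1)]
      by (simp add: algebra_simps)
  next
    case 3
    have DA: "diagm x * A \<in> carrier_mat 4 4" using D Ac by (intro mult_carrier_mat)
    have "cofactor (diagm x * A) (i - 10) 3 = (adj_mat A * diagm (\<lambda>j. 1 / x j)) $$ (3, i - 10)"
      using 3 i by (simp add: cofactor_adj[OF DA] adj_mat_mult[OF D Ac] adjx)
    also have "\<dots> = adj_mat A $$ (3, i - 10) * (1 / x (i - 10))"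
      using 3 i by (intro diagm_mult_right adj_mat(1)[OF Ac(1)]) auto
    finally show ?thesis unfolding flag_coord_def flag_weight_def using 3 i by (simp add: cofactor_adj[OF Ac(1)])
  qed
qed

interpretation cnj_hom: comm_ring_hom cnj
  by unfold_locales simp_all

lemma cnj_SL:
  assumes "A \<in> carrier (SL n)"
  shows "map_mat cnj A \<in> carrier (SL n)"
  using assms unfolding carrier_SL by (simp add: cnj_hom.hom_det)

lemma cofactor_cnj:
  assumes "A \<in> carrier_mat n n" "i < n" "j < n"
  shows "cofactor (map_mat cnj A) i j = cnj (cofactor A i j)"
proof -
  have "mat_delete (map_mat cnj A) i j = map_mat cnj (mat_delete A i j)"
    using assms by (intro eq_matI) (auto simp: mat_delete_def)
  then show ?thesis unfolding cofactor_def by (simp add: cnj_hom.hom_det)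
qed

text \<open>The coordinates are polynomials with integer coefficients in the matrix entries.
  Compatibility with conjugation is the real structure that turns the kernel identity into a sum of
  squares of absolute values.\<close>

lemma flag_coord_cnj:
  assumes A: "A \<in> carrier (SL 4)" and i: "i < 14"
  shows "flag_coord i (map_mat cnj A) = cnj (flag_coord i A)"
proof -
  have Ac: "A \<in> carrier_mat 4 4" using A unfolding carrier_SL by auto
  have "fst (pair_index (i - 4)) < 4" "snd (pair_index (i - 4)) < 4" if "i < 10"
    using pair_index_less[of "i - 4"] that by auto
  then show ?thesis unfolding flag_coord_def minor2_def using i Ac cofactor_cnj[OF Ac, of "i - 10" 3] by auto
qed

subsection \<open>Traces of highest weight representations\<close>

interpretation flag: monomial_functions "carrier (SL 4)" flag_coord 14 flag_deg
  by unfold_locales (rule flag_deg_less)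

lemma transpose_SL: "A \<in> carrier (SL n) \<Longrightarrow> transpose_mat A \<in> carrier (SL n)"
  unfolding carrier_SL using det_transpose[of A n] by auto

text \<open>The Schur decomposition supplies a conjugating matrix of arbitrary nonzero determinant;
  scaling it and its inverse by opposite factors brings both into \<open>SL 4\<close>.\<close>

lemma SL_triangularise:
  assumes g: "g \<in> carrier (SL 4)"
  shows "\<exists>T\<in>carrier (SL 4). \<exists>P\<in>carrier (SL 4). \<exists>Q\<in>carrier (SL 4).
    upper_triangular T \<and> g = P * T * Q \<and> Q * P = 1\<^sub>m 4"
proof -
  have gc: "g \<in> carrier_mat 4 4" "det g = 1" using g unfolding carrier_SL by auto
  obtain as where "char_poly g = (\<Prod>a\<leftarrow>as. [:- a, 1:])" using char_poly_factorized[OF gc(1)] by blast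
  from schur_decomposition_exists[OF gc(1) this] obtain T
    where T: "T \<in> carrier_mat 4 4" "upper_triangular T" "similar_mat g T" by auto
  from T(3) obtain P Q where "similar_mat_wit g T P Q" unfolding similar_mat_def by blast
  then have PQ: "P \<in> carrier_mat 4 4" "Q \<in> carrier_mat 4 4" "P * Q = 1\<^sub>m 4" "Q * P = 1\<^sub>m 4" "g = P * T * Q"
    using gc(1) unfolding similar_mat_wit_def by (auto simp: Let_def)
  \<comment> \<open>A fourth root of the determinant, because scaling a 4 x 4 matrix by
    \<open>c\<close> multiplies its determinant by \<open>c ^ 4\<close>.\<close>
  define c where "c = csqrt (csqrt (det Q))"
  have dPQ: "det P * det Q = 1" using det_mult[OF PQ(1,2)] PQ(3) by simp
  have "c ^ 4 = (c\<^sup>2)\<^sup>2" by (simp flip: power_mult)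
  then have c4: "c ^ 4 = det Q" unfolding c_def by simp
  then have c0: "c \<noteq> 0" using dPQ by auto
  define P' where "P' = c \<cdot>\<^sub>m P"
  define Q' where "Q' = (1 / c) \<cdot>\<^sub>m Q"
  have P': "P' \<in> carrier (SL 4)" unfolding carrier_SL P'_def using PQ(1) c4 dPQ by (auto simp: mult.commute)
  have Q': "Q' \<in> carrier (SL 4)"
    unfolding carrier_SL Q'_def using PQ(2) c0 by (auto simp: power_one_over c4[symmetric])
  have Pc: "P' \<in> carrier_mat 4 4" and Qc: "Q' \<in> carrier_mat 4 4" using P' Q' unfolding carrier_SL by auto
  have smul: "(a \<cdot>\<^sub>m A) * (b \<cdot>\<^sub>m B) = (a * b) \<cdot>\<^sub>m (A * B)"
    if "A \<in> carrier_mat 4 4" "B \<in> carrier_mat 4 4" for a b and A B :: "complex mat"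
    using that by (intro eq_matI) (auto simp: scalar_prod_def sum_distrib_left mult_ac)
  have QP: "Q' * P' = 1\<^sub>m 4"
    unfolding P'_def Q'_def smul[OF PQ(2,1)] PQ(4) using c0 by (intro eq_matI) auto
  have "P' * T * Q' = (c \<cdot>\<^sub>m (P * T)) * ((1 / c) \<cdot>\<^sub>m Q)"
    unfolding P'_def Q'_def using mult_smult_assoc_mat[OF PQ(1) T(1)] by simp
  also have "\<dots> = (c * (1 / c)) \<cdot>\<^sub>m (P * T * Q)" using PQ(1,2) T(1) by (intro smul) auto
  also have "\<dots> = g" using c0 gc(1) PQ(5) by (intro eq_matI) auto
  finally have g': "g = P' * T * Q'" ..
  have "det g = det P' * det T * det Q'"
    unfolding g' using det_mult[OF mult_carrier_mat[OF Pc T(1)] Qc] det_mult[OF Pc T(1)] by simp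
  then have "det T = 1" using P' Q' gc(2) unfolding carrier_SL by simp
  then have "T \<in> carrier (SL 4)" using T(1) unfolding carrier_SL by simp
  then show ?thesis using P' Q' T(2) g' QP by blast
qed

context highest_weight_rep
begin

lemma trace_polynomial: "\<exists>F. polynomial_fun 4 F \<and> (\<forall>A\<in>carrier (SL 4). mat_trace (\<rho> A) = F A)"
proof -
  have "\<forall>i. \<exists>f. polynomial_fun 4 f \<and> (\<forall>A\<in>carrier (SL 4). unit_vec d i \<bullet> (\<rho> A *\<^sub>v unit_vec d i) = f A)"
    using coefficient_polynomial by simp
  then obtain f where f: "\<And>i. polynomial_fun 4 (f i)"
    "\<And>i A. A \<in> carrier (SL 4) \<Longrightarrow> unit_vec d i \<bullet> (\<rho> A *\<^sub>v unit_vec d i) = f i A" by metis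
  have "mat_trace (\<rho> A) = (\<Sum>i<d. f i A)" if A: "A \<in> carrier (SL 4)" for A
  proof -
    have "mat_trace (\<rho> A) = (\<Sum>i<d. \<rho> A $$ (i,i))" using rho_carrier[OF A] unfolding mat_trace_def by simp
    also have "\<dots> = (\<Sum>i<d. f i A)"
    proof (rule sum.cong[OF refl])
      fix i assume "i \<in> {..<d}"
      then have i: "i < d" by simp
      have "unit_vec d i \<bullet> (\<rho> A *\<^sub>v unit_vec d i) = (\<rho> A *\<^sub>v unit_vec d i) $ i"
        using rho_carrier[OF A] i by (intro scalar_prod_left_unit) auto
      also have "\<dots> = \<rho> A $$ (i,i)" using rho_carrier[OF A] i by simp
      finally show "\<rho> A $$ (i,i) = f i A" using f(2)[OF A, of i] by simp
    qed
    finally show ?thesis .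
  qed
  moreover have "polynomial_fun 4 (\<lambda>A. \<Sum>i<d. f i A)" by (intro polynomial_fun_sum f(1))
  ultimately show ?thesis by (intro exI[of _ "\<lambda>A. \<Sum>i<d. f i A"]) simp
qed

lemma trace_conjugate:
  assumes P: "P \<in> carrier (SL 4)" and T: "T \<in> carrier (SL 4)" and Q: "Q \<in> carrier (SL 4)" and QP: "Q * P = 1\<^sub>m 4"
  shows "mat_trace (\<rho> (P * T * Q)) = mat_trace (\<rho> T)"
proof -
  have "\<rho> Q * \<rho> P = 1\<^sub>m d" using rho_mult[OF Q P] QP rho_one by simp
  then show ?thesis unfolding rho_mult[OF SL_mult[OF P T] Q] rho_mult[OF P T]
    using mat_trace_conj[OF rho_carrier[OF P] rho_carrier[OF Q] rho_carrier[OF T]] by simp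
qed

text \<open>
  The trace is constant along \<open>torus (inverse z) * T * torus z\<close>, whose entries are polynomials in \<open>z\<close> and
  which degenerates to the diagonal part of \<open>T\<close> at \<open>z = 0\<close>.
\<close>

lemma trace_triangular:
  assumes T: "T \<in> carrier (SL 4)" and ut: "upper_triangular T"
  shows "mat_trace (\<rho> T) = mat_trace (\<rho> (diagm (\<lambda>i. T $$ (i,i))))"
proof -
  have Tc: "T \<in> carrier_mat 4 4" "det T = 1" using T unfolding carrier_SL by auto
  obtain F where F: "polynomial_fun 4 F" "\<And>A. A \<in> carrier (SL 4) \<Longrightarrow> mat_trace (\<rho> A) = F A"
    using trace_polynomial by blast
  define m where "m = (\<lambda>i j. if i \<le> j then monom (T $$ (i,j)) (2 * (j - i)) else 0)"
  have "degree (m i j) \<le> 6" if "i < 4" "j < 4" for i j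
  proof (cases "i \<le> j")
    case True
    then show ?thesis unfolding m_def using that by (simp, intro order_trans[OF degree_monom_le]) simp
  qed (simp add: m_def)
  then obtain R where R: "\<And>M z. (\<forall>i<4. \<forall>j<4. M $$ (i,j) = poly (m i j) z) \<Longrightarrow> F M = poly R z"
    using polynomial_fun_curve[OF F(1)] by metis
  have "poly R z = mat_trace (\<rho> T)" if z: "z \<noteq> 0" for z
  proof -
    have Z: "torus z \<in> carrier (SL 4)" "torus (inverse z) \<in> carrier (SL 4)" using z by (auto intro: torus_SL)
    let ?M = "torus (inverse z) * T * torus z"
    have ent: "?M $$ (i,j) = poly (m i j) z" if "i < 4" "j < 4" for i j
    proof (cases "i \<le> j")
      case True
      then show ?thesis using torus_conj_upper[OF Tc(1) that z ut] by (simp add: m_def)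
    next
      case False
      then have "T $$ (i,j) = 0" using ut that Tc(1) unfolding upper_triangular_def by auto
      then show ?thesis using torus_conj_upper[OF Tc(1) that z ut] False by (simp add: m_def)
    qed
    have "poly R z = F ?M" using R[of ?M z] ent by simp
    also have "\<dots> = mat_trace (\<rho> ?M)" using F(2) SL_mult[OF SL_mult[OF Z(2) T] Z(1)] by simp
    also have "\<dots> = mat_trace (\<rho> T)" by (rule trace_conjugate[OF Z(2) T Z(1) torus_inverse(1)[OF z]])
    finally show ?thesis .
  qed
  then have "- {0} \<subseteq> {z. poly (R - [:mat_trace (\<rho> T):]) z = 0}" by auto
  moreover have "infinite (- {0 :: complex})" using infinite_UNIV_char_0[where 'a = complex] by (simp add: Compl_eq_Diff_UNIV)
  ultimately have "R - [:mat_trace (\<rho> T):] = 0" using poly_roots_finite finite_subset by blast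
  then have "R = [:mat_trace (\<rho> T):]" by simp
  then have R0: "poly R 0 = mat_trace (\<rho> T)" by simp
  have D: "diagm (\<lambda>i. T $$ (i,i)) \<in> carrier (SL 4)"
    using det_upper_triangular_prod[OF Tc(1) ut] Tc(2) by (intro diagm_SL) simp
  have "diagm (\<lambda>i. T $$ (i,i)) $$ (i,j) = poly (m i j) 0" if "i < 4" "j < 4" for i j
    using that by (simp add: m_def poly_monom)
  then have "F (diagm (\<lambda>i. T $$ (i,i))) = poly R 0" using R by blast
  then show ?thesis using F(2)[OF D] R0 by simp
qed

text \<open>The abstract trace formula is applied to the orbit map of \<open>v\<close>, with left
  multiplication by \<open>diagm x\<close> as \<open>t\<close>. Irreducibility enters twice: the
  orbit of \<open>v\<close> spans the space, and no nonzero vector is annihilated by all translates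
  of \<xi>.\<close>

lemma trace_diagm:
  assumes x: "(\<Prod>i<4. x i) = 1"
  shows "mat_trace (\<rho> (diagm x)) =
    (\<Sum>e\<in>flag.standard \<inter> exps_of_deg flag_deg 14 p q r. exp_weight (flag_weight x) 14 e)"
proof -
  let ?X = "carrier (SL 4)"
  obtain \<xi> where \<xi>: "\<xi> \<in> carrier_vec d" "\<And>A. A \<in> ?X \<Longrightarrow> \<xi> \<bullet> (\<rho> A *\<^sub>v v) = flag_monomial p q r A"
    using extremal_coefficient by blast
  define w where "w = (\<lambda>A. \<rho> A *\<^sub>v v)"
  \<comment> \<open>Defined so that \<open>\<eta> B \<bullet> w A\<close> is the extremal
    coefficient at \<open>transpose_mat B * A\<close>, the argument for which the kernel splits into
    monomials.\<close>
  define \<eta> where "\<eta> = (\<lambda>B. transpose_mat (\<rho> (transpose_mat B)) *\<^sub>v \<xi>)"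
  have w: "w A \<in> carrier_vec d" if "A \<in> ?X" for A
    unfolding w_def using rho_carrier[OF that] v_props(1) by simp
  have \<eta>: "\<eta> B \<in> carrier_vec d" if "B \<in> ?X" for B
    unfolding \<eta>_def using rho_carrier[OF transpose_SL[OF that]] \<xi>(1) by simp
  have \<eta>u: "\<eta> B \<bullet> u = \<xi> \<bullet> (\<rho> (transpose_mat B) *\<^sub>v u)" if "B \<in> ?X" "u \<in> carrier_vec d" for B u
    unfolding \<eta>_def by (rule scalar_prod_row_transpose[OF rho_carrier[OF transpose_SL[OF that(1)]] \<xi>(1) that(2)])
  obtain c :: "(nat \<Rightarrow> nat) \<Rightarrow> real" where c: "\<And>e. c e > 0" "\<And>a :: nat \<Rightarrow> complex.
    (\<Sum>i<14. if flag_deg i = 0 then a i else 0) ^ p * (\<Sum>i<14. if flag_deg i = 1 then a i else 0) ^ q *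
    (\<Sum>i<14. if flag_deg i = 2 then a i else 0) ^ r =
    (\<Sum>e\<in>exps_of_deg flag_deg 14 p q r. of_real (c e) * (\<Prod>i<14. a i ^ e i))"
    using multinomial_three_degrees[of flag_deg 14 p q r, OF flag_deg_less] by blast
  have kernel: "\<eta> B \<bullet> w A =
      (\<Sum>e\<in>exps_of_deg flag_deg 14 p q r. of_real (c e) * flag.mono_fun e A * flag.mono_fun e B)"
    if A: "A \<in> ?X" and B: "B \<in> ?X" for A B
  proof -
    have "\<eta> B \<bullet> w A = \<xi> \<bullet> (\<rho> (transpose_mat B * A) *\<^sub>v v)"
      unfolding \<eta>u[OF B w[OF A]] unfolding w_def rho_mult_vec[OF transpose_SL[OF B] A v_props(1)] by (rule refl)
    also have "\<dots> = flag_monomial p q r (transpose_mat B * A)" by (rule \<xi>(2)[OF SL_mult[OF transpose_SL[OF B] A]])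
    also have "\<dots> = (\<Sum>e\<in>exps_of_deg flag_deg 14 p q r. of_real (c e) * (\<Prod>i<14. (flag_coord i A * flag_coord i B) ^ e i))"
      unfolding flag_monomial_kernel[OF A B] by (rule c(2))
    also have "\<dots> = (\<Sum>e\<in>exps_of_deg flag_deg 14 p q r. of_real (c e) * flag.mono_fun e A * flag.mono_fun e B)"
      unfolding flag.mono_fun_def using A B by (simp add: power_mult_distrib prod.distrib mult.assoc)
    finally show ?thesis .
  qed
  have irr': "\<And>W. subspace_vec d W \<Longrightarrow> (\<And>g u. g \<in> ?X \<Longrightarrow> u \<in> W \<Longrightarrow> \<rho> g *\<^sub>v u \<in> W) \<Longrightarrow>
      W = {0\<^sub>v d} \<or> W = carrier_vec d"
    using irr unfolding irreducible_rep_SL4_def irreducible_rep_iff d_def by blast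
  have w_span: "\<zeta> = 0\<^sub>v d" if \<zeta>: "\<zeta> \<in> carrier_vec d" and z: "\<And>A. A \<in> ?X \<Longrightarrow> \<zeta> \<bullet> w A = 0" for \<zeta>
  proof -
    \<comment> \<open>The annihilator of the annihilator of the orbit of \<open>v\<close>. It is
      invariant and contains \<open>v\<close>, hence is the whole space, so a row vanishing on the
      orbit vanishes identically.\<close>
    define W where "W = {u \<in> carrier_vec d. \<forall>\<theta>\<in>carrier_vec d. (\<forall>A\<in>?X. \<theta> \<bullet> w A = 0) \<longrightarrow> \<theta> \<bullet> u = 0}"
    have "subspace_vec d W"
      unfolding subspace_vec_def W_def by (auto simp: scalar_prod_add_distrib[of _ d])
    moreover have "\<rho> g *\<^sub>v u \<in> W" if g: "g \<in> ?X" and u: "u \<in> W" for g u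
    proof -
      have uc: "u \<in> carrier_vec d" using u unfolding W_def by simp
      have "\<theta> \<bullet> (\<rho> g *\<^sub>v u) = 0" if \<theta>: "\<theta> \<in> carrier_vec d" "\<forall>A\<in>?X. \<theta> \<bullet> w A = 0" for \<theta>
      proof -
        have "(transpose_mat (\<rho> g) *\<^sub>v \<theta>) \<bullet> w A = 0" if A: "A \<in> ?X" for A
        proof -
          have "(transpose_mat (\<rho> g) *\<^sub>v \<theta>) \<bullet> w A = \<theta> \<bullet> w (g * A)"
            unfolding scalar_prod_row_transpose[OF rho_carrier[OF g] \<theta>(1) w[OF A]]
            unfolding w_def rho_mult_vec[OF g A v_props(1)] by (rule refl)
          then show ?thesis using \<theta>(2) SL_mult[OF g A] by simp
        qed
        moreover have "transpose_mat (\<rho> g) *\<^sub>v \<theta> \<in> carrier_vec d" using rho_carrier[OF g] \<theta>(1) by simp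
        ultimately have "(transpose_mat (\<rho> g) *\<^sub>v \<theta>) \<bullet> u = 0" using u unfolding W_def by blast
        then show ?thesis unfolding scalar_prod_row_transpose[OF rho_carrier[OF g] \<theta>(1) uc] .
      qed
      then show ?thesis unfolding W_def using rho_carrier[OF g] uc by auto
    qed
    ultimately have "W = {0\<^sub>v d} \<or> W = carrier_vec d" by (rule irr')
    moreover have "v \<in> W"
    proof -
      have "1\<^sub>m 4 \<in> ?X" unfolding carrier_SL by simp
      moreover have "w (1\<^sub>m 4) = v" unfolding w_def rho_one using v_props(1) by simp
      ultimately show ?thesis unfolding W_def using v_props(1) by force
    qed
    ultimately have "W = carrier_vec d" using v_props(2) by blast
    then have "\<zeta> \<bullet> u = 0" if "u \<in> carrier_vec d" for u using that z \<zeta> unfolding W_def by blast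
    then have "\<zeta> \<bullet> unit_vec d i = 0" for i by simp
    then have "\<zeta> $ i = 0" if "i < d" for i using scalar_prod_right_unit[OF that, of \<zeta>] by simp
    then show ?thesis using \<zeta> by (intro eq_vecI) auto
  qed
  have \<eta>_span: "u = 0\<^sub>v d" if u: "u \<in> carrier_vec d" and z: "\<And>B. B \<in> ?X \<Longrightarrow> \<eta> B \<bullet> u = 0" for u
  proof -
    \<comment> \<open>The vectors annihilated by all translates of \<xi>. This invariant subspace
      misses \<open>v\<close>, on which \<xi> takes the value 1, so it is zero.\<close>
    define W where "W = {u \<in> carrier_vec d. \<forall>g\<in>?X. \<xi> \<bullet> (\<rho> g *\<^sub>v u) = 0}"
    have "subspace_vec d W"
      unfolding subspace_vec_def
    proof (intro conjI ballI allI)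
      show "0\<^sub>v d \<in> W" unfolding W_def using \<xi>(1) by (auto simp: mult_mat_zero_vec[OF rho_carrier])
    next
      fix a b assume "a \<in> W" "b \<in> W"
      then show "a + b \<in> W" unfolding W_def using \<xi>(1) rho_carrier
        by (auto simp: mult_add_distrib_mat_vec[OF rho_carrier] scalar_prod_add_distrib[OF \<xi>(1)]
            mult_mat_vec_carrier[OF rho_carrier])
    next
      fix k a assume "a \<in> W"
      then show "k \<cdot>\<^sub>v a \<in> W" unfolding W_def using \<xi>(1)
        by (auto simp: mult_mat_vec[OF rho_carrier] scalar_prod_smult_distrib[OF \<xi>(1)] mult_mat_vec_carrier[OF rho_carrier])
    qed (simp add: W_def)
    moreover have "\<rho> g *\<^sub>v a \<in> W" if g: "g \<in> ?X" and a: "a \<in> W" for g a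
    proof -
      have ac: "a \<in> carrier_vec d" using a unfolding W_def by simp
      have "\<xi> \<bullet> (\<rho> h *\<^sub>v (\<rho> g *\<^sub>v a)) = 0" if "h \<in> ?X" for h
      proof -
        have "\<xi> \<bullet> (\<rho> (h * g) *\<^sub>v a) = 0" using a SL_mult[OF that g] unfolding W_def by blast
        then show ?thesis unfolding rho_mult_vec[OF that g ac] .
      qed
      then show ?thesis unfolding W_def using rho_carrier[OF g] ac by simp
    qed
    ultimately have "W = {0\<^sub>v d} \<or> W = carrier_vec d" by (rule irr')
    moreover have "v \<notin> W"
    proof -
      have one: "1\<^sub>m 4 \<in> ?X" unfolding carrier_SL by simp
      have "cofactor (1\<^sub>m 4 :: complex mat) 3 3 = 1" by (simp add: cofactor_3_3)
      then have "flag_monomial p q r (1\<^sub>m 4) = 1" by (simp add: flag_monomial_def minor2_def)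
      then have "\<xi> \<bullet> (\<rho> (1\<^sub>m 4) *\<^sub>v v) = 1" using \<xi>(2)[OF one] by simp
      moreover have "\<xi> \<bullet> (\<rho> (1\<^sub>m 4) *\<^sub>v v) = 0" if "v \<in> W" using that one unfolding W_def by blast
      ultimately show ?thesis by auto
    qed
    ultimately have "W = {0\<^sub>v d}" using v_props(1) by blast
    moreover have "u \<in> W"
    proof -
      have "\<xi> \<bullet> (\<rho> g *\<^sub>v u) = 0" if g: "g \<in> ?X" for g
        using z[OF transpose_SL[OF g]] \<eta>u[OF transpose_SL[OF g] u] by simp
      then show ?thesis unfolding W_def using u by simp
    qed
    ultimately show ?thesis by blast
  qed
  have D: "diagm x \<in> ?X" using x by (rule diagm_SL)
  show ?thesis
  proof (rule flag.trace_standard_monomials[where w = w and \<eta> = \<eta> and c = c and cj = "map_mat cnj" and t = "\<lambda>A. diagm x * A" and d = d])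
    show "\<rho> (diagm x) \<in> carrier_mat d d" by (rule rho_carrier[OF D])
    show "\<rho> (diagm x) *\<^sub>v w A = w (diagm x * A)" if "A \<in> ?X" for A
      unfolding w_def rho_mult_vec[OF D that v_props(1)] by (rule refl)
    show "w A \<in> carrier_vec d" if "A \<in> ?X" for A by (rule w[OF that])
    show "\<eta> B \<in> carrier_vec d" if "B \<in> ?X" for B by (rule \<eta>[OF that])
    show "\<eta> B \<bullet> w A =
        (\<Sum>e\<in>exps_of_deg flag_deg 14 p q r. of_real (c e) * flag.mono_fun e A * flag.mono_fun e B)"
      if "A \<in> ?X" "B \<in> ?X" for A B by (rule kernel[OF that])
    show "c e > 0" for e by (rule c(1))
    show "map_mat cnj A \<in> ?X" if "A \<in> ?X" for A by (rule cnj_SL[OF that])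
    show "flag_coord i (map_mat cnj A) = cnj (flag_coord i A)" if "A \<in> ?X" "i < 14" for A i
      by (rule flag_coord_cnj[OF that])
    show "\<zeta> = 0\<^sub>v d" if "\<zeta> \<in> carrier_vec d" "\<And>A. A \<in> ?X \<Longrightarrow> \<zeta> \<bullet> w A = 0" for \<zeta> by (rule w_span[OF that])
    show "u = 0\<^sub>v d" if "u \<in> carrier_vec d" "\<And>B. B \<in> ?X \<Longrightarrow> \<eta> B \<bullet> u = 0" for u by (rule \<eta>_span[OF that])
    show "diagm x * A \<in> ?X" if "A \<in> ?X" for A by (rule SL_mult[OF D that])
    show "flag_coord i (diagm x * A) = flag_weight x i * flag_coord i A" if "A \<in> ?X" "i < 14" for A i
      by (rule flag_coord_torus[OF x that])
  qed
qed

end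

section \<open>Rationality of the multiplicity series\<close>

theorem theorem1:
  fixes \<Gamma> :: "complex mat set"
    and l :: nat
    and \<gamma> :: "nat \<Rightarrow> complex mat \<Rightarrow> complex mat"
    and \<pi> :: "nat \<Rightarrow> nat \<Rightarrow> nat \<Rightarrow> complex mat \<Rightarrow> complex mat"
  assumes "subgroup \<Gamma> (SL 4)"
    and "finite \<Gamma>"
    and "\<And>i. i \<le> l \<Longrightarrow> irreducible_rep (SL 4\<lparr>carrier := \<Gamma>\<rparr>) (\<gamma> i)"
    and "\<And>i j. i \<le> l \<Longrightarrow> j \<le> l \<Longrightarrow> equivalent_rep (SL 4\<lparr>carrier := \<Gamma>\<rparr>) (\<gamma> i) (\<gamma> j) \<Longrightarrow> i = j"
    and "\<And>\<sigma>. irreducible_rep (SL 4\<lparr>carrier := \<Gamma>\<rparr>) \<sigma> \<Longrightarrow>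
           \<exists>i\<le>l. equivalent_rep (SL 4\<lparr>carrier := \<Gamma>\<rparr>) \<sigma> (\<gamma> i)"
    and "equivalent_rep (SL 4\<lparr>carrier := \<Gamma>\<rparr>) (\<gamma> 0) trivial_rep"
    and "\<And>p q r. irreducible_rep_SL4 p q r (\<pi> p q r)"
  shows "\<exists>(N :: nat \<Rightarrow> rat poly poly poly) (D :: rat poly poly poly).
           D \<noteq> 0 \<and>
           (\<forall>i\<le>l. to_fract (multiplicity_series \<Gamma> \<pi> (\<gamma> i)) =
                   to_fract (fps3_of_poly (N i)) / to_fract (fps3_of_poly D))"
proof -
  let ?G = "SL 4\<lparr>carrier := \<Gamma>\<rparr>"
  let ?N = "of_nat (card \<Gamma>) :: complex"
  have G: "group ?G" by (rule subgroup.subgroup_is_group[OF assms(1) group_SL])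
  have \<Gamma>: "\<Gamma> \<subseteq> carrier (SL 4)" by (rule subgroup.subset[OF assms(1)])
  \<comment> \<open>The diagonal matrix is chosen from \<open>g\<close> before p, q, r are
    quantified; the weights of the Hilbert series must be the same for all (p,q,r).\<close>
  have "\<exists>x. (\<Prod>i<4. x i) = 1 \<and> (\<forall>p q r. mat_trace (\<pi> p q r g) = mat_trace (\<pi> p q r (diagm x)))"
    if g: "g \<in> \<Gamma>" for g
  proof -
    obtain T P Q where T: "T \<in> carrier (SL 4)" "upper_triangular T" and PQ: "P \<in> carrier (SL 4)" "Q \<in> carrier (SL 4)"
      "g = P * T * Q" "Q * P = 1\<^sub>m 4" using SL_triangularise \<Gamma> g by blast
    have Tc: "T \<in> carrier_mat 4 4" "det T = 1" using T(1) unfolding carrier_SL by auto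
    have "mat_trace (\<pi> p q r g) = mat_trace (\<pi> p q r (diagm (\<lambda>i. T $$ (i,i))))" for p q r
    proof -
      interpret highest_weight_rep p q r "\<pi> p q r" by unfold_locales (rule assms(7))
      show ?thesis unfolding PQ(3) trace_conjugate[OF PQ(1) T(1) PQ(2) PQ(4)] by (rule trace_triangular[OF T])
    qed
    moreover have "(\<Prod>i<4. T $$ (i,i)) = 1" using det_upper_triangular_prod[OF Tc(1) T(2)] Tc(2) by simp
    ultimately show ?thesis by (intro exI[of _ "\<lambda>i. T $$ (i,i)"]) blast
  qed
  then obtain x where x: "\<And>g. g \<in> \<Gamma> \<Longrightarrow> (\<Prod>i<4. x g i) = 1"
    "\<And>g p q r. g \<in> \<Gamma> \<Longrightarrow> mat_trace (\<pi> p q r g) = mat_trace (\<pi> p q r (diagm (x g)))" by metis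
  \<comment> \<open>The exponent set \<open>flag.standard\<close> is common to all \<open>g\<close>,
    and only the weights change with \<open>g\<close>.\<close>
  have series: "fps3 (\<lambda>p q r. mat_trace (\<pi> p q r g)) = hilbert_series flag_deg (flag_weight (x g)) 14 flag.standard"
    if g: "g \<in> \<Gamma>" for g
  proof (rule fps3_eqI)
    fix p q r
    interpret highest_weight_rep p q r "\<pi> p q r" by unfold_locales (rule assms(7))
    show "coeff3 (fps3 (\<lambda>p q r. mat_trace (\<pi> p q r g))) p q r =
        coeff3 (hilbert_series flag_deg (flag_weight (x g)) 14 flag.standard) p q r"
      unfolding hilbert_series_def[OF flag_deg_less] coeff3_fps3 x(2)[OF g] by (rule trace_diagm[OF x(1)[OF g]])
  qed
  have rat: "fps3 (\<lambda>p q r. of_nat (multiplicity_rep ?G (\<gamma> i) (\<pi> p q r))) \<in> rational_fps3" if i: "i \<le> l" for i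
  proof -
    have "fps3 (\<lambda>p q r. of_nat (multiplicity_rep ?G (\<gamma> i) (\<pi> p q r))) =
        (\<Sum>g\<in>\<Gamma>. fps3_const (mat_trace (\<gamma> i (inv\<^bsub>?G\<^esub> g)) / ?N) * fps3 (\<lambda>p q r. mat_trace (\<pi> p q r g)))"
    proof (rule fps3_eqI)
      fix p q r
      interpret highest_weight_rep p q r "\<pi> p q r" by unfold_locales (rule assms(7))
      have "representation ?G (\<pi> p q r)"
        by (rule representationI(1)[OF G, of _ d]) (use \<Gamma> in \<open>auto simp: mult_SL one_SL rho_one intro!: rho_carrier rho_mult\<close>)
      then have "of_nat (multiplicity_rep ?G (\<gamma> i) (\<pi> p q r)) =
          (\<Sum>g\<in>\<Gamma>. mat_trace (\<pi> p q r g) * mat_trace (\<gamma> i (inv\<^bsub>?G\<^esub> g))) / ?N"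
        using multiplicity_rep_character[OF G _ assms(3)[OF i]] assms(2) by simp
      also have "\<dots> = (\<Sum>g\<in>\<Gamma>. mat_trace (\<gamma> i (inv\<^bsub>?G\<^esub> g)) / ?N * mat_trace (\<pi> p q r g))"
        by (simp add: sum_divide_distrib mult.commute)
      finally show "coeff3 (fps3 (\<lambda>p q r. of_nat (multiplicity_rep ?G (\<gamma> i) (\<pi> p q r)))) p q r =
          coeff3 (\<Sum>g\<in>\<Gamma>. fps3_const (mat_trace (\<gamma> i (inv\<^bsub>?G\<^esub> g)) / ?N) * fps3 (\<lambda>p q r. mat_trace (\<pi> p q r g))) p q r"
        by (simp add: coeff3_sum)
    qed
    also have "\<dots> \<in> rational_fps3"
    proof (rule rational_fps3_sum, rule rational_fps3_mult_poly[OF poly_fps3.const])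
      fix g assume g: "g \<in> \<Gamma>"
      show "fps3 (\<lambda>p q r. mat_trace (\<pi> p q r g)) \<in> rational_fps3"
        unfolding series[OF g] by (rule hilbert_series_rational[OF flag_deg_less flag.down_closed_standard])
    qed
    finally show ?thesis .
  qed
  show ?thesis unfolding multiplicity_series_def
    by (rule rational_fps3_descent[of l "\<lambda>i p q r. multiplicity_rep ?G (\<gamma> i) (\<pi> p q r)", OF rat])
qed

end
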